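(* For any positive integer $n$, $$\sum_{w\in \bar{D}_{n+1}^{FC}}q^{\mathrm{maj}(w)}=P_n(q)+(q^{2n+1}-q^n)\begin{bmatrix} n-1\\ \lfloor (n-1)/2\rfloor\end{bmatrix}_q+\begin{bmatrix} n+1\\ \lfloor (n+1)/2\rfloor\end{bmatrix}_q,$$ where for $n$ even $$P_n(q):=\sum_{h=1}^{n-1}q^h\sum_{i=0}^{h-1}\begin{bmatrix} h-1\\ i\end{bmatrix}_q+\frac{1}{2}q^n(1+q)\sum_{i=0}^{n-1}\begin{bmatrix} n-1\\ i\end{bmatrix}_q,$$ and for $n$ odd $$P_n(q):=\sum_{h=1}^{n-1}q^h\sum_{i=0}^{h-1}\begin{bmatrix} h-1\\ i\end{bmatrix}_q+\frac{1}{2}q^n(1+q)\sum_{i=0}^{n-1}\begin{bmatrix} n-1\\ i\end{bmatrix}_q+\sum_{h=1}^{(n-1)/2}q^{n-h}\begin{bmatrix} n-h-1\\ (n-1)/2\end{bmatrix}_q+\frac{1}{2}q^n(1+q)\begin{bmatrix} n-1\\ (n-1)/2\end{bmatrix}_q.$$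
   Context: $D_{n+1}$ denotes the Coxeter group with generators $s_1,\dots,s_{n+1}$ whose Coxeter graph is the path $s_1 - s_2-\cdots - s_{n-1}$ together with two further vertices $s_n$ and $s_{n+1}$, each joined to $s_{n-1}$; every edge $\{s,t\}$ has $m_{st}=3$ and all other pairs of distinct generators commute. (For $n=1$, $D_2$ has two commuting generators $s_1,s_2$.) For a Coxeter system $(W,S)$ with length function $\ell$, an element $w\in W$ is fully commutative (FC) if any reduced expression of $w$ can be obtained from any other one by using only commutation relations $st=ts$ (for pairs with $m_{st}=2$). An involution is an element with $w^2=1$ (the identity included). $\bar{D}_{n+1}^{FC}$ is the set of fully commutative involutions of $D_{n+1}$. The right descent set is $\mathrm{Des}_R(w)=\{s\in S:\ell(ws)<\ell(w)\}$, and the major index is $\mathrm{maj}(w)=\sum_{s_i\in \mathrm{Des}_R(w)} i$ (with the generators of $D_{n+1}$ indexed $s_1,\dots,s_{n+1}$ so that $s_1 - s_2-\cdots - s_{n-1}$ is a path in the Coxeter graph and $s_n$, $s_{n+1}$ are the two further vertices joined to $s_{n-1}$). For $0\le k\le n$, $\begin{bmatrix} n\\ k\end{bmatrix}_q=\dfrac{(1-q)\cdots(1-q^n)}{(1-q)\cdots(1-q^k)\,(1-q)\cdots(1-q^{n-k})}$ is the $q$-binomial coefficient. Empty sums are $0$. *)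

theory Defs
  imports "HOL-Algebra.Group" "HOL-Computational_Algebra.Polynomial_Factorial"
begin

section \<open>Coxeter systems\<close>

text \<open>
  A Coxeter system is given by a set \<open>S\<close> of generators and a Coxeter matrix \<open>m\<close>, where
  \<open>m s t = 0\<close> encodes $m_{st} = \infty$ (the corresponding relation is then trivial).
  As \<open>m s s = 1\<close>, every generator is its own inverse. The group presented by the relations
  $(st)^{m_{st}} = 1$ is therefore the monoid with the same presentation, that is, the set of
  words over \<open>S\<close> modulo the congruence generated by these relations.
\<close>

definition coxeter_matrix :: "'a set \<Rightarrow> ('a \<Rightarrow> 'a \<Rightarrow> nat) \<Rightarrow> bool" where
  "coxeter_matrix S m \<longleftrightarrow>
     (\<forall>s\<in>S. \<forall>t\<in>S. m s t = m t s \<and> (m s t = 1 \<longleftrightarrow> s = t))"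

inductive_set cox_rel :: "'a set \<Rightarrow> ('a \<Rightarrow> 'a \<Rightarrow> nat) \<Rightarrow> ('a list \<times> 'a list) set"
  for S :: "'a set" and m :: "'a \<Rightarrow> 'a \<Rightarrow> nat" where
  rel: "u \<in> lists S \<Longrightarrow> v \<in> lists S \<Longrightarrow> s \<in> S \<Longrightarrow> t \<in> S \<Longrightarrow>
          (u @ concat (replicate (m s t) [s, t]) @ v, u @ v) \<in> cox_rel S m"
| refl: "u \<in> lists S \<Longrightarrow> (u, u) \<in> cox_rel S m"
| sym: "(u, v) \<in> cox_rel S m \<Longrightarrow> (v, u) \<in> cox_rel S m"
| trans: "(u, v) \<in> cox_rel S m \<Longrightarrow> (v, w) \<in> cox_rel S m \<Longrightarrow> (u, w) \<in> cox_rel S m"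

definition cox_class :: "'a set \<Rightarrow> ('a \<Rightarrow> 'a \<Rightarrow> nat) \<Rightarrow> 'a list \<Rightarrow> 'a list set" where
  "cox_class S m u = cox_rel S m `` {u}"

definition coxeter_group :: "'a set \<Rightarrow> ('a \<Rightarrow> 'a \<Rightarrow> nat) \<Rightarrow> 'a list set monoid" where
  "coxeter_group S m =
     \<lparr>carrier = lists S // cox_rel S m,
      monoid.mult = (\<lambda>x y. \<Union>u\<in>x. \<Union>v\<in>y. cox_class S m (u @ v)),
      one = cox_class S m []\<rparr>"

text \<open>
  An element \<open>w\<close> of the group is the set of all words that express it. Hence the length of
  an element is the least length of a word in \<open>w\<close>, and the reduced expressions are the
  words in \<open>w\<close> attaining it.
\<close>

definition cox_length :: "'a list set \<Rightarrow> nat" where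
  "cox_length w = (LEAST k. \<exists>u\<in>w. length u = k)"

definition reduced_expressions :: "'a list set \<Rightarrow> 'a list set" where
  "reduced_expressions w = {u \<in> w. length u = cox_length w}"

inductive commutation_step :: "('a \<Rightarrow> 'a \<Rightarrow> nat) \<Rightarrow> 'a list \<Rightarrow> 'a list \<Rightarrow> bool"
  for m :: "'a \<Rightarrow> 'a \<Rightarrow> nat" where
  "m s t = 2 \<Longrightarrow> commutation_step m (u @ [s, t] @ v) (u @ [t, s] @ v)"

definition fully_commutative :: "('a \<Rightarrow> 'a \<Rightarrow> nat) \<Rightarrow> 'a list set \<Rightarrow> bool" where
  "fully_commutative m w \<longleftrightarrow>
     (\<forall>u\<in>reduced_expressions w. \<forall>v\<in>reduced_expressions w. (commutation_step m)\<^sup>*\<^sup>* u v)"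

definition fc_involutions :: "'a set \<Rightarrow> ('a \<Rightarrow> 'a \<Rightarrow> nat) \<Rightarrow> 'a list set set" where
  "fc_involutions S m =
     {w \<in> carrier (coxeter_group S m).
        w \<otimes>\<^bsub>coxeter_group S m\<^esub> w = \<one>\<^bsub>coxeter_group S m\<^esub> \<and> fully_commutative m w}"

definition right_descents :: "'a set \<Rightarrow> ('a \<Rightarrow> 'a \<Rightarrow> nat) \<Rightarrow> 'a list set \<Rightarrow> 'a set" where
  "right_descents S m w =
     {s \<in> S. cox_length (w \<otimes>\<^bsub>coxeter_group S m\<^esub> cox_class S m [s]) < cox_length w}"

text \<open>The generator $s_i$ is the natural number \<open>i\<close>.\<close>

definition maj :: "nat set \<Rightarrow> (nat \<Rightarrow> nat \<Rightarrow> nat) \<Rightarrow> nat list set \<Rightarrow> nat" where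
  "maj S m w = (\<Sum>i\<in>right_descents S m w. i)"

lemma cox_rel_in_lists: "(u, v) \<in> cox_rel S m \<Longrightarrow> u \<in> lists S \<and> v \<in> lists S"
proof (induction rule: cox_rel.induct)
  case (rel u v s t)
  moreover have "set (concat (replicate (m s t) [s, t])) \<subseteq> S"
    using rel by auto
  ultimately show ?case by auto
qed auto

lemma equiv_cox_rel: "equiv (lists S) (cox_rel S m)"
proof (rule equivI)
  show "cox_rel S m \<subseteq> lists S \<times> lists S"
    using cox_rel_in_lists by fastforce
  show "refl_on (lists S) (cox_rel S m)"
    by (auto intro!: refl_onI cox_rel.refl)
  show "sym (cox_rel S m)"
    by (auto intro: symI cox_rel.sym)
  show "trans (cox_rel S m)"
    by (auto intro: transI cox_rel.trans)
qed

lemma cox_rel_append_left: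
  assumes "(u, v) \<in> cox_rel S m" "x \<in> lists S"
  shows "(x @ u, x @ v) \<in> cox_rel S m"
  using assms
proof (induction rule: cox_rel.induct)
  case (rel u v s t)
  then show ?case using cox_rel.rel[of "x @ u" S v s t m] by simp
next
  case (trans u v w)
  then show ?case by (meson cox_rel.trans)
qed (simp_all add: cox_rel.refl cox_rel.sym)

lemma cox_rel_append_right:
  assumes "(u, v) \<in> cox_rel S m" "x \<in> lists S"
  shows "(u @ x, v @ x) \<in> cox_rel S m"
  using assms
proof (induction rule: cox_rel.induct)
  case (rel u v s t)
  then show ?case using cox_rel.rel[of u S "v @ x" s t m] by simp
next
  case (trans u v w)
  then show ?case by (meson cox_rel.trans)
qed (simp_all add: cox_rel.refl cox_rel.sym)

lemma cox_rel_append: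
  assumes "(u, u') \<in> cox_rel S m" "(v, v') \<in> cox_rel S m"
  shows "(u @ v, u' @ v') \<in> cox_rel S m"
proof (rule cox_rel.trans)
  show "(u @ v, u @ v') \<in> cox_rel S m"
    using assms cox_rel_in_lists[OF assms(1)] by (intro cox_rel_append_left) auto
  show "(u @ v', u' @ v') \<in> cox_rel S m"
    using assms cox_rel_in_lists[OF assms(2)] by (intro cox_rel_append_right) auto
qed

lemma cox_class_eq_iff:
  assumes "u \<in> lists S" "v \<in> lists S"
  shows "cox_class S m u = cox_class S m v \<longleftrightarrow> (u, v) \<in> cox_rel S m"
  unfolding cox_class_def using eq_equiv_class_iff[OF equiv_cox_rel assms] .

lemma cox_class_eqI:
  assumes "(u, v) \<in> cox_rel S m"
  shows "cox_class S m u = cox_class S m v"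
  unfolding cox_class_def using equiv_class_eq[OF equiv_cox_rel assms] .

lemma carrier_coxeter_group:
  "carrier (coxeter_group S m) = cox_class S m ` lists S"
  by (auto simp: coxeter_group_def cox_class_def quotient_def)

lemma one_coxeter_group: "\<one>\<^bsub>coxeter_group S m\<^esub> = cox_class S m []"
  by (simp add: coxeter_group_def)

lemma mult_coxeter_group:
  assumes "u \<in> lists S" "v \<in> lists S"
  shows "cox_class S m u \<otimes>\<^bsub>coxeter_group S m\<^esub> cox_class S m v = cox_class S m (u @ v)"
proof -
  have *: "cox_class S m (u' @ v') = cox_class S m (u @ v)"
    if "u' \<in> cox_class S m u" "v' \<in> cox_class S m v" for u' v'
  proof -
    have "(u, u') \<in> cox_rel S m" "(v, v') \<in> cox_rel S m"
      using that by (auto simp: cox_class_def)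
    then have "(u' @ v', u @ v) \<in> cox_rel S m"
      by (intro cox_rel.sym[OF cox_rel_append])
    then show ?thesis
      by (rule cox_class_eqI)
  qed
  have "u \<in> cox_class S m u" "v \<in> cox_class S m v"
    using assms by (auto simp: cox_class_def intro: cox_rel.refl)
  then show ?thesis
    using * unfolding coxeter_group_def monoid.simps by blast
qed

lemma cox_rel_rev:
  assumes "\<forall>s\<in>S. m s s = 1" "u \<in> lists S"
  shows "(rev u @ u, []) \<in> cox_rel S m"
  using assms(2)
proof (induction u)
  case Nil
  then show ?case by (auto intro: cox_rel.refl)
next
  case (Cons s u)
  then have s: "s \<in> S" and u: "u \<in> lists S" by auto
  have "(rev u @ [s, s] @ u, rev u @ u) \<in> cox_rel S m"
    using cox_rel.rel[of "rev u" S u s s m] s u assms(1) by (auto simp: in_lists_conv_set)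
  then show ?case
    using Cons.IH by (auto intro: cox_rel.trans)
qed

lemma group_coxeter_group:
  assumes "coxeter_matrix S m"
  shows "group (coxeter_group S m)" (is "group ?G")
proof (rule groupI)
  have diag: "\<forall>s\<in>S. m s s = 1"
    using assms by (auto simp: coxeter_matrix_def)
  have rep: "\<exists>u\<in>lists S. x = cox_class S m u" if "x \<in> carrier ?G" for x
    using that unfolding carrier_coxeter_group by blast
  show "\<one>\<^bsub>?G\<^esub> \<in> carrier ?G"
    unfolding carrier_coxeter_group one_coxeter_group by simp
  show "x \<otimes>\<^bsub>?G\<^esub> y \<in> carrier ?G" if xy: "x \<in> carrier ?G" "y \<in> carrier ?G" for x y
  proof -
    obtain u v where "u \<in> lists S" "v \<in> lists S" "x = cox_class S m u" "y = cox_class S m v"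
      using rep xy by meson
    then show ?thesis
      by (simp add: carrier_coxeter_group mult_coxeter_group)
  qed
  show "x \<otimes>\<^bsub>?G\<^esub> y \<otimes>\<^bsub>?G\<^esub> z = x \<otimes>\<^bsub>?G\<^esub> (y \<otimes>\<^bsub>?G\<^esub> z)"
    if xyz: "x \<in> carrier ?G" "y \<in> carrier ?G" "z \<in> carrier ?G" for x y z
  proof -
    obtain u v w where "u \<in> lists S" "v \<in> lists S" "w \<in> lists S"
      "x = cox_class S m u" "y = cox_class S m v" "z = cox_class S m w"
      using rep xyz by meson
    then show ?thesis
      by (simp add: mult_coxeter_group)
  qed
  fix x assume "x \<in> carrier ?G"
  then obtain u where u: "u \<in> lists S" "x = cox_class S m u"
    using rep by blast
  then show "\<one>\<^bsub>?G\<^esub> \<otimes>\<^bsub>?G\<^esub> x = x"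
    by (simp add: one_coxeter_group mult_coxeter_group)
  have "rev u \<in> lists S" using u by auto
  moreover have "cox_class S m (rev u @ u) = cox_class S m []"
    using cox_rel_rev[where m = m, OF diag u(1)] by (rule cox_class_eqI)
  ultimately show "\<exists>y\<in>carrier ?G. y \<otimes>\<^bsub>?G\<^esub> x = \<one>\<^bsub>?G\<^esub>"
    using u by (auto simp: carrier_coxeter_group one_coxeter_group mult_coxeter_group)
qed


section \<open>The Coxeter system $D_{n+1}$\<close>

definition D_gens :: "nat \<Rightarrow> nat set" where
  "D_gens n = {1..n+1}"

definition D_edge :: "nat \<Rightarrow> nat \<Rightarrow> nat \<Rightarrow> bool" where
  "D_edge n i j \<longleftrightarrow> (j = i + 1 \<and> j \<le> n - 1) \<or> (i = n - 1 \<and> (j = n \<or> j = n + 1))"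

definition D_matrix :: "nat \<Rightarrow> nat \<Rightarrow> nat \<Rightarrow> nat" where
  "D_matrix n i j = (if i = j then 1 else if D_edge n i j \<or> D_edge n j i then 3 else 2)"

lemma coxeter_matrix_D: "coxeter_matrix (D_gens n) (D_matrix n)"
  by (auto simp: coxeter_matrix_def D_matrix_def)


section \<open>The generating function\<close>

text \<open>
  All identities take place in the field of rational functions in one indeterminate
  \<open>q\<close> over the rationals.
\<close>

definition qvar :: "rat poly fract" where
  "qvar = to_fract [:0, 1:]"

text \<open>Meaningful only for \<open>k \<le> n\<close>, the only case that is used.\<close>

definition qbinomial :: "nat \<Rightarrow> nat \<Rightarrow> rat poly fract" where
  "qbinomial n k =
     (\<Prod>i=1..n. 1 - qvar ^ i) / ((\<Prod>i=1..k. 1 - qvar ^ i) * (\<Prod>i=1..n-k. 1 - qvar ^ i))"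

definition P :: "nat \<Rightarrow> rat poly fract" where
  "P n =
     (if even n then
        (\<Sum>h=1..n-1. qvar ^ h * (\<Sum>i=0..h-1. qbinomial (h-1) i))
        + 1 / 2 * qvar ^ n * (1 + qvar) * (\<Sum>i=0..n-1. qbinomial (n-1) i)
      else
        (\<Sum>h=1..n-1. qvar ^ h * (\<Sum>i=0..h-1. qbinomial (h-1) i))
        + 1 / 2 * qvar ^ n * (1 + qvar) * (\<Sum>i=0..n-1. qbinomial (n-1) i)
        + (\<Sum>h=1..(n-1) div 2. qvar ^ (n-h) * qbinomial (n-h-1) ((n-1) div 2))
        + 1 / 2 * qvar ^ n * (1 + qvar) * qbinomial (n-1) ((n-1) div 2))"

end

theory Submission
  imports Defs
begin

text \<open>
  By the exchange condition, a word none of whose commutation-equivalent words contains a factor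
  \<open>s s\<close> or \<open>s t s\<close> with $m_{st} = 3$ is reduced, and its commutation class consists of all reduced
  words of the element it expresses. So the fully commutative involutions are the commutation
  classes of such words that are invariant under reversal, and the descents are the possible last
  letters.

  In type D a self-dual class is determined by the numbers \<open>c j\<close> of occurrences of the letters \<open>j\<close>:
  the descents depend only on these numbers, and a descent can be peeled off at both ends. Away from
  the fork the letters \<open>j\<close> and \<open>j + 1\<close> alternate, so that \<open>c\<close> is a walk with steps $\pm 1$ that may be
  flat only at height 0 and whose peaks are the descents. The only other classes contain a nested
  part \<open>h \<dots> (n-1) n (n+1) (n-1) \<dots> h\<close>, with a walk on the letters below \<open>h\<close>. Walks of length \<open>m\<close>
  ending at height \<open>j\<close>, counted by the sum of their peak positions, are enumerated by the Gaussian binomial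
  coefficient of \<open>m\<close> over $\lfloor (m-j)/2 \rfloor$, since both satisfy the same recurrence.
\<close>

section \<open>Commutation classes\<close>

text \<open>The group is given by a presentation only, so a priori distinct generators might
  coincide. The exchange condition is therefore extracted from the presentation by counting
  reflections modulo 2, and an action on integer functions keeps the generators apart. Letters are
  cancelled in the group, and minimality of fully commutative words carries the result back to
  commutation classes.

  That every admissible code occurs is shown by placing the letters at levels symmetric about 0:
  reversal of a word becomes negation of levels.

  A leaf can occur only if the branching vertex occurs an even number of times, so the leaf terms
  involve a sum over even final heights of a walk of length \<open>n - 1\<close>. Walks ending at
  two neighbouring heights of suitable parity have the same generating function, so this sum is half
  of the sum over all heights; height 0 is left without a partner exactly when \<open>n - 1\<close>
  is even. This is the origin of the factor 1/2 and of the two cases of \<open>P\<close>. The term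
  with exponent \<open>2 * n + 1\<close> belongs to walks that return to 0 before both leaves
  occur.\<close>

locale simply_laced =
  fixes S :: "'a set" and m :: "'a \<Rightarrow> 'a \<Rightarrow> nat"
  assumes m_sym: "m s t = m t s"
    and m_eq_1: "m s t = 1 \<longleftrightarrow> s = t"
    and m_cases: "m s t = 1 \<or> m s t = 2 \<or> m s t = 3"
begin

abbreviation ceq (infix "\<approx>" 50) where
  "u \<approx> v \<equiv> (commutation_step m)\<^sup>*\<^sup>* u v"

abbreviation cox (infix "\<sim>" 50) where
  "u \<sim> v \<equiv> (u, v) \<in> cox_rel S m"

lemma m_self [simp]: "m s s = Suc 0"
  using m_eq_1[of s s] by simp

lemma m_neq: "m s t = 2 \<or> m s t = 3 \<Longrightarrow> s \<noteq> t"
  using m_eq_1[of s t] by auto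

lemma ceq_step: "m s t = 2 \<Longrightarrow> p @ [s, t] @ q \<approx> p @ [t, s] @ q"
  by (rule r_into_rtranclp, rule commutation_step.intros)

lemma ceq_induct [consumes 1, case_names refl step]:
  assumes "u \<approx> v" "Q u"
    and "\<And>p s t q. u \<approx> p @ [s, t] @ q \<Longrightarrow> Q (p @ [s, t] @ q) \<Longrightarrow> m s t = 2 \<Longrightarrow> Q (p @ [t, s] @ q)"
  shows "Q v"
  using assms(1)
proof (induction rule: rtranclp_induct)
  case base
  then show ?case using assms(2) .
next
  case (step y z)
  from step.hyps(2) show ?case
    using step.hyps(1) step.IH by cases (use assms(3) in blast)
qed

lemma ceq_trans: "u \<approx> v \<Longrightarrow> v \<approx> w \<Longrightarrow> u \<approx> w"
  by (rule rtranclp_trans)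

lemma ceq_sym: "u \<approx> v \<Longrightarrow> v \<approx> u"
proof (induction rule: ceq_induct)
  case (step p s t q)
  have "p @ [t, s] @ q \<approx> p @ [s, t] @ q"
    using step by (intro ceq_step) (simp add: m_sym)
  then show ?case
    using step.IH by (rule ceq_trans)
qed simp

lemma ceq_append: "u \<approx> v \<Longrightarrow> p @ u @ q \<approx> p @ v @ q"
proof (induction rule: ceq_induct)
  case (step p' s t q')
  have "(p @ p') @ [s, t] @ (q' @ q) \<approx> (p @ p') @ [t, s] @ (q' @ q)"
    using step by (intro ceq_step)
  then show ?case
    using step.IH ceq_trans by simp
qed simp

lemma ceq_Cons: "u \<approx> v \<Longrightarrow> s # u \<approx> s # v"
  using ceq_append[of u v "[s]" "[]"] by simp

lemma ceq_append_right: "u \<approx> v \<Longrightarrow> u @ q \<approx> v @ q"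
  using ceq_append[of u v "[]" q] by simp

lemma ceq_append_left: "u \<approx> v \<Longrightarrow> p @ u \<approx> p @ v"
  using ceq_append[of u v p "[]"] by simp

lemma ceq_mset: "u \<approx> v \<Longrightarrow> mset u = mset v"
  by (induction rule: ceq_induct) auto

lemma ceq_length: "u \<approx> v \<Longrightarrow> length u = length v"
  by (metis ceq_mset size_mset)

lemma ceq_set: "u \<approx> v \<Longrightarrow> set u = set v"
  by (metis ceq_mset set_mset_mset)

text \<open>Letters of a non-commuting pair are never exchanged. These projections are the
  invariants from which descents and shapes of classes are read off below.\<close>

lemma ceq_filter:
  assumes "u \<approx> v" "m s t \<noteq> 2"
  shows "filter (\<lambda>x. x \<in> {s, t}) u = filter (\<lambda>x. x \<in> {s, t}) v"
  using assms(1)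
proof (induction rule: ceq_induct)
  case (step p x y q)
  have "\<not> (x \<in> {s, t} \<and> y \<in> {s, t})"
    using step.hyps assms(2) m_sym[of s t] by auto
  then show ?case
    using step.IH by auto
qed simp

lemma ceq_rev: "u \<approx> v \<Longrightarrow> rev u \<approx> rev v"
proof (induction rule: ceq_induct)
  case (step p s t q)
  have "rev q @ [t, s] @ rev p \<approx> rev q @ [s, t] @ rev p"
    using step by (intro ceq_step) (simp add: m_sym)
  then show ?case
    using step.IH ceq_trans by simp
qed simp

lemma ceq_move: "\<forall>t\<in>set q. m s t = 2 \<Longrightarrow> s # q \<approx> q @ [s]"
proof (induction q)
  case (Cons t q)
  have "[] @ [s, t] @ q \<approx> [] @ [t, s] @ q"
    using Cons.prems by (intro ceq_step) auto
  moreover have "t # (s # q) \<approx> t # (q @ [s])"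
    using Cons by (intro ceq_Cons) auto
  ultimately show ?case
    using ceq_trans by fastforce
qed simp

lemma cox_trans [trans]: "u \<sim> v \<Longrightarrow> v \<sim> w \<Longrightarrow> u \<sim> w"
  by (rule cox_rel.trans)

lemma cox_square: "p \<in> lists S \<Longrightarrow> q \<in> lists S \<Longrightarrow> s \<in> S \<Longrightarrow> p @ s # s # q \<sim> p @ q"
  using cox_rel.rel[of p S q s s m] by simp

lemma cox_context: "u \<sim> v \<Longrightarrow> p \<in> lists S \<Longrightarrow> q \<in> lists S \<Longrightarrow> p @ u @ q \<sim> p @ v @ q"
  by (intro cox_rel_append_left cox_rel_append_right)

text \<open>The word \<open>ststts\<close> begins with the relator of \<open>s\<close> and
  \<open>t\<close>, whose deletion leaves \<open>ts\<close>; cancelling squares in the same word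
  leaves \<open>st\<close>. The braid relation below is obtained in the same way.\<close>

lemma cox_commute:
  assumes "m s t = 2" "s \<in> S" "t \<in> S"
  shows "[s, t] \<sim> [t, s]"
proof -
  have "[s, t, s, t, t, s] \<sim> [t, s]"
    using cox_rel.rel[of "[]" S "[t, s]" s t m] assms by (simp add: numeral_2_eq_2)
  moreover have "[s, t, s, t, t, s] \<sim> [s, t, s, s]"
    using cox_square[of "[s, t, s]" "[s]" t] assms by simp
  moreover have "[s, t, s, s] \<sim> [s, t]"
    using cox_square[of "[s, t]" "[]" s] assms by simp
  ultimately show ?thesis
    by (meson cox_rel.sym cox_rel.trans)
qed

lemma cox_braid:
  assumes "m s t = 3" "s \<in> S" "t \<in> S"
  shows "[s, t, s] \<sim> [t, s, t]"
proof -
  have "[s, t, s, t, s, t, t, s, t] \<sim> [t, s, t]"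
    using cox_rel.rel[of "[]" S "[t, s, t]" s t m] assms by (simp add: numeral_3_eq_3)
  moreover have "[s, t, s, t, s, t, t, s, t] \<sim> [s, t, s, t, s, s, t]"
    using cox_square[of "[s, t, s, t, s]" "[s, t]" t] assms by simp
  moreover have "[s, t, s, t, s, s, t] \<sim> [s, t, s, t, t]"
    using cox_square[of "[s, t, s, t]" "[t]" s] assms by simp
  moreover have "[s, t, s, t, t] \<sim> [s, t, s]"
    using cox_square[of "[s, t, s]" "[]" t] assms by simp
  ultimately show ?thesis
    by (meson cox_rel.sym cox_rel.trans)
qed

lemma ceq_lists: "u \<approx> v \<Longrightarrow> u \<in> lists S \<Longrightarrow> v \<in> lists S"
  using ceq_set by (auto simp: in_lists_conv_set)

lemma ceq_imp_cox:
  assumes "u \<approx> v" "u \<in> lists S"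
  shows "u \<sim> v"
  using assms(1)
proof (induction rule: ceq_induct)
  case refl
  then show ?case using assms(2) by (rule cox_rel.refl)
next
  case (step p s t q)
  have "p @ [s, t] @ q \<in> lists S"
    using ceq_lists[OF step.hyps(1) assms(2)] .
  then have "p @ [s, t] @ q \<sim> p @ [t, s] @ q"
    using step.hyps by (intro cox_context cox_commute) auto
  with step.IH show ?case
    by (rule cox_rel.trans)
qed

section \<open>The exchange condition\<close>

lemma cox_even_length: "u \<sim> v \<Longrightarrow> even (length u) \<longleftrightarrow> even (length v)"
proof (induction rule: cox_rel.induct)
  case (rel u v s t)
  have "length (concat (replicate k [s, t])) = 2 * k" for k
    by (induction k) auto
  then show ?case by simp
qed auto

lemma rev_concat_replicate_pair:
  "rev (concat (replicate k [s, t])) = concat (replicate k [t, s])"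
  by (simp add: rev_concat)

lemma rev_in_lists [simp]: "rev u \<in> lists A \<longleftrightarrow> u \<in> lists A"
  by auto

lemma cox_rev: "u \<sim> v \<Longrightarrow> rev u \<sim> rev v"
proof (induction rule: cox_rel.induct)
  case (rel u v s t)
  then show ?case
    using cox_rel.rel[of "rev v" S "rev u" t s m]
    by (simp add: rev_concat_replicate_pair m_sym[of t s])
qed (auto intro: cox_rel.intros)

lemma cox_rev_left: "u \<in> lists S \<Longrightarrow> rev u @ u \<sim> []"
  by (rule cox_rel_rev) auto

lemma cox_rev_right: "u \<in> lists S \<Longrightarrow> u @ rev u \<sim> []"
  using cox_rev_left[of "rev u"] by simp

lemma cox_cancel_left:
  assumes "p @ u \<sim> p @ v" "p \<in> lists S"
  shows "u \<sim> v"
proof -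
  have l: "u \<in> lists S" "v \<in> lists S"
    using cox_rel_in_lists[OF assms(1)] by auto
  have "(rev p @ p) @ u \<sim> [] @ u"
    using cox_rev_left assms(2) l by (intro cox_rel_append_right)
  moreover have "rev p @ p @ u \<sim> rev p @ p @ v"
    using cox_rel_append_left[OF assms(1), of "rev p"] assms(2) by simp
  moreover have "(rev p @ p) @ v \<sim> [] @ v"
    using cox_rev_left assms(2) l by (intro cox_rel_append_right)
  ultimately show ?thesis
    by simp (meson cox_rel.sym cox_rel.trans)
qed

lemma cox_cancel_right:
  assumes "u @ p \<sim> v @ p" "p \<in> lists S"
  shows "u \<sim> v"
proof -
  have "rev p @ rev u \<sim> rev p @ rev v"
    using cox_rev[OF assms(1)] by simp
  then have "rev u \<sim> rev v"
    using cox_cancel_left assms(2) by simp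
  then show ?thesis
    using cox_rev by fastforce
qed

lemma cox_conj_iff:
  assumes "p \<in> lists S" "w \<in> lists S" "t \<in> lists S"
  shows "p @ w @ rev p \<sim> t \<longleftrightarrow> w \<sim> rev p @ t @ p"
proof -
  have rp: "rev p \<in> lists S"
    using assms by simp
  have 1: "(rev p @ p) @ w @ (rev p @ p) \<sim> w"
  proof -
    have "(rev p @ p) @ w @ (rev p @ p) \<sim> [] @ w @ []"
      using assms cox_rev_left by (intro cox_rel_append cox_rel.refl)
    then show ?thesis by simp
  qed
  have 2: "(p @ rev p) @ t @ (p @ rev p) \<sim> t"
  proof -
    have "(p @ rev p) @ t @ (p @ rev p) \<sim> [] @ t @ []"
      using assms cox_rev_right by (intro cox_rel_append cox_rel.refl)
    then show ?thesis by simp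
  qed
  show ?thesis
  proof
    assume "p @ w @ rev p \<sim> t"
    then have "rev p @ (p @ w @ rev p) @ p \<sim> rev p @ t @ p"
      using rp assms by (intro cox_context)
    then show "w \<sim> rev p @ t @ p"
      using 1 by simp (meson cox_rel.sym cox_rel.trans)
  next
    assume "w \<sim> rev p @ t @ p"
    then have "p @ w @ rev p \<sim> p @ (rev p @ t @ p) @ rev p"
      using rp assms by (intro cox_context)
    then show "p @ w @ rev p \<sim> t"
      using 2 by simp (meson cox_rel.trans)
  qed
qed

text \<open>For \<open>u = s1 ... sr\<close> these are words for the reflections
  \<open>s1 ... si ... s1\<close>, with multiplicity. When \<open>u\<close> is reduced they express
  the left inversions of its element.\<close>

primrec refl_words :: "'a list \<Rightarrow> 'a list list" where
  "refl_words [] = []"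
| "refl_words (s # u) = [s] # map (\<lambda>w. s # w @ [s]) (refl_words u)"

lemma refl_words_append:
  "refl_words (u @ v) = refl_words u @ map (\<lambda>w. u @ w @ rev u) (refl_words v)"
  by (induction u) auto

lemma in_refl_words:
  "w \<in> set (refl_words u) \<longleftrightarrow> (\<exists>p x q. u = p @ x # q \<and> w = p @ [x] @ rev p)"
proof (induction u arbitrary: w)
  case (Cons s u)
  show ?case
  proof
    assume "w \<in> set (refl_words (s # u))"
    then consider "w = [s]" | w' where "w' \<in> set (refl_words u)" "w = s # w' @ [s]"
      by auto
    then show "\<exists>p x q. s # u = p @ x # q \<and> w = p @ [x] @ rev p"
    proof cases
      case 1
      then show ?thesis by (intro exI[of _ "[]"]) auto
    next
      case 2
      then obtain p x q where "u = p @ x # q" "w' = p @ [x] @ rev p"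
        using Cons.IH by blast
      then show ?thesis using 2 by (intro exI[of _ "s # p"]) auto
    qed
  next
    assume "\<exists>p x q. s # u = p @ x # q \<and> w = p @ [x] @ rev p"
    then obtain p x q where *: "s # u = p @ x # q" "w = p @ [x] @ rev p"
      by blast
    show "w \<in> set (refl_words (s # u))"
    proof (cases p)
      case Nil
      then show ?thesis using * by simp
    next
      case (Cons y p')
      then have "p' @ [x] @ rev p' \<in> set (refl_words u)"
        using * Cons.IH by auto
      then show ?thesis using * Cons by auto
    qed
  qed
qed simp

lemma refl_words_lists: "u \<in> lists S \<Longrightarrow> w \<in> set (refl_words u) \<Longrightarrow> w \<in> lists S"
  by (auto simp: in_refl_words)

text \<open>The parity of this number depends only on the group element expressed by \<open>u\<close>:
  it says whether the reflection \<open>t\<close> is an inversion.\<close>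

definition refl_count :: "'a list \<Rightarrow> 'a list \<Rightarrow> nat" where
  "refl_count u t = length (filter (\<lambda>w. w \<sim> t) (refl_words u))"

lemma refl_count_append:
  assumes "u \<in> lists S" "v \<in> lists S" "t \<in> lists S"
  shows "refl_count (u @ v) t = refl_count u t + refl_count v (rev u @ t @ u)"
proof -
  have "filter (\<lambda>w. u @ w @ rev u \<sim> t) (refl_words v) = filter (\<lambda>w. w \<sim> rev u @ t @ u) (refl_words v)"
    using assms refl_words_lists by (intro filter_cong) (auto simp: cox_conj_iff)
  then show ?thesis
    by (simp add: refl_count_def refl_words_append filter_map o_def)
qed

lemma refl_count_cong: "t \<sim> t' \<Longrightarrow> refl_count u t = refl_count u t'"
  unfolding refl_count_def
  by (intro arg_cong[of _ _ length] filter_cong) (auto intro: cox_rel.intros)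

primrec alt_word :: "'a \<Rightarrow> 'a \<Rightarrow> nat \<Rightarrow> 'a list" where
  "alt_word s t 0 = []"
| "alt_word s t (Suc k) = s # alt_word t s k"

lemma alt_word_snoc: "alt_word s t (2 * k) @ [s] = s # alt_word t s (2 * k)"
  by (induction k) auto

lemma alt_word_pairs: "alt_word s t (2 * k + i) = concat (replicate k [s, t]) @ alt_word s t i"
  by (induction k) auto

lemma alt_word_lists: "s \<in> S \<Longrightarrow> t \<in> S \<Longrightarrow> alt_word s t k \<in> lists S"
  by (induction k arbitrary: s t) auto

lemma refl_words_alt_word:
  "refl_words (alt_word s t k) = map (\<lambda>j. alt_word s t (Suc (2 * j))) [0..<k]"
proof (induction k arbitrary: s t)
  case (Suc k)
  have "refl_words (alt_word s t (Suc k))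
      = map (\<lambda>j. alt_word s t (Suc (2 * j))) (0 # map Suc [0..<k])"
    by (simp add: Suc.IH o_def alt_word_snoc)
  also have "0 # map Suc [0..<k] = [0..<Suc k]"
    by (simp add: upt_conv_Cons map_Suc_upt del: upt_Suc)
  finally show ?case .
qed simp

text \<open>The reflection words of the relator are the alternating words of length
  \<open>2 * j + 1\<close>. Increasing \<open>j\<close> by \<open>m s t\<close> prepends one
  relator, so the second half of the list repeats the first half in the group.\<close>

lemma refl_count_relator:
  assumes "s \<in> S" "t \<in> S"
  shows "even (refl_count (concat (replicate (m s t) [s, t])) x)"
proof -
  let ?k = "m s t"
  let ?f = "\<lambda>j. alt_word s t (Suc (2 * j))"
  have rel: "?f (?k + j) \<sim> ?f j" for j
  proof -
    have "?f (?k + j) = concat (replicate ?k [s, t]) @ ?f j"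
      using alt_word_pairs[of s t ?k "Suc (2 * j)"] by (simp add: algebra_simps)
    then show ?thesis
      using cox_rel.rel[of "[]" S "?f j" s t m] assms alt_word_lists[OF assms]
      by (simp del: alt_word.simps)
  qed
  have "concat (replicate ?k [s, t]) = alt_word s t (?k + ?k)"
    using alt_word_pairs[of s t ?k 0] by (simp add: mult_2)
  then have "refl_words (concat (replicate ?k [s, t])) = map ?f ([0..<?k] @ map (\<lambda>j. j + ?k) [0..<?k])"
    by (simp add: refl_words_alt_word map_add_upt upt_add_eq_append[of 0 ?k ?k, simplified]
        del: alt_word.simps(2))
  moreover have "filter ((\<lambda>w. w \<sim> x) \<circ> (\<lambda>j. ?f (j + ?k))) [0..<?k] = filter ((\<lambda>w. w \<sim> x) \<circ> ?f) [0..<?k]"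
  proof (rule filter_cong[OF HOL.refl])
    fix j
    show "((\<lambda>w. w \<sim> x) \<circ> (\<lambda>j. ?f (j + ?k))) j = ((\<lambda>w. w \<sim> x) \<circ> ?f) j"
      unfolding comp_apply add.commute[of j ?k]
      using rel[of j] cox_rel.sym cox_rel.trans by blast
  qed
  ultimately show ?thesis
    unfolding refl_count_def by (simp add: filter_map o_def del: alt_word.simps(2))
qed

text \<open>An inserted relator contributes an even number of its own, and it does not change, as a
  group element, the prefix that conjugates the later letters.\<close>

lemma even_refl_count:
  assumes "u \<sim> v" "t \<in> lists S"
  shows "even (refl_count u t) \<longleftrightarrow> even (refl_count v t)"
  using assms
proof (induction arbitrary: t rule: cox_rel.induct)
  case (rel u v s r)
  let ?c = "concat (replicate (m s r) [s, r])"
  have c: "?c \<sim> []"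
    using rel cox_rel.rel[of "[]" S "[]" s r m] by simp
  then have c': "?c \<in> lists S"
    using cox_rel_in_lists by blast
  have "rev (u @ ?c) @ t @ (u @ ?c) \<sim> rev u @ t @ u"
  proof -
    have "rev ?c @ (rev u @ t @ u) @ ?c \<sim> [] @ (rev u @ t @ u) @ []"
      using rel c c' cox_rev[OF c] by (intro cox_rel_append cox_rel.refl) auto
    then show ?thesis by simp
  qed
  then have "refl_count v (rev (u @ ?c) @ t @ (u @ ?c)) = refl_count v (rev u @ t @ u)"
    by (rule refl_count_cong)
  then have "refl_count (u @ ?c @ v) t
      = refl_count u t + refl_count ?c (rev u @ t @ u) + refl_count v (rev u @ t @ u)"
    using rel c' refl_count_append[of "u @ ?c" v t] refl_count_append[of u ?c t] by simp
  moreover have "refl_count (u @ v) t = refl_count u t + refl_count v (rev u @ t @ u)"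
    using rel refl_count_append by auto
  ultimately show ?case
    using refl_count_relator[OF rel(3,4)] by simp
qed auto

definition reduced :: "'a list \<Rightarrow> bool" where
  "reduced u \<longleftrightarrow> u \<in> lists S \<and> (\<forall>v. u \<sim> v \<longrightarrow> length u \<le> length v)"

lemma reduced_cong: "reduced u \<Longrightarrow> u \<sim> v \<Longrightarrow> length v = length u \<Longrightarrow> reduced v"
  unfolding reduced_def using cox_rel_in_lists cox_rel.trans by metis

lemma reduced_append:
  assumes "reduced (p @ u @ q)"
  shows "reduced u"
proof -
  have l: "p \<in> lists S" "u \<in> lists S" "q \<in> lists S"
    using assms by (auto simp: reduced_def)
  have "length u \<le> length v" if "u \<sim> v" for v
  proof -
    have "p @ u @ q \<sim> p @ v @ q"
      using that l by (intro cox_context)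
    then show ?thesis
      using assms unfolding reduced_def by fastforce
  qed
  then show ?thesis
    using l by (simp add: reduced_def)
qed

text \<open>Write the element of \<open>u\<close> as a reduced word \<open>s # v\<close>. The
  reflection \<open>s\<close> occurs exactly once there, hence by parity it occurs for
  \<open>u\<close> as well, and a reflection word \<open>p @ [x] @ rev p\<close> expressing
  \<open>s\<close> means that \<open>s p = p x\<close> in the group.\<close>

lemma exchange:
  assumes "reduced u" "s \<in> S" "\<not> reduced (s # u)"
  obtains p x q where "u = p @ x # q" "s # p \<sim> p @ [x]"
proof -
  have u: "u \<in> lists S"
    using assms by (simp add: reduced_def)
  then obtain v where v: "s # u \<sim> v" "length v < Suc (length u)"
    using assms by (force simp: reduced_def)
  have vl: "v \<in> lists S"
    using cox_rel_in_lists v by blast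
  \<comment> \<open>Parity of the length excludes \<open>length v = length u\<close>, so that
    \<open>s # v\<close> is not longer than \<open>u\<close>.\<close>
  have "even (Suc (length u)) = even (length v)"
    using cox_even_length[OF v(1)] by simp
  then have "length v < length u"
    using v(2) by presburger
  have "u \<sim> s # v"
  proof -
    have "[s] @ s # u \<sim> [s] @ v"
      using v(1) assms by (intro cox_rel_append_left) auto
    moreover have "[] @ s # s # u \<sim> [] @ u"
      using u assms by (intro cox_square) auto
    ultimately show ?thesis
      by simp (meson cox_rel.sym cox_rel.trans)
  qed
  then have red: "reduced (s # v)"
    using \<open>length v < length u\<close> assms(1) by (metis Suc_leI le_antisym length_Cons reduced_cong reduced_def)
  \<comment> \<open>A second occurrence would allow the leading \<open>s\<close> and one letter of
    \<open>v\<close> to be deleted from the reduced word \<open>s # v\<close>.\<close>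
  have "refl_count (s # v) [s] = 1"
  proof -
    have "\<not> s # w @ [s] \<sim> [s]" if "w \<in> set (refl_words v)" for w
    proof
      assume *: "s # w @ [s] \<sim> [s]"
      obtain p y q where pq: "v = p @ y # q" "w = p @ [y] @ rev p"
        using \<open>w \<in> set (refl_words v)\<close> in_refl_words by blast
      have l: "p \<in> lists S" "q \<in> lists S" "y \<in> S"
        using vl pq by auto
      have "(s # p @ [y]) @ rev (s # p) \<sim> [s]"
        using * unfolding pq(2) by simp
      then have "((s # p @ [y]) @ rev (s # p)) @ (s # p) \<sim> [s] @ (s # p)"
        using l assms by (intro cox_rel_append_right) auto
      also have "[s] @ s # p \<sim> p"
        using cox_square[of "[]" p s] l assms by simp
      finally have "(s # p @ [y]) @ (rev (s # p) @ (s # p)) \<sim> p"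
        by simp
      moreover have "(s # p @ [y]) @ (rev (s # p) @ (s # p)) \<sim> (s # p @ [y]) @ []"
        using l assms by (intro cox_rel_append_left cox_rev_left) auto
      ultimately have "s # p @ [y] \<sim> p"
        unfolding append_Nil2 by (blast intro: cox_rel.sym cox_rel.trans)
      then have "(s # p @ [y]) @ q \<sim> p @ q"
        using l by (intro cox_rel_append_right)
      then show False
        using red pq by (auto simp: reduced_def)
    qed
    moreover have "[s] \<sim> [s]"
      using assms by (intro cox_rel.refl) auto
    ultimately have "filter (\<lambda>w. w \<sim> [s]) (refl_words (s # v)) = [[s]]"
      by (auto simp only: refl_words.simps filter.simps append.simps filter_empty_conv set_map if_True)
    then show ?thesis
      by (simp only: refl_count_def) simp
  qed
  then have "odd (refl_count u [s])"
    using even_refl_count[OF \<open>u \<sim> s # v\<close>, of "[s]"] assms by simp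
  then have "refl_count u [s] \<noteq> 0"
    by (metis even_zero)
  then obtain w where w: "w \<in> set (refl_words u)" "w \<sim> [s]"
    unfolding refl_count_def by (metis (mono_tags, lifting) filter_False length_0_conv)
  then obtain p x q where pq: "u = p @ x # q" "w = p @ [x] @ rev p"
    using in_refl_words by blast
  have l: "p \<in> lists S" "x \<in> S"
    using u pq by auto
  have "(p @ [x] @ rev p) @ p \<sim> [s] @ p"
    using w pq l by (intro cox_rel_append_right) auto
  moreover have "(p @ [x]) @ (rev p @ p) \<sim> (p @ [x]) @ []"
    using l by (intro cox_rel_append_left cox_rev_left) auto
  ultimately have "[s] @ p \<sim> (p @ [x]) @ []"
    unfolding append_assoc by (rule cox_rel.trans[OF cox_rel.sym])
  then have "s # p \<sim> p @ [x]"
    by simp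
  then show ?thesis
    by (rule that[OF pq(1)])
qed

text \<open>The numbers game: an action that separates the generators.\<close>

definition play :: "'a \<Rightarrow> ('a \<Rightarrow> int) \<Rightarrow> 'a \<Rightarrow> int" where
  "play s f t = (if t = s then - f s else if m s t = 3 then f t + f s else f t)"

lemma foldr_play_relator: "foldr play (concat (replicate (m s t) [s, t])) f = f"
proof -
  consider "m s t = 1" | "m s t = 2" | "m s t = 3"
    using m_cases by blast
  then show ?thesis
  proof cases
    case 1
    then have "s = t" using m_eq_1[of s t] by simp
    then show ?thesis by (auto simp: play_def)
  next
    case 2
    then have "s \<noteq> t" "m t s = 2" using m_neq m_sym by auto
    then show ?thesis using 2 by (auto simp: numeral_2_eq_2 play_def fun_eq_iff)
  next
    case 3
    then have "s \<noteq> t" "m t s = 3" using m_neq m_sym by auto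
    then show ?thesis using 3 by (auto simp: numeral_3_eq_3 play_def fun_eq_iff)
  qed
qed

lemma cox_foldr_play: "u \<sim> v \<Longrightarrow> foldr play u f = foldr play v f"
  by (induction rule: cox_rel.induct) (simp_all add: foldr_play_relator)

lemma cox_singleton:
  assumes "[s] \<sim> [t]"
  shows "s = t"
proof (rule ccontr)
  assume "s \<noteq> t"
  \<comment> \<open>Starting from the constant 1, playing at \<open>s\<close> turns the value at
    \<open>s\<close> into -1, whereas playing at any other generator leaves it positive.\<close>
  have "play s (\<lambda>_. 1) s = play t (\<lambda>_. 1) s"
    using cox_foldr_play[OF assms, of "\<lambda>_. 1"] by simp
  then show False
    using \<open>s \<noteq> t\<close> by (auto simp: play_def split: if_splits)
qed

end

context simply_laced
begin

section \<open>Fully commutative words\<close>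

definition fc_word :: "'a list \<Rightarrow> bool" where
  "fc_word u \<longleftrightarrow> (\<forall>v. u \<approx> v \<longrightarrow>
     (\<forall>p s q. v \<noteq> p @ [s, s] @ q) \<and> (\<forall>p s t q. m s t = 3 \<longrightarrow> v \<noteq> p @ [s, t, s] @ q))"

lemma fc_word_no_square: "fc_word u \<Longrightarrow> \<not> u \<approx> p @ s # s # q"
  unfolding fc_word_def by fastforce

lemma fc_word_no_braid: "fc_word u \<Longrightarrow> m s t = 3 \<Longrightarrow> \<not> u \<approx> p @ s # t # s # q"
  unfolding fc_word_def by fastforce

lemma fc_word_ceq: "fc_word u \<Longrightarrow> u \<approx> v \<Longrightarrow> fc_word v"
  unfolding fc_word_def using ceq_trans[of u v] by blast

lemma fc_word_append:
  assumes "fc_word (p @ u @ q)"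
  shows "fc_word u"
proof -
  have *: "p @ u @ q \<approx> p @ v @ q" if "u \<approx> v" for v
    using that by (rule ceq_append)
  show ?thesis
    unfolding fc_word_def
  proof (intro allI impI conjI notI)
    fix v p' s q' assume "u \<approx> v" "v = p' @ [s, s] @ q'"
    then show False
      using *[of v] fc_word_no_square[OF assms, of "p @ p'" s "q' @ q"] by simp
  next
    fix v p' s t q' assume "u \<approx> v" "m s t = 3" "v = p' @ [s, t, s] @ q'"
    then show False
      using *[of v] fc_word_no_braid[OF assms, of s t "p @ p'" "q' @ q"] by simp
  qed
qed

lemma fc_word_Cons: "fc_word (s # u) \<Longrightarrow> fc_word u"
  using fc_word_append[of "[s]" u "[]"] by simp

text \<open>With at most one neighbour in between, two consecutive occurrences of \<open>s\<close>
  can be moved by commutations until they meet or enclose just that neighbour, which gives a square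
  or a braid factor. The analysis of gaps in type D rests on this count.\<close>

lemma fc_word_gap:
  assumes "fc_word (p @ s # q @ s # r)" "s \<notin> set q"
  shows "2 \<le> length (filter (\<lambda>t. m s t = 3) q)"
proof (rule ccontr)
  assume "\<not> ?thesis"
  then consider "filter (\<lambda>t. m s t = 3) q = []" | t where "filter (\<lambda>t. m s t = 3) q = [t]"
    by (cases "filter (\<lambda>t. m s t = 3) q" rule: remdups_adj.cases) auto
  moreover have comm: "s # q' \<approx> q' @ [s]"
    if "filter (\<lambda>t. m s t = 3) q' = []" "set q' \<subseteq> set q" for q'
    using that assms(2) m_cases[of s] m_eq_1[of s]
    by (intro ceq_move) (auto simp: filter_empty_conv, metis subsetD)
  have fc: "fc_word (s # q @ [s])"
    using fc_word_append[of p "s # q @ [s]" r] assms(1) by simp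
  ultimately show False
  proof cases
    case 1
    then have "(s # q) @ [s] \<approx> (q @ [s]) @ [s]"
      by (intro ceq_append_right comm) auto
    then show False
      using fc_word_no_square[OF fc, of q s "[]"] by simp
  next
    case (2 t)
    then obtain q1 q2 where "q = q1 @ t # q2" "\<forall>x\<in>set q1. m s x \<noteq> 3" "m s t = 3"
      "[] = filter (\<lambda>t. m s t = 3) q2"
      unfolding filter_eq_Cons_iff by blast
    then have q: "q = q1 @ t # q2" "filter (\<lambda>t. m s t = 3) q1 = []"
      "filter (\<lambda>t. m s t = 3) q2 = []" "m s t = 3"
      by (auto simp: filter_empty_conv)
    have "(s # q1) @ (t # q2 @ [s]) \<approx> (q1 @ [s]) @ (t # q2 @ [s])"
      using q by (intro ceq_append_right comm) auto
    moreover have "(q1 @ [s, t]) @ (q2 @ [s]) \<approx> (q1 @ [s, t]) @ (s # q2)"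
      using q by (intro ceq_append_left ceq_sym[OF comm]) auto
    ultimately have "s # q @ [s] \<approx> q1 @ s # t # s # q2"
      using q(1) ceq_trans by simp
    then show False
      using fc_word_no_braid[OF fc q(4)] by blast
  qed
qed

text \<open>Commutation would reduce \<open>sts\<close> to \<open>t\<close>; by the braid relation
  also \<open>tst = t\<close>, hence \<open>st = 1\<close> and the two generators would
  coincide.\<close>

lemma cox_not_commute:
  assumes "[s, t] \<sim> [t, s]" "m s t = 3"
  shows False
proof -
  have st: "s \<in> S" "t \<in> S"
    using cox_rel_in_lists[OF assms(1)] by auto
  have "[s, t] @ [s] \<sim> [t, s] @ [s]"
    using assms(1) st by (intro cox_rel_append_right) auto
  moreover have "[t] @ s # s # [] \<sim> [t] @ []"
    using st by (intro cox_square) auto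
  ultimately have "[s, t, s] \<sim> [t]"
    using cox_rel.trans by fastforce
  then have "[t] @ [s, t] \<sim> [t] @ []"
    using cox_rel.trans[OF cox_rel.sym[OF cox_braid[OF assms(2) st]]] by simp
  then have "[s, t] \<sim> []"
    using st cox_cancel_left[of "[t]"] by simp
  then have "[s, t] @ [t] \<sim> [] @ [t]"
    using st by (intro cox_rel_append_right) auto
  moreover have "[s] @ t # t # [] \<sim> [s] @ []"
    using st by (intro cox_square) auto
  ultimately have "[s] \<sim> [t]"
    using cox_rel.trans[OF cox_rel.sym] by fastforce
  then show False
    using cox_singleton assms(2) m_neq by blast
qed

lemma exchange_word:
  assumes "reduced u" "s \<in> S" "\<not> reduced (s # u)"
  obtains p x q where "u = p @ x # q" "s # p \<sim> p @ [x]" "u \<sim> s # p @ q"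
proof -
  obtain p x q where *: "u = p @ x # q" "s # p \<sim> p @ [x]"
    using exchange[OF assms] .
  have "(s # p) @ q \<sim> (p @ [x]) @ q"
    using * assms(1) by (intro cox_rel_append_right) (auto simp: reduced_def)
  then have "u \<sim> s # p @ q"
    using * by (simp add: cox_rel.sym)
  with * show ?thesis
    by (rule that)
qed

lemma not_reduced_Cons:
  assumes "s # v \<sim> u" "length v \<le> length u"
  shows "\<not> reduced (s # u)"
proof
  assume red: "reduced (s # u)"
  have l: "s \<in> S" "v \<in> lists S"
    using cox_rel_in_lists[OF assms(1)] by auto
  have "[s] @ u \<sim> [s] @ s # v"
    using l cox_rel.sym[OF assms(1)] by (intro cox_rel_append_left) auto
  also have "[s] @ s # v \<sim> v"
    using cox_square[of "[]" v s] l by simp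
  finally have "s # u \<sim> v"
    by simp
  then show False
    using red assms(2) unfolding reduced_def by fastforce
qed

text \<open>Tits' solution of the word problem, restricted to words to which no braid move applies.\<close>

theorem fc_word_minimal:
  assumes "fc_word u" "u \<in> lists S" "u \<sim> v" "length v \<le> length u"
  shows "u \<approx> v"
  using assms
proof (induction "length u" arbitrary: u v rule: less_induct)
  case less
  show ?case
  proof (cases u)
    case Nil
    then show ?thesis using less.prems by simp
  next
    case (Cons s u')
    have l: "s \<in> S" "u' \<in> lists S" and fc': "fc_word u'"
      using less.prems Cons fc_word_Cons by auto
    have IH: "x \<approx> y" if "fc_word x" "x \<in> lists S" "x \<sim> y" "length y \<le> length u'" "length x = length u'" for x y
      using less.hyps[of x y] that Cons by simp
    have "reduced u'"
      unfolding reduced_def using l IH[OF fc'] ceq_length by (metis nat_le_linear order_refl)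
    \<comment> \<open>Otherwise an exchange rewrites \<open>u'\<close> with first letter
      \<open>s\<close>. By induction commutations suffice for this, and \<open>u\<close> acquires
      the factor \<open>s s\<close>.\<close>
    have "reduced u"
    proof (rule ccontr)
      assume "\<not> reduced u"
      then obtain p x q where *: "u' = p @ x # q" "u' \<sim> s # p @ q"
        using exchange_word[OF \<open>reduced u'\<close> l(1)] Cons by metis
      then have "s # u' \<approx> s # s # p @ q"
        using l fc' by (intro ceq_Cons IH) auto
      then show False
        using fc_word_no_square[OF less.prems(1), of "[]"] Cons by simp
    qed
    then have len: "length v = length u"
      using less.prems by (auto simp: reduced_def intro: le_antisym)
    then obtain t v' where v: "v = t # v'"
      using Cons by (cases v) auto
    have vl: "t \<in> S" "v' \<in> lists S"
      using cox_rel_in_lists[OF less.prems(3)] v by auto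
    show ?thesis
    proof (cases "t = s")
      case True
      then have "[s] @ u' \<sim> [s] @ v'"
        using less.prems(3) v Cons by simp
      then have "u' \<sim> v'"
        by (rule cox_cancel_left[of "[s]"]) (use l in auto)
      then show ?thesis
        using True v Cons len IH[OF fc' l(2)] ceq_Cons by simp
    next
      case False
      \<comment> \<open>Since \<open>v\<close> starts with \<open>t\<close>, the exchange condition
        also brings \<open>t\<close> to the front of \<open>u\<close>. The letter deleted for it is
        not the leading \<open>s\<close>, as distinct generators differ in the group; so
        \<open>u \<sim> t # z\<close> where \<open>z\<close> still starts with
        \<open>s\<close>.\<close>
      have "\<not> reduced (t # u)"
        using not_reduced_Cons[of t v' u] cox_rel.sym[OF less.prems(3)] v len by simp
      then obtain p x q where p: "u = p @ x # q" "t # p \<sim> p @ [x]" "u \<sim> t # p @ q"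
        using exchange_word[OF \<open>reduced u\<close> vl(1)] by metis
      have "p \<noteq> []"
        using p(1,2) cox_singleton[of t x] False Cons by auto
      then obtain p' where p': "p = s # p'" "u' = p' @ x # q"
        using p(1) Cons by (cases p) auto
      define z where "z = s # p' @ q"
      have z: "length z = length u'" "u \<sim> t # z" "z \<in> lists S"
        using p p' l by (auto simp: z_def)
      have "[t] @ z \<sim> [t] @ v'"
        using z(2) less.prems(3) v cox_rel.sym cox_rel.trans by fastforce
      then have zv: "z \<sim> v'"
        by (rule cox_cancel_left[of "[t]"]) (use vl in auto)
      consider "m s t = 2" | "m s t = 3"
        using m_cases[of s t] m_eq_1[of s t] False by blast
      then show ?thesis
      proof cases
        case 1
        have pq: "p' @ q \<in> lists S"
          using z(3) by (simp add: z_def)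
        have "[t, s] @ p' @ q \<sim> [s, t] @ p' @ q"
          using 1 pq l vl by (intro cox_rel_append_right cox_commute) (auto simp: m_sym)
        then have "[s] @ u' \<sim> [s] @ t # p' @ q"
          using cox_rel.trans[OF z(2)] Cons by (simp add: z_def)
        then have "u' \<sim> t # p' @ q"
          by (rule cox_cancel_left[of "[s]"]) (use l in auto)
        then have "s # u' \<approx> s # t # p' @ q"
          using fc' l p' by (intro ceq_Cons IH) auto
        also have "s # t # p' @ q \<approx> t # s # p' @ q"
          using ceq_step[OF 1, of "[]"] by simp
        finally have uz: "u \<approx> t # z"
          using Cons by (simp add: z_def)
        then have "fc_word z"
          using fc_word_ceq less.prems(1) fc_word_Cons by blast
        then have "z \<approx> v'"
          using z zv len v Cons by (intro IH) auto
        then show ?thesis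
          using uz v ceq_Cons ceq_trans by blast
      next
        case 2
        \<comment> \<open>Exchanging \<open>s\<close> into \<open>t # z\<close> must delete a letter
          behind the two leading letters \<open>t s\<close>: deleting \<open>t\<close> would
          identify generators, deleting \<open>s\<close> would make \<open>s\<close> and
          \<open>t\<close> commute. So \<open>u\<close> can start with \<open>s t s\<close>, which
          is excluded.\<close>
        have "reduced (t # z)"
          using reduced_cong[OF \<open>reduced u\<close> z(2)] z(1) Cons by simp
        moreover have "\<not> reduced (s # t # z)"
          using z(1,2) Cons by (intro not_reduced_Cons[of s u']) auto
        ultimately obtain P y Q where P: "t # z = P @ y # Q" "s # P \<sim> P @ [y]" "t # z \<sim> s # P @ Q"
          using exchange_word[OF _ l(1)] by metis
        have "P \<noteq> []"
          using P(1,2) cox_singleton[of s y] False by auto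
        then obtain P' where P': "P = t # P'" "z = P' @ y # Q"
          using P(1) by (cases P) auto
        have "P' \<noteq> []"
          using P(2) P' cox_not_commute[of s t] 2 by (auto simp: z_def)
        then obtain P'' where P'': "P' = s # P''"
          using P' by (cases P') (auto simp: z_def)
        have "[s] @ u' \<sim> [s] @ t # s # P'' @ Q"
          using cox_rel.trans[OF z(2) P(3)] Cons P' P'' by simp
        then have "u' \<sim> t # s # P'' @ Q"
          by (rule cox_cancel_left[of "[s]"]) (use l in auto)
        then have "s # u' \<approx> s # t # s # P'' @ Q"
          using fc' l z(1) P' P'' by (intro ceq_Cons IH) auto
        then show ?thesis
          using fc_word_no_braid[OF less.prems(1) 2, of "[]"] Cons by simp
      qed
    qed
  qed
qed

lemma fc_word_reduced: "fc_word u \<Longrightarrow> u \<in> lists S \<Longrightarrow> reduced u"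
  unfolding reduced_def using fc_word_minimal ceq_length by (metis nat_le_linear order_refl)

section \<open>Fully commutative involutions as self-dual commutation classes\<close>

lemma in_cox_class: "v \<in> cox_class S m u \<longleftrightarrow> u \<sim> v"
  by (simp add: cox_class_def)

lemma cox_length_class: "reduced u \<Longrightarrow> cox_length (cox_class S m u) = length u"
  unfolding cox_length_def
  by (rule Least_equality) (auto simp: in_cox_class reduced_def intro!: bexI[of _ u] cox_rel.refl)

lemma cox_length_le: "u \<sim> v \<Longrightarrow> cox_length (cox_class S m u) \<le> length v"
  unfolding cox_length_def by (rule Least_le) (auto simp: in_cox_class)

lemma ex_reduced:
  assumes "u \<in> lists S"
  obtains v where "u \<sim> v" "reduced v"
proof -
  obtain v where v: "u \<sim> v" "\<And>w. u \<sim> w \<Longrightarrow> length v \<le> length w"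
    using ex_has_least_nat[of "\<lambda>v. u \<sim> v" u length] assms cox_rel.refl by metis
  then have "reduced v"
    unfolding reduced_def using cox_rel_in_lists cox_rel.trans by metis
  with v(1) show ?thesis by (rule that)
qed

lemma fc_word_fully_commutative:
  assumes "fc_word u" "u \<in> lists S"
  shows "fully_commutative m (cox_class S m u)"
  unfolding fully_commutative_def
proof (intro ballI)
  fix v w
  assume "v \<in> reduced_expressions (cox_class S m u)" "w \<in> reduced_expressions (cox_class S m u)"
  then have "u \<approx> v" "u \<approx> w"
    using assms fc_word_minimal fc_word_reduced cox_length_class
    by (auto simp: reduced_expressions_def in_cox_class)
  then show "v \<approx> w"
    using ceq_sym ceq_trans by blast
qed

text \<open>A braid move keeps the element and the length but changes the number of occurrences of
  \<open>s\<close>, which commutations preserve.\<close>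

lemma fully_commutative_fc_word:
  assumes "fully_commutative m (cox_class S m u)" "reduced u"
  shows "fc_word u"
proof -
  have l: "u \<in> lists S"
    using assms by (simp add: reduced_def)
  have red: "v \<in> reduced_expressions (cox_class S m u) \<longleftrightarrow> u \<sim> v \<and> length v = length u" for v
    using assms by (simp add: reduced_expressions_def in_cox_class cox_length_class)
  show ?thesis
    unfolding fc_word_def
  proof (intro allI impI conjI notI)
    fix v p s q
    assume v: "u \<approx> v" "v = p @ [s, s] @ q"
    then have "u \<sim> v" "length v = length u"
      using ceq_imp_cox l ceq_length by auto
    then have "reduced v"
      using reduced_cong assms by blast
    then have "reduced [s, s]"
      using reduced_append v by blast
    moreover from this have "[] @ s # s # [] \<sim> [] @ []"
      by (intro cox_square) (auto simp: reduced_def)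
    ultimately show False
      by (auto simp: reduced_def)
  next
    fix v p s t q
    assume v: "u \<approx> v" "m s t = 3" "v = p @ [s, t, s] @ q"
    let ?w = "p @ [t, s, t] @ q"
    have uv: "u \<sim> v" "length v = length u" "v \<in> lists S"
      using ceq_imp_cox[OF v(1) l] ceq_length[OF v(1)] ceq_lists[OF v(1) l] by simp_all
    moreover have "v \<sim> ?w"
      unfolding v(3) using uv(3) v(2,3) by (intro cox_context cox_braid) auto
    ultimately have "v \<approx> ?w"
      using assms(1) v(3) cox_rel.trans unfolding fully_commutative_def Ball_def red by force
    then have "mset [s, t, s] = mset [t, s, t]"
      using ceq_mset[of v ?w] v(3) by simp
    then have "count (mset [s, t, s]) s = count (mset [t, s, t]) s"
      by simp
    moreover have "s \<noteq> t"
      using m_neq v(2) by blast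
    ultimately show False
      by simp
  qed
qed

definition sd_words :: "'a list set" where
  "sd_words = {u \<in> lists S. fc_word u \<and> u \<approx> rev u}"

definition descents :: "'a list \<Rightarrow> 'a set" where
  "descents u = {s. \<exists>v. u \<approx> v @ [s]}"

lemma involution_iff:
  assumes "u \<in> lists S"
  shows "cox_class S m u \<otimes>\<^bsub>coxeter_group S m\<^esub> cox_class S m u = \<one>\<^bsub>coxeter_group S m\<^esub> \<longleftrightarrow> u \<sim> rev u"
proof -
  have "u @ u \<sim> [] \<longleftrightarrow> u \<sim> rev u"
  proof
    assume "u @ u \<sim> []"
    then have "rev u @ (u @ u) \<sim> rev u @ []"
      using assms by (intro cox_rel_append_left) auto
    moreover have "(rev u @ u) @ u \<sim> [] @ u"
      using assms by (intro cox_rel_append_right cox_rev_left) auto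
    ultimately show "u \<sim> rev u"
      using cox_rel.sym cox_rel.trans by simp blast
  next
    assume "u \<sim> rev u"
    then have "u @ u \<sim> u @ rev u"
      using assms by (intro cox_rel_append_left) auto
    then show "u @ u \<sim> []"
      using cox_rev_right[OF assms] cox_rel.trans by blast
  qed
  then show ?thesis
    using assms by (simp add: mult_coxeter_group one_coxeter_group cox_class_eq_iff)
qed

lemma fc_involutions_eq: "fc_involutions S m = cox_class S m ` sd_words"
proof (intro equalityI subsetI)
  fix w assume w: "w \<in> fc_involutions S m"
  then obtain u0 where u0: "u0 \<in> lists S" "w = cox_class S m u0"
    by (auto simp: fc_involutions_def carrier_coxeter_group)
  obtain u where u: "u0 \<sim> u" "reduced u"
    using ex_reduced[OF u0(1)] .
  then have wu: "w = cox_class S m u"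
    using u0(2) cox_class_eqI by blast
  have l: "u \<in> lists S"
    using u by (simp add: reduced_def)
  have fc: "fc_word u"
    using w wu u fully_commutative_fc_word by (simp add: fc_involutions_def)
  have "u \<sim> rev u"
    using w wu involution_iff[OF l] by (simp add: fc_involutions_def)
  then have "u \<approx> rev u"
    using fc_word_minimal[OF fc l] by simp
  then show "w \<in> cox_class S m ` sd_words"
    using l fc wu by (auto simp: sd_words_def)
next
  fix w assume "w \<in> cox_class S m ` sd_words"
  then obtain u where u: "u \<in> lists S" "fc_word u" "u \<approx> rev u" "w = cox_class S m u"
    by (auto simp: sd_words_def)
  then show "w \<in> fc_involutions S m"
    using fc_word_fully_commutative involution_iff ceq_imp_cox
    by (simp add: fc_involutions_def carrier_coxeter_group)
qed

lemma cox_class_eq_sd_words: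
  assumes "u \<in> sd_words" "v \<in> sd_words" "cox_class S m u = cox_class S m v"
  shows "u \<approx> v"
proof -
  have l: "u \<in> lists S" "v \<in> lists S" "fc_word u" "fc_word v"
    using assms by (auto simp: sd_words_def)
  have "u \<sim> v"
    using assms(3) cox_class_eq_iff[OF l(1,2)] by blast
  then show ?thesis
    using fc_word_minimal[OF l(3,1)] ceq_sym[OF fc_word_minimal[OF l(4,2) cox_rel.sym]]
    by (meson nat_le_linear)
qed

lemma right_descents_class:
  assumes "u \<in> lists S" "fc_word u"
  shows "right_descents S m (cox_class S m u) = descents u"
proof (intro equalityI subsetI)
  have len: "cox_length (cox_class S m u) = length u"
    using assms fc_word_reduced cox_length_class by blast
  fix s assume "s \<in> right_descents S m (cox_class S m u)"
  then have s: "s \<in> S" "cox_length (cox_class S m (u @ [s])) < length u"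
    using assms(1) len mult_coxeter_group[of u S "[s]" m] by (auto simp: right_descents_def)
  then obtain v where v: "u @ [s] \<sim> v" "reduced v"
    using ex_reduced[of "u @ [s]"] assms(1) by auto
  then have "length v < length u"
    using s(2) cox_length_class cox_class_eqI by metis
  have "(u @ [s]) @ [s] \<sim> v @ [s]"
    using v s by (intro cox_rel_append_right) auto
  moreover have "u @ s # s # [] \<sim> u @ []"
    using s assms by (intro cox_square) auto
  ultimately have "u \<sim> v @ [s]"
    using cox_rel.sym cox_rel.trans by simp blast
  then have "u \<approx> v @ [s]"
    using fc_word_minimal[OF assms(2,1)] \<open>length v < length u\<close> by simp
  then show "s \<in> descents u"
    by (auto simp: descents_def)
next
  have len: "cox_length (cox_class S m u) = length u"
    using assms fc_word_reduced cox_length_class by blast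
  fix s assume "s \<in> descents u"
  then obtain v where v: "u \<approx> v @ [s]"
    by (auto simp: descents_def)
  then have l: "v \<in> lists S" "s \<in> S"
    using ceq_lists[OF v assms(1)] by auto
  have "u @ [s] \<sim> (v @ [s]) @ [s]"
    using v l assms(1) by (intro cox_rel_append_right ceq_imp_cox) auto
  moreover have "v @ s # s # [] \<sim> v @ []"
    using l by (intro cox_square) auto
  ultimately have "u @ [s] \<sim> v"
    using cox_rel.trans by fastforce
  then show "s \<in> right_descents S m (cox_class S m u)"
    using cox_length_le[OF \<open>u @ [s] \<sim> v\<close>] ceq_length[OF v] l assms len mult_coxeter_group[of u S "[s]" m]
    by (simp add: right_descents_def)
qed

text \<open>Only neighbours of \<open>s\<close> behind its last occurrence prevent it from moving to
  the end, and each of them is visible in one projection.\<close>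

lemma descents_iff:
  "s \<in> descents u \<longleftrightarrow> s \<in> set u \<and> (\<forall>t. m s t = 3 \<longrightarrow> last (filter (\<lambda>x. x \<in> {s, t}) u) = s)"
proof (intro iffI conjI allI impI)
  assume "s \<in> descents u"
  then obtain v where v: "u \<approx> v @ [s]"
    by (auto simp: descents_def)
  then show "s \<in> set u"
    using ceq_set by fastforce
  fix t assume "m s t = 3"
  then show "last (filter (\<lambda>x. x \<in> {s, t}) u) = s"
    using ceq_filter[OF v, of s t] by simp
next
  assume *: "s \<in> set u \<and> (\<forall>t. m s t = 3 \<longrightarrow> last (filter (\<lambda>x. x \<in> {s, t}) u) = s)"
  then obtain p q where u: "u = p @ s # q" "s \<notin> set q"
    by (meson split_list_last)
  have "m s t = 2" if "t \<in> set q" for t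
  proof (rule ccontr)
    assume "m s t \<noteq> 2"
    then have "m s t = 3"
      using m_cases[of s t] m_eq_1[of s t] that u by blast
    then have "last (filter (\<lambda>x. x \<in> {s, t}) q) = s"
      using * u that by (auto simp: filter_empty_conv split: if_splits)
    moreover have "filter (\<lambda>x. x \<in> {s, t}) q \<noteq> []"
      using that by (auto simp: filter_empty_conv)
    ultimately show False
      using u(2) last_in_set by fastforce
  qed
  then have "p @ s # q \<approx> p @ q @ [s]"
    by (intro ceq_append_left ceq_move) auto
  then show "s \<in> descents u"
    using u by (auto simp: descents_def intro!: exI[of _ "p @ q"])
qed

text \<open>By self-duality \<open>s\<close> is also a possible first letter. Either the first and
  the last \<open>s\<close> are two occurrences, removed together, or there is a single one, which
  then commutes with all other letters.\<close>

lemma peel: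
  assumes "u \<in> sd_words" "s \<in> descents u"
  obtains u' where "u' \<in> sd_words" "u \<approx> s # u' @ [s]"
  | u' where "u' \<in> sd_words" "u \<approx> u' @ [s]" "s \<notin> set u'"
proof -
  have u: "u \<in> lists S" "fc_word u" "u \<approx> rev u"
    using assms by (auto simp: sd_words_def)
  obtain v where v: "u \<approx> v @ [s]"
    using assms(2) by (auto simp: descents_def)
  have vl: "v \<in> lists S" "s \<in> S"
    using ceq_lists[OF v u(1)] by auto
  have "rev u \<approx> rev (v @ [s])"
    using v by (rule ceq_rev)
  then have "u \<approx> s # rev v"
    using ceq_trans[OF u(3)] by simp
  then have vs: "v @ [s] \<approx> s # rev v"
    by (rule ceq_trans[OF ceq_sym[OF v]])
  \<comment> \<open>The class contains a word starting with \<open>s\<close>, so each projection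
    onto a non-commuting pair starts with \<open>s\<close>; nothing in front of the first
    \<open>s\<close> can block it.\<close>
  have comm: "p @ s # q \<approx> s # p @ q" if "v @ [s] = p @ s # q" "s \<notin> set p" for p q
  proof -
    have "m s t = 2" if "t \<in> set p" for t
    proof (rule ccontr)
      assume "m s t \<noteq> 2"
      moreover have "s \<noteq> t"
        using \<open>s \<notin> set p\<close> that by blast
      ultimately have "hd (filter (\<lambda>x. x \<in> {s, t}) (p @ s # q)) = s"
        using ceq_filter[OF vs, of s t] \<open>v @ [s] = p @ s # q\<close> by simp
      moreover have "filter (\<lambda>x. x \<in> {s, t}) p \<noteq> []"
        using that by (auto simp: filter_empty_conv)
      ultimately show False
        using \<open>s \<notin> set p\<close> hd_in_set[of "filter (\<lambda>x. x \<in> {s, t}) p"] by auto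
    qed
    then have "(p @ [s]) @ q \<approx> (s # p) @ q"
      by (intro ceq_append_right ceq_sym[OF ceq_move]) auto
    then show ?thesis by simp
  qed
  show ?thesis
  proof (cases "s \<in> set v")
    case True
    then obtain p q where pq: "v = p @ s # q" "s \<notin> set p"
      by (meson split_list_first)
    have "v @ [s] \<approx> s # (p @ q) @ [s]"
      using comm[of p "q @ [s]"] pq by simp
    with v have u': "u \<approx> s # (p @ q) @ [s]"
      by (rule ceq_trans)
    have "s # (p @ q) @ [s] \<approx> rev (s # (p @ q) @ [s])"
      by (rule ceq_trans[OF ceq_sym[OF u'] ceq_trans[OF u(3) ceq_rev[OF u']]])
    \<comment> \<open>The outer letters are cancelled in the group; minimality of fully commutative
      words then turns the result into a commutation equivalence.\<close>
    then have "[s] @ (p @ q) @ [s] \<sim> [s] @ rev (p @ q) @ [s]"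
      using ceq_imp_cox[of "s # (p @ q) @ [s]"] vl pq by simp
    then have "(p @ q) @ [s] \<sim> rev (p @ q) @ [s]"
      by (rule cox_cancel_left[of "[s]"]) (use vl in auto)
    then have "p @ q \<sim> rev (p @ q)"
      by (rule cox_cancel_right[of _ "[s]"]) (use vl in auto)
    moreover have "fc_word (p @ q)"
      using fc_word_append[of "[s]" "p @ q" "[s]"] fc_word_ceq[OF u(2) u'] by simp
    ultimately have "p @ q \<in> sd_words"
      using vl pq fc_word_minimal[of "p @ q" "rev (p @ q)"] by (simp add: sd_words_def)
    then show ?thesis
      using u' by (rule that(1))
  next
    case False
    have "v @ [s] \<approx> s # v"
      using comm[of v "[]"] False by simp
    then have "s # v \<approx> s # rev v"
      using vs by (rule ceq_trans[OF ceq_sym])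
    then have "[s] @ v \<sim> [s] @ rev v"
      using ceq_imp_cox[of "s # v"] vl by simp
    then have "v \<sim> rev v"
      by (rule cox_cancel_left[of "[s]"]) (use vl in auto)
    moreover have "fc_word v"
      using fc_word_append[of "[]" v "[s]"] fc_word_ceq[OF u(2) v] by simp
    ultimately have "v \<in> sd_words"
      using vl fc_word_minimal[of v "rev v"] by (simp add: sd_words_def)
    then show ?thesis
      using v False by (rule that(2))
  qed
qed

text \<open>Peel a common descent from both words. The multiplicity of this letter, one or at least
  two, decides which form of peeling occurs, so it is the same for both and the remaining multisets
  agree.\<close>

lemma sd_words_eqI:
  assumes desc: "\<And>u v. u \<in> sd_words \<Longrightarrow> v \<in> sd_words \<Longrightarrow> mset u = mset v \<Longrightarrow> descents u = descents v"
    and "u \<in> sd_words" "v \<in> sd_words" "mset u = mset v"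
  shows "u \<approx> v"
  using assms(2-)
proof (induction "length u" arbitrary: u v rule: less_induct)
  case less
  show ?case
  proof (cases u rule: rev_cases)
    case Nil
    then show ?thesis using less.prems by simp
  next
    case (snoc u0 s)
    then have su: "s \<in> descents u"
      by (auto simp: descents_def)
    then have sv: "s \<in> descents v"
      using desc less.prems by blast
    have clash: False
      if "mset x = mset y" "x \<approx> s # x' @ [s]" "y \<approx> y' @ [s]" "s \<notin> set y'" for x y x' y'
    proof -
      have "add_mset s (add_mset s (mset x')) = add_mset s (mset y')"
        using that(1) ceq_mset[OF that(2)] ceq_mset[OF that(3)] by simp
      then show False
        using that(4) by (metis add_mset_add_mset_same_iff set_mset_mset union_single_eq_member)
    qed
    from peel[OF less.prems(1) su] show ?thesis
    proof cases
      case u': (1 u')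
      from peel[OF less.prems(2) sv] show ?thesis
      proof cases
        case v': (1 v')
        have "mset u' = mset v'"
          using less.prems(3) ceq_mset[OF u'(2)] ceq_mset[OF v'(2)] by simp
        then have "u' \<approx> v'"
          using less.hyps[of u' v'] u'(1) v'(1) ceq_length[OF u'(2)] by simp
        then have "[s] @ u' @ [s] \<approx> [s] @ v' @ [s]"
          by (rule ceq_append)
        then have "s # u' @ [s] \<approx> s # v' @ [s]"
          by simp
        then show ?thesis
          by (rule ceq_trans[OF ceq_trans[OF u'(2)] ceq_sym[OF v'(2)]])
      next
        case (2 v')
        then show ?thesis
          using clash[OF less.prems(3) u'(2)] by blast
      qed
    next
      case u': (2 u')
      from peel[OF less.prems(2) sv] show ?thesis
      proof cases
        case (1 v')
        then show ?thesis
          using clash[OF less.prems(3)[symmetric] _ u'(2,3)] by blast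
      next
        case v': (2 v')
        have "mset u' = mset v'"
          using less.prems(3) ceq_mset[OF u'(2)] ceq_mset[OF v'(2)] by simp
        then have "u' \<approx> v'"
          using less.hyps[of u' v'] u'(1) v'(1) ceq_length[OF u'(2)] by simp
        then have "u' @ [s] \<approx> v' @ [s]"
          by (rule ceq_append_right)
        then show ?thesis
          by (rule ceq_trans[OF ceq_trans[OF u'(2)] ceq_sym[OF v'(2)]])
      qed
    qed
  qed
qed

section \<open>Heaps\<close>

text \<open>A heap is a set of letters placed at integer levels; its linear extensions are the words of
  one commutation class.\<close>

definition below :: "'a \<times> int \<Rightarrow> 'a \<times> int \<Rightarrow> bool" where
  "below a b \<longleftrightarrow> (m (fst a) (fst b) \<noteq> 2 \<longrightarrow> snd a < snd b)"

abbreviation linear_ext :: "('a \<times> int) list \<Rightarrow> bool" where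
  "linear_ext L \<equiv> sorted_wrt below L"

lemma linear_ext_ceq:
  assumes "linear_ext L" "map fst L \<approx> v"
  shows "\<exists>L'. v = map fst L' \<and> linear_ext L' \<and> set L' = set L"
  using assms(2)
proof (induction rule: ceq_induct)
  case refl
  then show ?case using assms(1) by blast
next
  case (step p s t q)
  then obtain L' where L': "p @ [s, t] @ q = map fst L'" "linear_ext L'" "set L' = set L"
    by blast
  then obtain A a b B where AB: "L' = A @ [a, b] @ B" "map fst A = p" "fst a = s" "fst b = t" "map fst B = q"
    by (auto simp: append_eq_map_conv Cons_eq_map_conv)
  have "linear_ext (A @ [b, a] @ B)"
    using L'(2) AB step.hyps by (auto simp: sorted_wrt_append below_def m_sym[of t s])
  moreover have "set (A @ [b, a] @ B) = set L"
    using L'(3) AB by auto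
  moreover have "p @ [t, s] @ q = map fst (A @ [b, a] @ B)"
    using AB by simp
  ultimately show ?case
    by blast
qed

lemma linear_ext_distinct: "linear_ext L \<Longrightarrow> distinct L"
  by (induction L) (auto simp: below_def)

text \<open>Whatever precedes the first element of \<open>L\<close> in \<open>L'\<close> commutes
  with it, since otherwise their levels would be ordered in both ways. So this element moves to the
  front of \<open>L'\<close>.\<close>

lemma linear_ext_unique:
  assumes "linear_ext L" "linear_ext L'" "set L = set L'"
  shows "map fst L \<approx> map fst L'"
  using assms
proof (induction L arbitrary: L')
  case (Cons a L)
  then obtain A B where L': "L' = A @ a # B"
    by (metis list.set_intros(1) split_list)
  have d: "distinct (a # L)" "distinct L'"
    using Cons.prems linear_ext_distinct by blast+
  then have set: "set L = set (A @ B)"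
    using Cons.prems(3) L' by auto
  have "m (fst a) (fst b) = 2" if "b \<in> set A" for b
  proof (rule ccontr)
    assume ne: "m (fst a) (fst b) \<noteq> 2"
    have "below b a"
      using Cons.prems(2) L' that by (auto simp: sorted_wrt_append)
    moreover have "below a b"
      using Cons.prems(1) set that by auto
    ultimately show False
      using ne m_sym[of "fst a"] by (auto simp: below_def)
  qed
  then have "fst a # map fst A \<approx> map fst A @ [fst a]"
    by (intro ceq_move) auto
  then have "(fst a # map fst A) @ map fst B \<approx> (map fst A @ [fst a]) @ map fst B"
    by (rule ceq_append_right)
  moreover have "fst a # map fst L \<approx> fst a # map fst (A @ B)"
    using Cons.prems set L' by (intro ceq_Cons Cons.IH) (auto simp: sorted_wrt_append)
  ultimately show ?case
    using L' ceq_trans by fastforce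
qed simp

text \<open>Neighbours of \<open>s\<close> at levels strictly between two occurrences of
  \<open>s\<close> stand between them in every linear extension. One neighbour rules out
  \<open>s s\<close>, a second one rules out \<open>s t s\<close>.\<close>

lemma linear_ext_fc_word:
  assumes "linear_ext L"
    and gap: "\<And>s y y'. (s, y) \<in> set L \<Longrightarrow> (s, y') \<in> set L \<Longrightarrow> y < y' \<Longrightarrow>
      \<exists>a\<in>set L. \<exists>b\<in>set L. a \<noteq> b \<and> m s (fst a) = 3 \<and> m s (fst b) = 3 \<and>
        y < snd a \<and> snd a < y' \<and> y < snd b \<and> snd b < y'"
  shows "fc_word (map fst L)"
proof -
  have between: "a \<in> set M"
    if L': "linear_ext (A @ (s, y) # M @ (s, y') # B)" "a \<in> set (A @ (s, y) # M @ (s, y') # B)"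
      and a: "m s (fst a) = 3" "y < snd a" "snd a < y'" for A M B s y y' a
  proof -
    have "m (fst a) s = 3"
      using a m_sym by metis
    then have "\<not> below a (s, y)" "\<not> below (s, y') a" "a \<noteq> (s, y)" "a \<noteq> (s, y')"
      using a by (auto simp: below_def)
    then show ?thesis
      using L' by (auto simp: sorted_wrt_append)
  qed
  show ?thesis
    unfolding fc_word_def
  proof (intro allI impI conjI notI)
    fix v p s q
    assume v: "map fst L \<approx> v" "v = p @ [s, s] @ q"
    obtain L' where L': "v = map fst L'" "linear_ext L'" "set L' = set L"
      using linear_ext_ceq[OF assms(1) v(1)] by blast
    then obtain A y y' B where AB: "L' = A @ (s, y) # [] @ (s, y') # B"
      using v(2) by (auto simp: append_eq_map_conv Cons_eq_map_conv)
    then have "y < y'"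
      using L'(2) by (simp add: sorted_wrt_append below_def)
    moreover have "(s, y) \<in> set L" "(s, y') \<in> set L"
      using AB by (simp_all flip: L'(3))
    ultimately obtain a where "a \<in> set L'" "m s (fst a) = 3" "y < snd a" "snd a < y'"
      using gap[of s y y'] unfolding L'(3) by blast
    then have "a \<in> set []"
      using L'(2) unfolding AB by (rule between[rotated])
    then show False
      by simp
  next
    fix v p s t q
    assume v: "map fst L \<approx> v" "m s t = 3" "v = p @ [s, t, s] @ q"
    obtain L' where L': "v = map fst L'" "linear_ext L'" "set L' = set L"
      using linear_ext_ceq[OF assms(1) v(1)] by blast
    then obtain A y z y' B where AB: "L' = A @ (s, y) # [(t, z)] @ (s, y') # B"
      using v(3) by (auto simp: append_eq_map_conv Cons_eq_map_conv)
    then have "y < y'"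
      using L'(2) by (simp add: sorted_wrt_append below_def)
    moreover have "(s, y) \<in> set L" "(s, y') \<in> set L"
      using AB by (simp_all flip: L'(3))
    ultimately obtain a b where ab: "a \<in> set L'" "m s (fst a) = 3" "y < snd a" "snd a < y'"
      "b \<in> set L'" "m s (fst b) = 3" "y < snd b" "snd b < y'" "a \<noteq> b"
      using gap[of s y y'] unfolding L'(3) by blast
    have "a \<in> set [(t, z)]" "b \<in> set [(t, z)]"
      using ab(1-4) ab(5-8) L'(2) unfolding AB by (blast intro: between)+
    then show False
      using ab(9) by simp
  qed
qed

text \<open>Negating the levels and reversing the list gives another linear extension of the same
  heap.\<close>

lemma linear_ext_selfdual:
  assumes "linear_ext L" "\<And>s y. (s, y) \<in> set L \<Longrightarrow> (s, - y) \<in> set L"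
  shows "map fst L \<approx> rev (map fst L)"
proof -
  let ?f = "\<lambda>(s, y). (s, - y)"
  have "linear_ext (rev (map ?f L))"
    using assms(1) unfolding sorted_wrt_rev sorted_wrt_map
    by (rule sorted_wrt_mono_rel[rotated]) (auto simp: below_def m_sym)
  moreover have "set (rev (map ?f L)) = set L"
    using assms(2) by force
  ultimately have "map fst L \<approx> map fst (rev (map ?f L))"
    using assms(1) by (intro linear_ext_unique) auto
  also have "map fst (rev (map ?f L)) = rev (map fst L)"
    by (simp add: rev_map split_beta o_def)
  finally show ?thesis .
qed

lemma ex_linear_ext:
  assumes "finite H" "\<And>s t y. (s, y) \<in> H \<Longrightarrow> (t, y) \<in> H \<Longrightarrow> s \<noteq> t \<Longrightarrow> m s t = 2"
  obtains L where "set L = H" "linear_ext L"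
proof -
  obtain xs where xs: "set xs = H" "distinct xs"
    using finite_distinct_list[OF assms(1)] by blast
  have "linear_ext L" if "sorted (map snd L)" "distinct L" "set L \<subseteq> H" for L
    using that
  proof (induction L)
    case (Cons a L)
    have "below a b" if "b \<in> set L" for b
      using Cons.prems that assms(2)[of "fst a" "snd a" "fst b"]
      by (cases a; cases b) (fastforce simp: below_def)
    then show ?case
      using Cons by auto
  qed simp
  then show ?thesis
    using that[of "sort_key snd xs"] xs by simp
qed

lemma count_linear_ext:
  assumes "linear_ext L"
  shows "count_list (map fst L) s = card {y. (s, y) \<in> set L}"
proof -
  have "count_list (map fst L) s = length (filter (\<lambda>a. fst a = s) L)"
    by (induction L) auto
  also have "\<dots> = card {a \<in> set L. fst a = s}"
    using linear_ext_distinct[OF assms] by (metis distinct_card distinct_filter set_filter)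
  also have "\<dots> = card (Pair s ` {y. (s, y) \<in> set L})"
    by (rule arg_cong[of _ _ card]) force
  also have "\<dots> = card {y. (s, y) \<in> set L}"
    by (rule card_image) (simp add: inj_on_def)
  finally show ?thesis .
qed

end

section \<open>Palindromes\<close>

lemma filter_eq_append_ConsE:
  assumes "filter Q u = A @ x # B"
  obtains p q where "u = p @ x # q" "filter Q p = A" "filter Q q = B"
proof -
  have "\<exists>p q. u = p @ x # q \<and> filter Q p = A \<and> filter Q q = B"
    using assms
  proof (induction A arbitrary: u)
    case Nil
    then have "filter Q u = x # B"
      by simp
    then obtain us vs where "u = us @ x # vs" "\<forall>z\<in>set us. \<not> Q z" "B = filter Q vs"
      unfolding filter_eq_Cons_iff by blast
    then show ?case
      by (intro exI[of _ us] exI[of _ vs]) simp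
  next
    case (Cons y A)
    then have "filter Q u = y # A @ x # B"
      by simp
    then obtain us vs where *: "u = us @ y # vs" "\<forall>z\<in>set us. \<not> Q z" "Q y" "A @ x # B = filter Q vs"
      unfolding filter_eq_Cons_iff by blast
    then obtain p q where "vs = p @ x # q" "filter Q p = A" "filter Q q = B"
      using Cons.IH[of vs] by auto
    then show ?case
      using * by (intro exI[of _ "us @ y # p"] exI[of _ q]) simp
  qed
  then show ?thesis
    using that by blast
qed

lemma filter_eq_append_Cons2E:
  assumes "filter Q u = A @ x # B @ y # C"
  obtains p q r where "u = p @ x # q @ y # r" "filter Q p = A" "filter Q q = B" "filter Q r = C"
proof -
  obtain p s where *: "u = p @ x # s" "filter Q p = A" "filter Q s = B @ y # C"
    using assms by (rule filter_eq_append_ConsE)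
  obtain q r where "s = q @ y # r" "filter Q q = B" "filter Q r = C"
    using *(3) by (rule filter_eq_append_ConsE)
  then show ?thesis
    using that * by blast
qed

lemma count_list_filter: "count_list (filter Q u) x = (if Q x then count_list u x else 0)"
  by (induction u) auto

lemma two_occurrencesE:
  assumes "2 \<le> count_list q x"
  obtains q1 q2 q3 where "q = q1 @ x # q2 @ x # q3" "x \<notin> set q2"
proof -
  have "x \<in> set q"
    using assms count_list_0_iff[of q x] by auto
  then obtain q1 q' where q1: "q = q1 @ x # q'" "x \<notin> set q1"
    by (meson split_list_first)
  then have "x \<in> set q'"
    using assms count_list_0_iff[of q' x] count_list_0_iff[of q1 x] by auto
  then obtain q2 q3 where "q' = q2 @ x # q3" "x \<notin> set q2"
    by (meson split_list_first)
  then show ?thesis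
    using q1 that by blast
qed

lemma distinct_adjI: "(\<And>A x B. f \<noteq> A @ x # x # B) \<Longrightarrow> distinct_adj f"
proof (induction f)
  case (Cons z f)
  have "f \<noteq> A @ x # x # B" for A x B
    using Cons.prems[of "z # A" x B] by simp
  moreover have "z \<noteq> hd f" if "f \<noteq> []"
    using Cons.prems[of "[]" z "tl f"] that by (cases f) auto
  ultimately show ?case
    using Cons.IH by (auto simp: distinct_adj_Cons)
qed simp

lemma alternating_count:
  assumes "distinct_adj (z # f)" "set (z # f) \<subseteq> {x, y}" "x \<noteq> y"
  shows "count_list (z # f) x + (if last (z # f) = y then 1 else 0)
    = count_list (z # f) y + (if z = x then 1 else 0)"
  using assms
proof (induction f arbitrary: z)
  case (Cons z' f)
  then show ?case
    using Cons.IH[of z'] by (auto split: if_splits)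
qed auto

lemma alternating_palindrome:
  assumes "distinct_adj f" "set f \<subseteq> {x, y}" "x \<noteq> y" "rev f = f" "f \<noteq> []"
  shows "(last f = x \<and> count_list f x = Suc (count_list f y)) \<or>
    (last f = y \<and> count_list f y = Suc (count_list f x))"
proof -
  obtain z f' where f: "f = z # f'"
    using assms(5) by (cases f) auto
  have "last f = z"
    using hd_rev[of f] assms(4) f by simp
  moreover have "last f \<in> {x, y}"
    using assms(2,5) last_in_set by blast
  ultimately show ?thesis
    using alternating_count[of z f' x y] assms(1-3) f by (auto split: if_splits)
qed

text \<open>The two \<open>y\<close> cut \<open>f\<close> into three blocks of at most one
  \<open>x\<close> each, and symmetry makes the outer blocks equal.\<close>

lemma nested_palindrome:
  assumes "rev f = f" "set f \<subseteq> {x, y}" "x \<noteq> y" "count_list f y = 2" "\<And>A B. f \<noteq> A @ x # x # B"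
  shows "f \<in> {[y, y], [y, x, y], [x, y, y, x], [x, y, x, y, x]}"
proof -
  have "2 \<le> count_list f y"
    using assms(4) by simp
  then obtain A B C where f: "f = A @ y # B @ y # C"
    by (rule two_occurrencesE)
  have cnt: "y \<notin> set A" "y \<notin> set B" "y \<notin> set C"
    using assms(4) f by (auto simp flip: count_list_0_iff)
  have short: "D = [] \<or> D = [x]" if D: "D \<in> {A, B, C}" for D
  proof (cases D rule: remdups_adj.cases)
    case (3 z1 z2 D')
    have "set D \<subseteq> {x}"
      using D f cnt assms(2) by auto
    then have "D = [] @ x # x # D'"
      using 3 by auto
    moreover have "f = [] @ A @ y # B @ y # C" "f = (A @ [y]) @ B @ y # C" "f = (A @ y # B @ [y]) @ C @ []"
      using f by simp_all
    then obtain X Y where "f = X @ D @ Y"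
      using D by blast
    ultimately have "f = X @ x # x # (D' @ Y)"
      by simp
    then show ?thesis
      using assms(5) by blast
  qed (use D f cnt assms(2) in auto)
  show ?thesis
    using short[of A] short[of B] short[of C] f assms(1,3) by auto
qed

section \<open>The fork of the Coxeter graph\<close>

text \<open>The condition imposed by full commutativity on the subword of the letters \<open>a\<close>, \<open>b\<close>, \<open>c\<close>,
  where \<open>a\<close> is the branching vertex and \<open>b\<close>, \<open>c\<close> are the leaves attached to it.\<close>

definition fork_ok :: "'a \<Rightarrow> 'a \<Rightarrow> 'a \<Rightarrow> 'a list \<Rightarrow> bool" where
  "fork_ok a b c f \<longleftrightarrow> set f \<subseteq> {a, b, c} \<and>
     (\<forall>A s B C. f = A @ s # B @ s # C \<longrightarrow> s \<notin> set B \<longrightarrow>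
        (if s = a then B = [b] \<or> B = [c] else 2 \<le> count_list B a))"

lemma fork_ok_gap:
  assumes "fork_ok a b c f" "f = A @ s # B @ s # C" "s \<notin> set B"
  shows "if s = a then B = [b] \<or> B = [c] else 2 \<le> count_list B a"
  using assms unfolding fork_ok_def by blast

lemma fork_ok_append: "fork_ok a b c (A @ f @ B) \<Longrightarrow> fork_ok a b c f"
  unfolding fork_ok_def
proof (elim conjE, intro conjI allI impI)
  fix A' s B' C'
  assume *: "\<forall>A' s B' C'. A @ f @ B = A' @ s # B' @ s # C' \<longrightarrow> s \<notin> set B' \<longrightarrow>
        (if s = a then B' = [b] \<or> B' = [c] else 2 \<le> count_list B' a)"
    and "f = A' @ s # B' @ s # C'" "s \<notin> set B'"
  then have "A @ f @ B = (A @ A') @ s # B' @ s # (C' @ B)"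
    by simp
  then show "if s = a then B' = [b] \<or> B' = [c] else 2 \<le> count_list B' a"
    using * \<open>s \<notin> set B'\<close> by blast
qed auto

lemma fork_ok_rev:
  assumes "fork_ok a b c f"
  shows "fork_ok a b c (rev f)"
  unfolding fork_ok_def
proof (intro conjI allI impI)
  show "set (rev f) \<subseteq> {a, b, c}"
    using assms by (simp add: fork_ok_def)
  fix A s B C assume "rev f = A @ s # B @ s # C" "s \<notin> set B"
  then have "f = rev C @ s # rev B @ s # rev A" "s \<notin> set (rev B)"
    by (auto simp: rev_swap)
  then have "if s = a then rev B = [b] \<or> rev B = [c] else 2 \<le> count_list (rev B) a"
    using fork_ok_gap[OF assms] by blast
  then show "if s = a then B = [b] \<or> B = [c] else 2 \<le> count_list B a"
    by (auto simp: rev_swap split: if_splits)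
qed

lemma fork_ok_commute:
  assumes "fork_ok a b c f"
  shows "fork_ok a c b f"
  unfolding fork_ok_def
proof (intro conjI allI impI)
  show "set f \<subseteq> {a, c, b}"
    using assms by (auto simp: fork_ok_def)
  fix A s B C assume "f = A @ s # B @ s # C" "s \<notin> set B"
  then show "if s = a then B = [c] \<or> B = [b] else 2 \<le> count_list B a"
    using fork_ok_gap[OF assms, of A s B C] by (auto split: if_splits)
qed

lemma fork_ok_next:
  assumes "fork_ok a b c (F @ [x, y, z])" "distinct [a, b, c]"
  shows "y = a \<Longrightarrow> x = b \<Longrightarrow> z = c" "y = a \<Longrightarrow> x = c \<Longrightarrow> z = b"
    and "y \<noteq> a \<Longrightarrow> z \<noteq> y"
proof -
  have z: "z \<in> {a, b, c}"
    using assms(1) by (auto simp: fork_ok_def)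
  have yz: "y \<noteq> z"
    using fork_ok_gap[OF assms(1), of "F @ [x]" y "[]" "[]"] by (auto split: if_splits)
  have xz: "x \<noteq> z" if "y = a" "x \<noteq> a"
    using fork_ok_gap[OF assms(1), of F x "[y]" "[]"] that by (auto split: if_splits)
  show "y = a \<Longrightarrow> x = b \<Longrightarrow> z = c" "y = a \<Longrightarrow> x = c \<Longrightarrow> z = b" "y \<noteq> a \<Longrightarrow> z \<noteq> y"
    using z yz xz assms(2) by auto
qed

lemma fork_ok_leaves_suffix:
  assumes "fork_ok a b c (A @ b # c # B)" "distinct [a, b, c]"
  shows "B = [] \<or> B = [a]"
proof (cases B)
  case (Cons z B')
  have z: "z \<in> {a, b, c}"
    using assms(1) Cons by (auto simp: fork_ok_def)
  have "z \<noteq> b" "z \<noteq> c"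
    using fork_ok_gap[OF assms(1), of A b "[c]" B'] fork_ok_gap[OF assms(1), of "A @ [b]" c "[]" B']
      Cons assms(2) by auto
  then have za: "z = a"
    using z by simp
  show ?thesis
  proof (cases B')
    case Nil
    then show ?thesis using Cons za by simp
  next
    case (Cons z' B'')
    have B: "B = a # z' # B''"
      using \<open>B = z # B'\<close> Cons za by simp
    have "z' \<in> {a, b, c}"
      using assms(1) B by (auto simp: fork_ok_def)
    moreover have "z' \<noteq> a"
      using fork_ok_gap[OF assms(1), of "A @ [b, c]" a "[]" B''] B by auto
    moreover have "z' \<noteq> b"
      using fork_ok_gap[OF assms(1), of A b "[c, a]" B''] B assms(2) by auto
    moreover have "z' \<noteq> c"
      using fork_ok_gap[OF assms(1), of "A @ [b]" c "[a]" B''] B assms(2) by auto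
    ultimately show ?thesis
      by blast
  qed
qed simp

text \<open>At most one \<open>a\<close> fits on either side of \<open>b c\<close>. Having it on
  both sides gives the forbidden gap \<open>a b c a\<close>, having it on one side breaks the
  symmetry of the \<open>{a, b}\<close> projection.\<close>

lemma fork_ok_leaves:
  assumes "fork_ok a b c (A @ b # c # B)" "distinct [a, b, c]"
    and "rev (filter (\<lambda>x. x \<in> {a, b}) (A @ b # c # B)) = filter (\<lambda>x. x \<in> {a, b}) (A @ b # c # B)"
  shows "A @ b # c # B = [b, c]"
proof -
  have "B = [] \<or> B = [a]"
    using assms(1,2) by (rule fork_ok_leaves_suffix)
  moreover have "fork_ok a c b (rev B @ c # b # rev A)"
    using fork_ok_commute[OF fork_ok_rev[OF assms(1)]] by simp
  then have "rev A = [] \<or> rev A = [a]"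
    by (rule fork_ok_leaves_suffix) (use assms(2) in auto)
  moreover have False if "A = [a]" "B = [a]"
    using fork_ok_gap[OF assms(1), of "[]" a "[b, c]" "[]"] that assms(2) by auto
  ultimately show ?thesis
    using assms(2,3) by auto
qed

text \<open>If leaves are never adjacent, every other letter is \<open>a\<close>. A leaf recurs only
  after two \<open>a\<close>, so the leaves in between alternate. The four candidates for
  \<open>s\<close> are the starting points in the period \<open>abac\<close>.\<close>

lemma fork_ok_periodic:
  assumes "fork_ok a b c f" "distinct [a, b, c]"
    and "\<And>A B. f \<noteq> A @ b # c # B" "\<And>A B. f \<noteq> A @ c # b # B"
  shows "\<exists>s\<in>{[a, b, a, c], [a, c, a, b], [b, a, c, a], [c, a, b, a]}. \<exists>r i. i < 4 \<and>
    f = concat (replicate r s) @ take i s"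
  using assms
proof (induction f rule: rev_induct)
  case Nil
  then show ?case
    by (intro bexI[of _ "[a, b, a, c]"] exI[of _ 0]) auto
next
  case (snoc z f)
  have fz: "z \<in> {a, b, c}"
    using snoc.prems(1) by (auto simp: fork_ok_def)
  have "fork_ok a b c f"
    using fork_ok_append[of a b c "[]" f "[z]"] snoc.prems(1) by simp
  moreover have "f \<noteq> A @ b # c # B" "f \<noteq> A @ c # b # B" for A B
    using snoc.prems(3)[of A "B @ [z]"] snoc.prems(4)[of A "B @ [z]"] by auto
  ultimately obtain s r i where s: "s \<in> {[a, b, a, c], [a, c, a, b], [b, a, c, a], [c, a, b, a]}"
    "i < 4" "f = concat (replicate r s) @ take i s"
    using snoc.IH snoc.prems(2) by blast
  show ?case
  proof (cases "length f < 2")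
    case True
    then consider "f = []" | y where "f = [y]"
      by (cases f rule: remdups_adj.cases) auto
    then show ?thesis
    proof cases
      case 1
      have "\<exists>s\<in>{[a, b, a, c], [a, c, a, b], [b, a, c, a], [c, a, b, a]}. [z] = take 1 s"
        using fz by auto
      then show ?thesis
        using 1 by (metis (no_types, lifting) append_Nil concat.simps(1) one_less_numeral_iff
            replicate_0 semiring_norm(76))
    next
      case (2 y)
      have y: "y \<in> {a, b, c}" "y \<noteq> z"
        using snoc.prems(1) 2 fork_ok_gap[OF snoc.prems(1), of "[]" y "[]" "[]"]
        by (auto simp: fork_ok_def split: if_splits)
      then have "\<exists>s\<in>{[a, b, a, c], [a, c, a, b], [b, a, c, a], [c, a, b, a]}. [y, z] = take 2 s"
        using fz 2 snoc.prems(3)[of "[]" "[]"] snoc.prems(4)[of "[]" "[]"] by auto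
      then obtain s where "s \<in> {[a, b, a, c], [a, c, a, b], [b, a, c, a], [c, a, b, a]}"
        "[y, z] = take 2 s"
        by blast
      then show ?thesis
        using 2 by (intro bexI[of _ s] exI[of _ 0] exI[of _ "2::nat"]) auto
    qed
  next
    case False
    obtain F x y where f: "f = F @ [x, y]"
    proof -
      obtain f1 y where f1: "f = f1 @ [y]"
        using False by (cases f rule: rev_cases) auto
      moreover obtain F x where "f1 = F @ [x]"
        using False f1 by (cases f1 rule: rev_cases) auto
      ultimately show ?thesis
        using that by simp
    qed
    note nxt = fork_ok_next[of a b c F x y z, OF _ snoc.prems(2)]
    have ok: "fork_ok a b c (F @ [x, y, z])"
      using snoc.prems(1) f by simp
    have za: "z = a" if "y \<noteq> a"
      using nxt(3)[OF ok that] fz that snoc.prems(1) snoc.prems(3)[of "F @ [x]" "[]"]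
        snoc.prems(4)[of "F @ [x]" "[]"] f by (auto simp: fork_ok_def)
    have step: "z = s ! i"
    proof -
      have sl: "length s = 4"
        using s(1) by auto
      consider "i = 0" | "i = 1" | "i = 2" | "i = 3"
        using s(2) by linarith
      then show ?thesis
      proof cases
        case 1
        then obtain r' where "r = Suc r'"
          using False s(3) by (cases r) auto
        then have "f = concat (replicate r' s) @ s"
          using s(3) 1 by (simp flip: replicate_append_same)
        then have "x = s ! 2" "y = s ! 3"
          using s(1) f by auto
        then show ?thesis
          using s(1) 1 za nxt(1,2)[OF ok] snoc.prems(2) by auto
      next
        case 2
        then obtain r' where "r = Suc r'"
          using False s(1,3) by (cases r) auto
        then have "f = concat (replicate r' s) @ s @ [s ! 0]"
          using s(1,3) 2 by (auto simp flip: replicate_append_same)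
        then have "x = s ! 3" "y = s ! 0"
          using s(1) f by auto
        then show ?thesis
          using s(1) 2 za nxt(1,2)[OF ok] snoc.prems(2) by auto
      next
        case 3
        then have "x = s ! 0" "y = s ! 1"
          using s(1,3) f by (auto simp: numeral_2_eq_2)
        then show ?thesis
          using s(1) 3 za nxt(1,2)[OF ok] snoc.prems(2) by auto
      next
        case 4
        then have "x = s ! 1" "y = s ! 2"
          using s(1,3) f by (auto simp: numeral_3_eq_3)
        then show ?thesis
          using s(1) 4 za nxt(1,2)[OF ok] snoc.prems(2) by auto
      qed
    qed
    have "length s = 4"
      using s(1) by auto
    have "f @ [z] = concat (replicate r s) @ take (Suc i) s"
      using s(2,3) step \<open>length s = 4\<close> by (simp add: take_Suc_conv_app_nth)
    moreover have "concat (replicate r s) @ take (Suc i) s = concat (replicate (Suc r) s) @ take 0 s"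
      if "i = 3"
    proof -
      have "replicate (Suc r) s = replicate r s @ [s]"
        by (simp add: replicate_append_same)
      then show ?thesis
        using that \<open>length s = 4\<close> by (simp del: replicate_Suc)
    qed
    moreover have "Suc i < 4" if "i \<noteq> 3"
      using that s(2) by simp
    ultimately have "\<exists>r i. i < 4 \<and> f @ [z] = concat (replicate r s) @ take i s"
      by (metis zero_less_numeral)
    then show ?thesis
      using s(1) by blast
  qed
qed

text \<open>These are the palindromes \<open>(abac)^k aba\<close> and \<open>(baca)^k b\<close>,
  recorded by letter counts and by the last letters of the two edge projections.\<close>

definition fork_shape :: "'a \<Rightarrow> 'a \<Rightarrow> 'a \<Rightarrow> 'a list \<Rightarrow> bool" where
  "fork_shape a b c f \<longleftrightarrow> (\<exists>k. count_list f b = k + 1 \<and> count_list f c = k \<and>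
     (count_list f a = 2 * k + 2 \<and>
        last (filter (\<lambda>x. x \<in> {a, b}) f) = a \<and> last (filter (\<lambda>x. x \<in> {a, c}) f) = a \<or>
      count_list f a = 2 * k \<and>
        last (filter (\<lambda>x. x \<in> {a, b}) f) = b \<and> (k > 0 \<longrightarrow> last (filter (\<lambda>x. x \<in> {a, c}) f) = a)))"

text \<open>Comparing the ends of the projections rejects every phase other than the listed ones,
  except \<open>(abac)^(k+1) a\<close>. There the second letters decide: the \<open>{a, b}\<close>
  projection starts with \<open>a b\<close> but ends with \<open>a a\<close>.\<close>

lemma fork_palindrome_aux:
  fixes a b c :: 'a and f s :: "'a list" and r i :: nat
  assumes "distinct [a, b, c]" "s \<in> {[a, b, a, c], [b, a, c, a]}" "i < 4"
    and f: "f = concat (replicate r s) @ take i s"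
    and pal: "rev (filter (\<lambda>x. x \<in> {a, b}) f) = filter (\<lambda>x. x \<in> {a, b}) f"
      "rev (filter (\<lambda>x. x \<in> {a, c}) f) = filter (\<lambda>x. x \<in> {a, c}) f"
  shows "f = [] \<or> f = [a] \<or> fork_shape a b c f"
proof -
  have d: "a \<noteq> b" "b \<noteq> a" "a \<noteq> c" "c \<noteq> a" "b \<noteq> c" "c \<noteq> b"
    using assms(1) by auto
  have count: "count_list (concat (replicate r s)) x = r * count_list s x" for x
    by (induction r) auto
  have filt: "filter Q (concat (replicate r s)) = concat (replicate r (filter Q s))" for Q
    by (induction r) auto
  have snoc: "concat (replicate (Suc k) xs) = concat (replicate k xs) @ xs" for k and xs :: "'a list"
    by (induction k) auto
  have ends: "hd f' = last f'" if "rev f' = f'" for f' :: "'a list"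
    using hd_rev[of f'] that by simp
  note hl = ends[OF pal(1)] ends[OF pal(2)]
  have "i = 0 \<or> i = 1 \<or> i = 2 \<or> i = 3"
    using assms(3) by linarith
  moreover have "r = 0 \<or> (\<exists>k. r = Suc k)"
    by (cases r) auto
  ultimately consider (1) "r = 0" "i = 0" | (2) k where "r = Suc k" "i = 0"
    | (3) "r = 0" "i = 1" | (4) k where "r = Suc k" "i = 1" | (5) "i = 2" | (6) "i = 3"
    by blast
  then show ?thesis
  proof cases
    case 1
    then show ?thesis using f by simp
  next
    case (2 k)
    have f1: "f = s @ concat (replicate k s)" and f2: "f = concat (replicate k s) @ s"
      using 2 f snoc[of k s] by simp_all
    have "hd (filter (\<lambda>x. x \<in> {a, b}) f) \<noteq> last (filter (\<lambda>x. x \<in> {a, b}) f) \<or>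
      hd (filter (\<lambda>x. x \<in> {a, c}) f) \<noteq> last (filter (\<lambda>x. x \<in> {a, c}) f)"
    proof -
      have "hd (filter Q f) = hd (filter Q s)" "last (filter Q f) = last (filter Q s)"
        if "filter Q s \<noteq> []" for Q
        using that by (simp add: f1, simp add: f2)
      then show ?thesis
        using assms(1,2) by auto
    qed
    then show ?thesis
      using hl by blast
  next
    case 3
    then show ?thesis
      using f assms(1,2) by (auto simp: fork_shape_def)
  next
    case (4 k)
    show ?thesis
    proof (cases "s = [a, b, a, c]")
      case True
      have "f = a # b # [a, c] @ concat (replicate k s) @ [a]"
        using 4 f True by simp
      then obtain X where X: "filter (\<lambda>x. x \<in> {a, b}) f = a # b # X"
        using assms(1) by auto
      have "f = concat (replicate k s) @ [a, b, a, c] @ [a]"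
        using 4 f True snoc[of k s] by simp
      then obtain Y where "rev (filter (\<lambda>x. x \<in> {a, b}) f) = a # a # Y"
        using assms(1) by auto
      then show ?thesis
        using pal(1) X assms(1) by simp
    next
      case False
      then have "s = [b, a, c, a]"
        using assms(2) by simp
      then show ?thesis
        using 4 f d count snoc[of k s] filt
        by (intro disjI2) (simp add: fork_shape_def snoc del: replicate_Suc)
    qed
  next
    case 5
    have "hd (filter (\<lambda>x. x \<in> {a, b}) f) \<noteq> last (filter (\<lambda>x. x \<in> {a, b}) f) \<or>
      hd (filter (\<lambda>x. x \<in> {a, c}) f) \<noteq> last (filter (\<lambda>x. x \<in> {a, c}) f)"
      using assms(1,2) 5 f by (cases r) auto
    then show ?thesis
      using hl by blast
  next
    case 6
    show ?thesis
    proof (cases "s = [a, b, a, c]")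
      case True
      then show ?thesis
        using 6 f d count filt
        by (intro disjI2) (simp add: fork_shape_def)
    next
      case False
      then have "s = [b, a, c, a]"
        using assms(2) by simp
      then have "hd (filter (\<lambda>x. x \<in> {a, b}) f) \<noteq> last (filter (\<lambda>x. x \<in> {a, b}) f)"
        using assms(1) 6 f by (cases r) auto
      then show ?thesis
        using hl by blast
    qed
  qed
qed

lemma fork_palindrome:
  assumes "fork_ok a b c f" "distinct [a, b, c]"
    and pal: "rev (filter (\<lambda>x. x \<in> {a, b}) f) = filter (\<lambda>x. x \<in> {a, b}) f"
      "rev (filter (\<lambda>x. x \<in> {a, c}) f) = filter (\<lambda>x. x \<in> {a, c}) f"
  shows "f \<in> {[], [a], [b, c], [c, b]} \<or> fork_shape a b c f \<or> fork_shape a c b f"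
proof (cases "(\<exists>A B. f = A @ b # c # B) \<or> (\<exists>A B. f = A @ c # b # B)")
  case True
  then have "f = [b, c] \<or> f = [c, b]"
    using fork_ok_leaves[of a b c] fork_ok_leaves[of a c b] assms fork_ok_commute[OF assms(1)] by auto
  then show ?thesis by blast
next
  case False
  then obtain s r i where s: "s \<in> {[a, b, a, c], [a, c, a, b], [b, a, c, a], [c, a, b, a]}" "i < 4"
    "f = concat (replicate r s) @ take i s"
    using fork_ok_periodic[OF assms(1,2)] by blast
  then consider "s \<in> {[a, b, a, c], [b, a, c, a]}" | "s \<in> {[a, c, a, b], [c, a, b, a]}"
    by blast
  then show ?thesis
  proof cases
    case 1
    from fork_palindrome_aux[OF assms(2) 1 s(2,3) pal] show ?thesis
      by blast
  next
    case 2
    have "distinct [a, c, b]"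
      using assms(2) by auto
    from fork_palindrome_aux[OF this 2 s(2,3) pal(2,1)] show ?thesis
      by blast
  qed
qed

section \<open>Self-dual fully commutative words of type D\<close>

text \<open>In these codes \<open>c j\<close> is the number of occurrences of the letter \<open>j\<close>. The letter 0 never occurs; it
  provides the starting point of the walk and, for \<open>n = 1\<close>, plays the role of the branching vertex
  \<open>n - 1\<close>.\<close>

definition walk_step :: "nat \<Rightarrow> nat \<Rightarrow> bool" where
  "walk_step x y \<longleftrightarrow> x = 0 \<and> y = 0 \<or> y = Suc x \<or> x = Suc y"

definition path_code :: "(nat \<Rightarrow> nat) \<Rightarrow> nat \<Rightarrow> bool" where
  "path_code c l \<longleftrightarrow> c 0 = 0 \<and> (\<forall>j<l. walk_step (c j) (c (Suc j)))"

text \<open>The first two alternatives are the exceptional subwords at the fork: the empty one, the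
  two leaves alone, and the branching vertex alone. The others are the counts of
  \<open>fork_shape\<close> with either leaf in excess.\<close>

definition fork_code :: "nat \<Rightarrow> nat \<Rightarrow> nat \<Rightarrow> bool" where
  "fork_code k b c \<longleftrightarrow> k = 0 \<and> b = c \<and> b \<le> 1 \<or> k = 1 \<and> b = 0 \<and> c = 0 \<or>
     b = Suc c \<and> (k = 2 * c \<or> k = 2 * c + 2) \<or> c = Suc b \<and> (k = 2 * b \<or> k = 2 * b + 2)"

definition alternating_code :: "nat \<Rightarrow> (nat \<Rightarrow> nat) \<Rightarrow> bool" where
  "alternating_code n c \<longleftrightarrow> path_code c (n - 1) \<and> fork_code (c (n - 1)) (c n) (c (Suc n))"

text \<open>The values 0, 1, 3 are those a palindrome around two occurrences of \<open>h\<close>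
  allows besides 2; leaving out 2 makes \<open>h\<close> the start of the run of 2s and hence
  unique.\<close>

definition nested_code :: "nat \<Rightarrow> (nat \<Rightarrow> nat) \<Rightarrow> nat \<Rightarrow> bool" where
  "nested_code n c h \<longleftrightarrow> 1 \<le> h \<and> h < n \<and> path_code c (h - 1) \<and> c (h - 1) \<in> {0, 1, 3} \<and>
     (\<forall>j. h \<le> j \<longrightarrow> j < n \<longrightarrow> c j = 2) \<and> c n = 1 \<and> c (Suc n) = 1"

text \<open>On a tie the smaller letter wins, because in a nested part it is the outer one. Leaf
  counts are doubled in the comparison because the branching vertex occurs twice between consecutive
  occurrences of a leaf in the periodic shapes.\<close>

definition code_descents :: "nat \<Rightarrow> (nat \<Rightarrow> nat) \<Rightarrow> nat set" where
  "code_descents n c =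
     {j. 1 \<le> j \<and> j < n \<and> c (j - 1) < c j \<and> (if Suc j < n then c (Suc j) else c n + c (Suc n)) \<le> c j} \<union>
     {j. j \<in> {n, Suc n} \<and> c (n - 1) < 2 * c j}"

text \<open>The arguments are the branching vertex and the two leaves, the numbers of their occurrences,
  and the last letters of the projections to the two edges of the fork.\<close>

definition leaf_cond :: "nat \<Rightarrow> nat \<Rightarrow> nat \<Rightarrow> nat \<Rightarrow> nat \<Rightarrow> nat \<Rightarrow> nat \<Rightarrow> nat \<Rightarrow> bool" where
  "leaf_cond a b c ka kb kc lb lc \<longleftrightarrow>
     (1 \<le> kb \<longrightarrow> (lb = b \<longleftrightarrow> ka < 2 * kb)) \<and> (1 \<le> kc \<longrightarrow> (lc = c \<longleftrightarrow> ka < 2 * kc)) \<and>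
     (1 \<le> ka \<longrightarrow> (lb = a \<and> lc = a \<longleftrightarrow> kb + kc \<le> ka))"

lemma leaf_cond_short:
  assumes "ka = 0 \<and> kb = 0 \<and> kc = 0 \<or> ka = 1 \<and> kb = 0 \<and> kc = 0 \<and> lb = a \<and> lc = a \<or>
      ka = 0 \<and> kb = 1 \<and> kc = 1 \<and> lb = b \<and> lc = c" "a \<noteq> b" "a \<noteq> c"
  shows "fork_code ka kb kc \<and> leaf_cond a b c ka kb kc lb lc"
  using assms by (auto simp: fork_code_def leaf_cond_def)

lemma leaf_cond_left:
  assumes "kb = k + 1" "kc = k" "a \<noteq> b" "a \<noteq> c"
    "ka = 2 * k + 2 \<and> lb = a \<and> lc = a \<or> ka = 2 * k \<and> lb = b \<and> (k > 0 \<longrightarrow> lc = a)"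
  shows "fork_code ka kb kc \<and> leaf_cond a b c ka kb kc lb lc"
  using assms by (auto simp: fork_code_def leaf_cond_def)

lemma leaf_cond_commute:
  "fork_code ka kc kb \<and> leaf_cond a c b ka kc kb lc lb \<Longrightarrow> fork_code ka kb kc \<and> leaf_cond a b c ka kb kc lb lc"
  by (auto simp: fork_code_def leaf_cond_def)

lemma length_filter_eq: "length (filter (\<lambda>t. t = x) q) = count_list q x"
  by (induction q) auto

locale type_D =
  fixes n :: nat
  assumes n_pos: "1 \<le> n"

sublocale type_D \<subseteq> simply_laced "D_gens n" "D_matrix n"
  by unfold_locales (auto simp: D_matrix_def)

context type_D
begin

section \<open>Gaps between equal letters in type D\<close>

lemma adj_iff: "D_matrix n s t = 3 \<longleftrightarrow> D_edge n s t \<or> D_edge n t s"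
  using n_pos by (auto simp: D_matrix_def D_edge_def)

lemma adj_path: "Suc j < n \<Longrightarrow> D_matrix n j t = 3 \<longleftrightarrow> t = Suc j \<or> Suc t = j"
  unfolding adj_iff by (auto simp: D_edge_def)

lemma adj_branch: "D_matrix n (n - 1) t = 3 \<longleftrightarrow> Suc t = n - 1 \<or> t = n \<or> t = Suc n"
  unfolding adj_iff using n_pos by (auto simp: D_edge_def)

lemma adj_leaf: "s = n \<or> s = Suc n \<Longrightarrow> D_matrix n s t = 3 \<longleftrightarrow> t = n - 1"
  unfolding adj_iff using n_pos by (auto simp: D_edge_def)

lemma gens: "u \<in> lists (D_gens n) \<Longrightarrow> t \<in> set u \<Longrightarrow> 1 \<le> t \<and> t \<le> Suc n"
  by (auto simp: D_gens_def)

text \<open>Otherwise the two neighbours required in the gap are both \<open>j - 1\<close>, and by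
  induction a \<open>j\<close> lies between them, inside the gap. The induction starts at 0, which
  is not a generator.\<close>

lemma left_gap:
  assumes "fc_word u" "u \<in> lists (D_gens n)" "u = p @ j # q @ j # r" "j \<notin> set q" "Suc j < n"
  shows "Suc j \<in> set q"
  using assms(3-5)
proof (induction j arbitrary: p q r)
  case 0
  then show ?case
    using gens[OF assms(2), of 0] by auto
next
  case (Suc j)
  show ?case
  proof (rule ccontr)
    assume no: "Suc (Suc j) \<notin> set q"
    have "filter (\<lambda>t. D_matrix n (Suc j) t = 3) q = filter (\<lambda>t. t = j) q"
      using no Suc.prems(3) by (intro filter_cong) (auto simp: adj_path)
    then have "2 \<le> count_list q j"
      using fc_word_gap[of p "Suc j" q r] assms(1) Suc.prems by (simp add: length_filter_eq)
    then obtain q1 q2 q3 where q: "q = q1 @ j # q2 @ j # q3" "j \<notin> set q2"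
      by (rule two_occurrencesE)
    then have "u = (p @ Suc j # q1) @ j # q2 @ j # (q3 @ Suc j # r)"
      using Suc.prems by simp
    then have "Suc j \<in> set q2"
      using q(2) Suc.prems(3) by (intro Suc.IH[of "p @ Suc j # q1" q2 "q3 @ Suc j # r"]) auto
    then show False
      using q(1) Suc.prems(2) by simp
  qed
qed

lemma leaf_gap:
  assumes "fc_word u" "u = p @ s # q @ s # r" "s \<notin> set q" "s = n \<or> s = Suc n"
  shows "2 \<le> count_list q (n - 1)"
  using fc_word_gap[of p s q r] assms(1-3) adj_leaf[OF assms(4)] by (simp add: length_filter_eq)

text \<open>A neighbour occurring twice would force a branching letter between its two occurrences,
  within the gap.\<close>

lemma branch_gap:
  assumes "fc_word u" "u \<in> lists (D_gens n)" "u = p @ (n - 1) # q @ (n - 1) # r" "n - 1 \<notin> set q"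
  shows "2 \<le> count_list q (n - 2) + count_list q n + count_list q (Suc n)"
    "count_list q (n - 2) \<le> 1" "count_list q n \<le> 1" "count_list q (Suc n) \<le> 1" "2 \<le> n"
proof -
  have "1 \<le> n - 1"
    using gens[OF assms(2), of "n - 1"] assms(3) by simp
  then show n: "2 \<le> n"
    by simp
  have "length (filter (\<lambda>t. D_matrix n (n - 1) t = 3) q)
      = count_list q (n - 2) + count_list q n + count_list q (Suc n)"
    using n by (induction q) (auto simp: adj_branch[unfolded One_nat_def])
  then show "2 \<le> count_list q (n - 2) + count_list q n + count_list q (Suc n)"
    using fc_word_gap[of p "n - 1" q r] assms(1,3,4) by simp
  show "count_list q (n - 2) \<le> 1"
  proof (rule ccontr)
    assume "\<not> ?thesis"
    then have "2 \<le> count_list q (n - 2)"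
      by simp
    then obtain q1 q2 q3 where q: "q = q1 @ (n - 2) # q2 @ (n - 2) # q3" "n - 2 \<notin> set q2"
      by (rule two_occurrencesE)
    then have "Suc (n - 2) \<in> set q2"
      using assms(3) n by (intro left_gap[OF assms(1,2), of "p @ (n - 1) # q1" _ _ "q3 @ (n - 1) # r"]) auto
    then show False
      using q(1) assms(4) n by (simp add: Suc_diff_Suc numeral_2_eq_2)
  qed
  have leaf: "count_list q s \<le> 1" if s: "s = n \<or> s = Suc n" for s
  proof (rule ccontr)
    assume "\<not> ?thesis"
    then have "2 \<le> count_list q s"
      by simp
    then obtain q1 q2 q3 where q: "q = q1 @ s # q2 @ s # q3" "s \<notin> set q2"
      by (rule two_occurrencesE)
    then have "2 \<le> count_list q2 (n - 1)"
      using assms(3) s by (intro leaf_gap[OF assms(1), of "p @ (n - 1) # q1" s _ "q3 @ (n - 1) # r"]) auto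
    then have "n - 1 \<in> set q2"
      using count_list_0_iff[of q2 "n - 1"] by auto
    then show False
      using q(1) assms(4) by simp
  qed
  show "count_list q n \<le> 1" "count_list q (Suc n) \<le> 1"
    using leaf by auto
qed

text \<open>Without the lower neighbour, both required neighbours are \<open>i + 1\<close>, and the
  gap between these lies inside the old one and so avoids \<open>i\<close>. The defect thus travels
  up to the branching vertex.\<close>

lemma gap_propagates:
  assumes "fc_word u" "u = p @ i # q @ i # r" "i \<notin> set q" "\<forall>t\<in>set q. Suc t \<noteq> i"
    and "i \<le> j" "j < n"
  shows "\<exists>p q r. u = p @ j # q @ j # r \<and> j \<notin> set q \<and> (\<forall>t\<in>set q. Suc t \<noteq> j)"
  using assms(5,6)
proof (induction j rule: dec_induct)
  case base
  then show ?case using assms(2-4) by blast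
next
  case (step j)
  then obtain p q r where pq: "u = p @ j # q @ j # r" "j \<notin> set q" "\<forall>t\<in>set q. Suc t \<noteq> j"
    by auto
  have "filter (\<lambda>t. D_matrix n j t = 3) q = filter (\<lambda>t. t = Suc j) q"
    using pq step.prems by (intro filter_cong) (auto simp: adj_path)
  then have "2 \<le> count_list q (Suc j)"
    using fc_word_gap[of p j q r] assms(1) pq by (simp add: length_filter_eq)
  then obtain q1 q2 q3 where q: "q = q1 @ Suc j # q2 @ Suc j # q3" "Suc j \<notin> set q2"
    by (rule two_occurrencesE)
  then have "u = (p @ j # q1) @ Suc j # q2 @ Suc j # (q3 @ j # r)"
    using pq by simp
  moreover have "\<forall>t\<in>set q2. Suc t \<noteq> Suc j"
    using q pq by auto
  ultimately show ?case
    using q(2) by blast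
qed

section \<open>Descents from projections and letter counts\<close>

abbreviation proj :: "nat \<Rightarrow> nat \<Rightarrow> nat list \<Rightarrow> nat list" where
  "proj s t u \<equiv> filter (\<lambda>x. x \<in> {s, t}) u"

lemma proj_commute: "proj s t u = proj t s u"
  by (intro filter_cong) auto

lemma proj_rev:
  assumes "u \<in> sd_words" "D_matrix n s t = 3"
  shows "rev (proj s t u) = proj s t u"
  using ceq_filter[of u "rev u" s t] assms by (simp add: sd_words_def rev_filter)

text \<open>The last letters of the projections determine the descents. The alternating and the nested words
  admit this common description of them by the numbers of occurrences.\<close>

definition path_info :: "nat list \<Rightarrow> nat \<Rightarrow> bool" where
  "path_info u j \<longleftrightarrow> (let c = count_list u in
     (c j \<ge> 1 \<longrightarrow> (last (proj j (Suc j) u) = j \<longleftrightarrow> c (Suc j) \<le> c j)) \<and>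
     (c (Suc j) \<ge> 1 \<longrightarrow> (last (proj j (Suc j) u) = Suc j \<longleftrightarrow> c j < c (Suc j))))"

definition leaf_info :: "nat list \<Rightarrow> bool" where
  "leaf_info u \<longleftrightarrow> (let c = count_list u in
     leaf_cond (n - 1) n (Suc n) (c (n - 1)) (c n) (c (Suc n))
       (last (proj (n - 1) n u)) (last (proj (n - 1) (Suc n) u)))"

lemma count_pos_iff: "Suc 0 \<le> count_list u s \<longleftrightarrow> s \<in> set u"
  using count_list_0_iff[of u s] by (cases "count_list u s") auto

lemma descents_eq_code_descents:
  assumes "u \<in> lists (D_gens n)" "\<And>j. Suc j < n \<Longrightarrow> path_info u j" "leaf_info u"
  shows "descents u = code_descents n (count_list u)"
proof (rule Set.set_eqI)
  fix s
  let ?c = "count_list u"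
  have c0: "?c 0 = 0"
    using gens[OF assms(1), of 0] by (auto simp: count_list_0_iff)
  consider "s = 0" | "1 \<le> s" "Suc s < n" | "1 \<le> s" "s = n - 1" | "s = n \<or> s = Suc n" | "Suc n < s"
    by linarith
  then show "s \<in> descents u \<longleftrightarrow> s \<in> code_descents n ?c"
  proof cases
    case 1
    then show ?thesis
      using gens[OF assms(1), of 0] n_pos by (auto simp: descents_iff code_descents_def)
  next
    case 2
    then obtain j where j: "s = Suc j"
      using Suc_le_D[of 0 s] unfolding One_nat_def by blast
    have "s \<in> descents u \<longleftrightarrow> s \<in> set u \<and> last (proj s (Suc s) u) = s \<and> last (proj j s u) = s"
      unfolding descents_iff adj_path[OF 2(2)] using j proj_commute[of s j u] by auto
    also have "\<dots> \<longleftrightarrow> s \<in> set u \<and> ?c (Suc s) \<le> ?c s \<and> ?c j < ?c s"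
      using assms(2)[of s] assms(2)[of j] 2 j by (auto simp: path_info_def Let_def count_pos_iff)
    also have "\<dots> \<longleftrightarrow> s \<in> code_descents n ?c"
      using 2 j count_pos_iff[of u s] by (auto simp: code_descents_def)
    finally show ?thesis .
  next
    case 3
    then obtain j where j: "s = Suc j"
      using Suc_le_D[of 0 s] unfolding One_nat_def by blast
    have "s \<in> descents u \<longleftrightarrow> s \<in> set u \<and> last (proj j s u) = s \<and>
        last (proj (n - 1) n u) = n - 1 \<and> last (proj (n - 1) (Suc n) u) = n - 1"
      unfolding descents_iff 3(2) adj_branch using j 3(2) proj_commute[of s j u] by auto
    also have "\<dots> \<longleftrightarrow> s \<in> set u \<and> ?c j < ?c s \<and> ?c n + ?c (Suc n) \<le> ?c s"
      using assms(2)[of j] assms(3) 3 j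
      by (auto simp: path_info_def leaf_info_def leaf_cond_def Let_def count_pos_iff)
    also have "\<dots> \<longleftrightarrow> s \<in> code_descents n ?c"
    proof -
      have "n - Suc (Suc 0) = j" "\<not> Suc s < n" "s \<noteq> n" "s \<noteq> Suc n"
        using 3 j by simp_all
      then show ?thesis
        using 3 j count_pos_iff[of u s] by (auto simp: code_descents_def)
    qed
    finally show ?thesis .
  next
    case 4
    have "s \<in> descents u \<longleftrightarrow> s \<in> set u \<and> last (proj (n - 1) s u) = s"
      unfolding descents_iff adj_leaf[OF 4] using proj_commute[of s "n - 1" u] by auto
    also have "\<dots> \<longleftrightarrow> s \<in> set u \<and> ?c (n - 1) < 2 * ?c s"
      using assms(3) 4 by (auto simp: leaf_info_def leaf_cond_def Let_def count_pos_iff)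
    also have "\<dots> \<longleftrightarrow> s \<in> code_descents n ?c"
      using 4 count_pos_iff[of u s] by (auto simp: code_descents_def)
    finally show ?thesis .
  next
    case 5
    then show ?thesis
      using gens[OF assms(1), of s] by (auto simp: descents_iff code_descents_def)
  qed
qed

section \<open>Words in which neighbouring letters alternate\<close>

lemma path_alternating:
  assumes "u \<in> sd_words" "Suc j < n"
    and "\<And>p q r. u = p @ Suc j # q @ Suc j # r \<Longrightarrow> Suc j \<notin> set q \<Longrightarrow> j \<in> set q"
  shows "walk_step (count_list u j) (count_list u (Suc j))" "path_info u j"
proof -
  have u: "u \<in> lists (D_gens n)" "fc_word u"
    using assms(1) by (auto simp: sd_words_def)
  let ?f = "proj j (Suc j) u"
  have "distinct_adj ?f"
  proof (rule distinct_adjI)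
    fix A x B
    show "?f \<noteq> A @ x # x # B"
    proof
      assume f: "?f = A @ x # x # B"
      then have "x \<in> set ?f"
        by simp
      then have x: "x = j \<or> x = Suc j"
        by auto
      have "?f = A @ x # [] @ x # B"
        using f by simp
      then obtain p q r where pq: "u = p @ x # q @ x # r" "proj j (Suc j) q = []"
        by (rule filter_eq_append_Cons2E) (rule that)
      then have "j \<notin> set q" "Suc j \<notin> set q"
        by (auto simp: filter_empty_conv)
      then show False
        using x pq(1) left_gap[OF u(2,1), of p j q r] assms(2) assms(3)[of p q r] by blast
    qed
  qed
  moreover have "rev ?f = ?f"
    using assms(1,2) by (intro proj_rev) (auto simp: adj_path)
  ultimately have "?f = [] \<or> (last ?f = j \<and> count_list ?f j = Suc (count_list ?f (Suc j))) \<or>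
    (last ?f = Suc j \<and> count_list ?f (Suc j) = Suc (count_list ?f j))"
    using alternating_palindrome[of ?f j "Suc j"] by auto
  moreover have "count_list u j = 0" "count_list u (Suc j) = 0" if "?f = []"
    using that by (auto simp: filter_empty_conv count_list_0_iff)
  ultimately show "walk_step (count_list u j) (count_list u (Suc j))" "path_info u j"
    by (auto simp: walk_step_def path_info_def Let_def count_list_filter)
qed

text \<open>This is the core \<open>(n-1) n (n+1) (n-1)\<close> of a nested part; its presence
  separates the two kinds of codes.\<close>

definition nested_gap :: "nat list \<Rightarrow> nat list \<Rightarrow> nat list \<Rightarrow> nat list \<Rightarrow> bool" where
  "nested_gap u p q r \<longleftrightarrow> u = p @ (n - 1) # q @ (n - 1) # r \<and> n - 1 \<notin> set q \<and> n \<in> set q \<and> Suc n \<in> set q"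

text \<open>A gap without its lower neighbour would propagate to the branching vertex, where only
  the two leaves can supply the required neighbours.\<close>

lemma not_nested_gap:
  assumes "u \<in> sd_words" "\<And>p q r. \<not> nested_gap u p q r"
    and "u = p @ Suc j # q @ Suc j # r" "Suc j \<notin> set q" "Suc j < n"
  shows "j \<in> set q"
proof (rule ccontr)
  assume "j \<notin> set q"
  have u: "u \<in> lists (D_gens n)" "fc_word u"
    using assms(1) by (auto simp: sd_words_def)
  have "\<exists>p q r. u = p @ (n - 1) # q @ (n - 1) # r \<and> n - 1 \<notin> set q \<and> (\<forall>t\<in>set q. Suc t \<noteq> n - 1)"
    using assms(3-5) \<open>j \<notin> set q\<close> by (intro gap_propagates[OF u(2)]) auto
  then obtain p q r where pq: "u = p @ (n - 1) # q @ (n - 1) # r" "n - 1 \<notin> set q"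
    "\<forall>t\<in>set q. Suc t \<noteq> n - 1"
    by blast
  note gap = branch_gap[OF u(2,1) pq(1,2)]
  have "Suc (n - 2) = n - 1"
    using gap(5) by simp
  then have "n - 2 \<notin> set q"
    using pq(3) by blast
  then have "count_list q n \<noteq> 0" "count_list q (Suc n) \<noteq> 0"
    using gap(1-4) count_list_0_iff[of q "n - 2"] by linarith+
  then have "nested_gap u p q r"
    using pq by (simp add: nested_gap_def count_list_0_iff)
  then show False
    using assms(2) by blast
qed

lemma fork_ok_proj:
  assumes "u \<in> sd_words" "\<And>p q r. \<not> nested_gap u p q r"
  shows "fork_ok (n - 1) n (Suc n) (filter (\<lambda>x. x \<in> {n - 1, n, Suc n}) u)" (is "fork_ok _ _ _ ?f")
  unfolding fork_ok_def
proof (intro conjI allI impI)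
  have u: "u \<in> lists (D_gens n)" "fc_word u"
    using assms(1) by (auto simp: sd_words_def)
  show "set ?f \<subseteq> {n - 1, n, Suc n}"
    by auto
  fix A s B C assume f: "?f = A @ s # B @ s # C" and sB: "s \<notin> set B"
  have "s \<in> set ?f"
    using f by simp
  then have s: "s \<in> {n - 1, n, Suc n}"
    by auto
  obtain p q r where pq: "u = p @ s # q @ s # r" "filter (\<lambda>x. x \<in> {n - 1, n, Suc n}) q = B"
    using f by (rule filter_eq_append_Cons2E) (rule that)
  have sq: "s \<notin> set q"
    using sB s pq(2) by auto
  show "if s = n - 1 then B = [n] \<or> B = [Suc n] else 2 \<le> count_list B (n - 1)"
  proof (cases "s = n - 1")
    case True
    have pq': "u = p @ (n - 1) # q @ (n - 1) # r" "n - 1 \<notin> set q"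
      using pq sq True by auto
    note gap = branch_gap[OF u(2,1) pq']
    have "\<not> (n \<in> set q \<and> Suc n \<in> set q)"
      using assms(2)[of p q r] pq' by (simp add: nested_gap_def)
    then have "count_list q n + count_list q (Suc n) = 1"
      using gap count_list_0_iff[of q n] count_list_0_iff[of q "Suc n"] by linarith
    moreover have "length (filter (\<lambda>x. x \<in> {n - 1, n, Suc n}) q) = count_list q n + count_list q (Suc n)"
      using pq'(2) by (induction q) auto
    ultimately obtain x where "B = [x]"
      using pq(2) by (metis One_nat_def length_0_conv length_Suc_conv)
    moreover have "x \<in> {n, Suc n}"
    proof -
      have "x \<in> set (filter (\<lambda>x. x \<in> {n - 1, n, Suc n}) q)"
        using pq(2) \<open>B = [x]\<close> by simp
      then show ?thesis
        using pq'(2) by auto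
    qed
    ultimately show ?thesis
      using True by auto
  next
    case False
    then have "2 \<le> count_list q (n - 1)"
      using s by (intro leaf_gap[OF u(2) pq(1) sq]) auto
    then show ?thesis
      using False pq(2) by (auto simp: count_list_filter)
  qed
qed

lemma alternating_word:
  assumes "u \<in> sd_words" "\<And>p q r. \<not> nested_gap u p q r"
  shows "alternating_code n (count_list u)" "descents u = code_descents n (count_list u)"
proof -
  let ?c = "count_list u"
  have u: "u \<in> lists (D_gens n)" "fc_word u"
    using assms(1) by (auto simp: sd_words_def)
  have c0: "?c 0 = 0"
    using gens[OF u(1), of 0] by (auto simp: count_list_0_iff)
  have path: "walk_step (?c j) (?c (Suc j))" "path_info u j" if "Suc j < n" for j
    using path_alternating[OF assms(1) that] not_nested_gap[OF assms] that by blast+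
  let ?f = "filter (\<lambda>x. x \<in> {n - 1, n, Suc n}) u"
  have ff: "proj (n - 1) s ?f = proj (n - 1) s u" if "s \<in> {n, Suc n}" for s
    using that by (auto simp: filter_filter intro!: filter_cong)
  have cf: "count_list ?f s = ?c s" if "s \<in> {n - 1, n, Suc n}" for s
    using that by (simp add: count_list_filter)
  have d: "distinct [n - 1, n, Suc n]" "n - 1 \<noteq> n" "n - 1 \<noteq> Suc n" "n \<noteq> n - 1" "Suc n \<noteq> n - 1"
    using n_pos by auto
  have "rev (proj (n - 1) s ?f) = proj (n - 1) s ?f" if "s \<in> {n, Suc n}" for s
    unfolding ff[OF that] using that by (intro proj_rev[OF assms(1)]) (auto simp: adj_branch[unfolded One_nat_def])
  then have "?f \<in> {[], [n - 1], [n, Suc n], [Suc n, n]} \<or>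
      fork_shape (n - 1) n (Suc n) ?f \<or> fork_shape (n - 1) (Suc n) n ?f"
    using fork_palindrome[OF fork_ok_proj[OF assms] d(1)] by simp
  moreover have c: "count_list ?f (n - 1) = ?c (n - 1)" "count_list ?f n = ?c n"
    "count_list ?f (Suc n) = ?c (Suc n)"
    using cf by auto
  moreover have p: "proj (n - 1) n ?f = proj (n - 1) n u" "proj (n - 1) (Suc n) ?f = proj (n - 1) (Suc n) u"
    using ff by auto
  ultimately have "fork_code (?c (n - 1)) (?c n) (?c (Suc n)) \<and> leaf_info u"
  proof (elim disjE)
    assume "?f \<in> {[], [n - 1], [n, Suc n], [Suc n, n]}"
    then have "?c (n - 1) = 0 \<and> ?c n = 0 \<and> ?c (Suc n) = 0 \<or>
      ?c (n - 1) = 1 \<and> ?c n = 0 \<and> ?c (Suc n) = 0 \<and>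
        last (proj (n - 1) n u) = n - 1 \<and> last (proj (n - 1) (Suc n) u) = n - 1 \<or>
      ?c (n - 1) = 0 \<and> ?c n = 1 \<and> ?c (Suc n) = 1 \<and>
        last (proj (n - 1) n u) = n \<and> last (proj (n - 1) (Suc n) u) = Suc n"
    proof (elim insertE)
      assume f: "?f = []" show ?thesis using c[symmetric] p[symmetric] d unfolding f by simp
    next
      assume f: "?f = [n - 1]" show ?thesis using c[symmetric] p[symmetric] d unfolding f by simp
    next
      assume f: "?f = [n, Suc n]" show ?thesis using c[symmetric] p[symmetric] d unfolding f by simp
    next
      assume f: "?f = [Suc n, n]" show ?thesis using c[symmetric] p[symmetric] d unfolding f by simp
    qed (simp only: empty_iff)
    then show ?thesis
      unfolding leaf_info_def Let_def using d(2,3) by (rule leaf_cond_short)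
  next
    assume "fork_shape (n - 1) n (Suc n) ?f"
    then obtain k where k: "?c n = k + 1" "?c (Suc n) = k"
      "?c (n - 1) = 2 * k + 2 \<and> last (proj (n - 1) n u) = n - 1 \<and> last (proj (n - 1) (Suc n) u) = n - 1 \<or>
       ?c (n - 1) = 2 * k \<and> last (proj (n - 1) n u) = n \<and> (k > 0 \<longrightarrow> last (proj (n - 1) (Suc n) u) = n - 1)"
      unfolding fork_shape_def c p by (elim exE conjE) (rule that)
    show ?thesis
      unfolding leaf_info_def Let_def using k(1,2) d(2,3) k(3) by (rule leaf_cond_left)
  next
    assume "fork_shape (n - 1) (Suc n) n ?f"
    then obtain k where k: "?c (Suc n) = k + 1" "?c n = k"
      "?c (n - 1) = 2 * k + 2 \<and> last (proj (n - 1) (Suc n) u) = n - 1 \<and> last (proj (n - 1) n u) = n - 1 \<or>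
       ?c (n - 1) = 2 * k \<and> last (proj (n - 1) (Suc n) u) = (Suc n) \<and> (k > 0 \<longrightarrow> last (proj (n - 1) n u) = n - 1)"
      unfolding fork_shape_def c p by (elim exE conjE) (rule that)
    show ?thesis
      unfolding leaf_info_def Let_def
      by (rule leaf_cond_commute[OF leaf_cond_left[OF k(1,2) d(3,2) k(3)]])
  qed
  then show "alternating_code n ?c" "descents u = code_descents n ?c"
    using path c0 descents_eq_code_descents[OF u(1)]
    by (auto simp: alternating_code_def path_code_def)
qed

section \<open>Words with a nested part\<close>

lemma nested_gap_clash:
  assumes "fc_word u" "u = p @ (n - 1) # q @ (n - 1) # q' @ r" "n - 1 \<notin> set q" "n - 1 \<notin> set q'"
    and "s = n \<or> s = Suc n" "s \<in> set q"
  shows "s \<notin> set q'"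
proof
  assume "s \<in> set q'"
  then obtain r1 r2 where r: "q' = r1 @ s # r2" "s \<notin> set r1"
    by (meson split_list_first)
  obtain q1 q2 where q: "q = q1 @ s # q2" "s \<notin> set q2"
    using assms(6) by (meson split_list_last)
  have "2 \<le> count_list (q2 @ (n - 1) # r1) (n - 1)"
    using r q assms(2,5) n_pos
    by (intro leaf_gap[OF assms(1), of "p @ (n - 1) # q1" s _ "r2 @ r"]) auto
  moreover have "count_list q2 (n - 1) = 0" "count_list r1 (n - 1) = 0"
    using q r assms(3,4) by (auto simp: count_list_0_iff)
  ultimately show False
    by simp
qed

text \<open>A further branching letter would enclose a leaf that already occurs in the nested gap,
  with a single branching letter in between, but two are needed. Applied to the reversed word, this
  clears the prefix as well.\<close>

lemma nested_gap_suffix: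
  assumes "fc_word u" "u \<in> lists (D_gens n)" "nested_gap u p q r"
  shows "set r \<inter> {n - 1, n, Suc n} = {}"
proof -
  have g: "u = p @ (n - 1) # q @ (n - 1) # r" "n - 1 \<notin> set q" "n \<in> set q" "Suc n \<in> set q"
    using assms(3) by (auto simp: nested_gap_def)
  have "n - 1 \<notin> set r"
  proof
    assume "n - 1 \<in> set r"
    then obtain r1 r2 where r: "r = r1 @ (n - 1) # r2" "n - 1 \<notin> set r1"
      by (meson split_list_first)
    have u: "u = (p @ (n - 1) # q) @ (n - 1) # r1 @ (n - 1) # r2"
      using g r by simp
    have "n \<in> set r1 \<or> Suc n \<in> set r1"
      using branch_gap(1,2)[OF assms(1,2) u r(2)] count_list_0_iff[of r1 n] count_list_0_iff[of r1 "Suc n"]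
      by linarith
    then show False
      using nested_gap_clash[OF assms(1), of p q r1 "(n - 1) # r2"] g r by auto
  qed
  then show ?thesis
    using nested_gap_clash[OF assms(1), of p q r "[]"] g by auto
qed

lemma nested_word:
  assumes "u \<in> sd_words" "nested_gap u p q r"
  shows "\<exists>h. nested_code n (count_list u) h" "descents u = code_descents n (count_list u)"
proof -
  let ?c = "count_list u"
  have u: "u \<in> lists (D_gens n)" "fc_word u" "fc_word (rev u)"
    using assms(1) fc_word_ceq by (auto simp: sd_words_def)
  have c0: "?c 0 = 0"
    using gens[OF u(1), of 0] by (auto simp: count_list_0_iff)
  have g: "u = p @ (n - 1) # q @ (n - 1) # r" "n - 1 \<notin> set q" "n \<in> set q" "Suc n \<in> set q"
    using assms(2) by (auto simp: nested_gap_def)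
  note gap = branch_gap[OF u(2,1) g(1,2)]
  have r: "set r \<inter> {n - 1, n, Suc n} = {}"
    using nested_gap_suffix[OF u(2,1) assms(2)] .
  have "nested_gap (rev u) (rev r) (rev q) (rev p)"
    using g by (simp add: nested_gap_def)
  then have p: "set p \<inter> {n - 1, n, Suc n} = {}"
    using nested_gap_suffix[OF u(3)] u(1) by fastforce
  have cs: "count_list p s = 0" "count_list r s = 0" if "s \<in> {n - 1, n, Suc n}" for s
    using p r that by (auto simp: count_list_0_iff)
  have "count_list q s = 1" if "s = n \<or> s = Suc n" for s
    using gap(3,4) g(3,4) that count_list_0_iff[of q s] by (cases "count_list q s") auto
  moreover have "count_list q (n - 1) = 0"
    using g(2) by (simp add: count_list_0_iff)
  ultimately have fork: "?c (n - 1) = 2" "?c n = 1" "?c (Suc n) = 1"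
    using cs n_pos unfolding g(1) by auto
  have "last (proj (n - 1) s u) = n - 1" if "s \<in> {n, Suc n}" for s
  proof -
    have "proj (n - 1) s r = []"
      using r that by (auto simp: filter_empty_conv)
    then show ?thesis
      unfolding g(1) by simp
  qed
  then have "leaf_info u"
    using fork n_pos by (auto simp: leaf_info_def leaf_cond_def Let_def)
  \<comment> \<open>The nested part begins where the maximal run of letters occurring twice before
    the fork begins.\<close>
  define h where "h = (LEAST h. \<forall>j. h \<le> j \<longrightarrow> j < n \<longrightarrow> ?c j = 2)"
  have h: "\<forall>j. h \<le> j \<longrightarrow> j < n \<longrightarrow> ?c j = 2" "h \<le> n - 1"
  proof -
    have *: "\<forall>j. n - 1 \<le> j \<longrightarrow> j < n \<longrightarrow> ?c j = 2"
      using fork(1) le_antisym by fastforce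
    show "\<forall>j. h \<le> j \<longrightarrow> j < n \<longrightarrow> ?c j = 2"
      unfolding h_def by (rule LeastI[of _ "n - 1"]) (rule *)
    show "h \<le> n - 1"
      unfolding h_def by (rule Least_le) (rule *)
  qed
  have "h \<noteq> 0"
    using h(1) c0 n_pos by (metis le0 less_one less_le_trans zero_neq_numeral)
  then obtain x where x: "h = Suc x"
    by (cases h) auto
  have hn: "h < n"
    using h(2) n_pos by linarith
  have "?c x \<noteq> 2"
  proof
    assume "?c x = 2"
    then have "\<forall>j. x \<le> j \<longrightarrow> j < n \<longrightarrow> ?c j = 2"
      using h(1) x by (metis Suc_leI le_eq_less_or_eq)
    then have "h \<le> x"
      unfolding h_def by (rule Least_le)
    then show False
      using x by simp
  qed
  \<comment> \<open>From \<open>h\<close> on each letter before the leaves occurs twice, so the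
    projection contains \<open>Suc j\<close> twice; two adjacent \<open>j\<close> are excluded by
    \<open>left_gap\<close>.\<close>
  have form: "proj j (Suc j) u \<in> {[Suc j, Suc j], [Suc j, j, Suc j], [j, Suc j, Suc j, j], [j, Suc j, j, Suc j, j]}"
    if j: "x \<le> j" "Suc j < n" for j
  proof (rule nested_palindrome)
    show "rev (proj j (Suc j) u) = proj j (Suc j) u"
      using assms(1) j by (intro proj_rev) (auto simp: adj_path)
    show "count_list (proj j (Suc j) u) (Suc j) = 2"
      using h(1) j x by (simp add: count_list_filter)
    show "proj j (Suc j) u \<noteq> A @ j # j # B" for A B
    proof
      assume "proj j (Suc j) u = A @ j # j # B"
      then have "proj j (Suc j) u = A @ j # [] @ j # B"
        by simp
      then obtain p q r where pq: "u = p @ j # q @ j # r" "proj j (Suc j) q = []"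
        by (rule filter_eq_append_Cons2E) (rule that)
      then have "j \<notin> set q" "Suc j \<notin> set q"
        by (auto simp: filter_empty_conv)
      then show False
        using left_gap[OF u(2,1) pq(1)] j by blast
    qed
  qed auto
  have counts: "?c j = count_list (proj j (Suc j) u) j" "?c (Suc j) = count_list (proj j (Suc j) u) (Suc j)" for j
    by (simp_all add: count_list_filter)
  have cx: "?c x \<in> {0, 1, 3}"
    using form[of x] hn x \<open>?c x \<noteq> 2\<close> unfolding counts(1)[of x] by auto
  have info1: "path_info u j" if "x \<le> j" "Suc j < n" for j
    using form[OF that] unfolding path_info_def Let_def counts[of j] by auto
  \<comment> \<open>A missing lower neighbour would propagate to \<open>x\<close> and put both
    \<open>Suc x\<close> between two consecutive \<open>x\<close>. Then \<open>x\<close> occurs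
    exactly twice, contrary to the choice of \<open>h\<close>.\<close>
  have low: "j \<in> set q" if "u = p @ Suc j # q @ Suc j # r" "Suc j \<notin> set q" "Suc j \<le> x" for j p q r
  proof (rule ccontr)
    assume "j \<notin> set q"
    then have "\<exists>p q r. u = p @ x # q @ x # r \<and> x \<notin> set q \<and> (\<forall>t\<in>set q. Suc t \<noteq> x)"
      using that x hn by (intro gap_propagates[OF u(2) that(1,2)]) auto
    then obtain p q r where pq: "u = p @ x # q @ x # r" "x \<notin> set q" "\<forall>t\<in>set q. Suc t \<noteq> x"
      by blast
    have "filter (\<lambda>t. D_matrix n x t = 3) q = filter (\<lambda>t. t = Suc x) q"
      using pq hn x by (intro filter_cong) (auto simp: adj_path)
    then have "2 \<le> count_list q (Suc x)"
      using fc_word_gap[of p x q r] u pq by (simp add: length_filter_eq)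
    moreover define Q where "Q = proj x (Suc x) q"
    ultimately have "2 \<le> count_list Q (Suc x)" "x \<notin> set Q"
      using pq(2) by (simp_all add: count_list_filter)
    moreover have "proj x (Suc x) u = proj x (Suc x) p @ x # Q @ x # proj x (Suc x) r"
      unfolding pq(1) Q_def by simp
    ultimately have "proj x (Suc x) u = [x, Suc x, Suc x, x]"
      using form[of x] hn x by (auto simp: append_eq_Cons_conv Cons_eq_append_conv)
    then show False
      using \<open>?c x \<noteq> 2\<close> unfolding counts(1)[of x] by simp
  qed
  have path: "walk_step (?c j) (?c (Suc j))" "path_info u j" if "Suc j \<le> x" for j
    using path_alternating[OF assms(1), of j] low that x hn by auto
  have "nested_code n ?c h"
    using x hn cx path(1) c0 h(1) fork by (auto simp: nested_code_def path_code_def)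
  then show "\<exists>h. nested_code n ?c h"
    by blast
  have "path_info u j" if "Suc j < n" for j
    using info1[of j] path(2)[of j] that by (cases "x \<le> j") auto
  then show "descents u = code_descents n ?c"
    using descents_eq_code_descents[OF u(1)] \<open>leaf_info u\<close> by blast
qed

theorem sd_word_code:
  assumes "u \<in> sd_words"
  shows "alternating_code n (count_list u) \<or> (\<exists>h. nested_code n (count_list u) h)"
    and "descents u = code_descents n (count_list u)"
  using alternating_word[OF assms] nested_word[OF assms] by blast+

lemma sd_words_eq_iff:
  assumes "u \<in> sd_words" "v \<in> sd_words" "count_list u = count_list v"
  shows "(commutation_step (D_matrix n))\<^sup>*\<^sup>* u v"
proof (rule sd_words_eqI[OF _ assms(1,2)])
  show "mset u = mset v"
    using assms(3) by (intro multiset_eqI) (metis count_mset)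
  show "descents x = descents y" if "x \<in> sd_words" "y \<in> sd_words" "mset x = mset y" for x y
  proof -
    have "count_list x = count_list y"
      using that(3) by (intro ext) (metis count_mset)
    then show ?thesis
      using sd_word_code(2) that by metis
  qed
qed

end

context simply_laced
begin

text \<open>The set \<open>Lv s\<close> prescribes the levels of the letter \<open>s\<close>.
  Disjointness for neighbours makes sorting by level a linear extension, the gap condition gives
  full commutativity, and symmetry about 0 gives self-duality.\<close>

lemma ex_sd_word:
  fixes Lv :: "'a \<Rightarrow> int set"
  assumes "finite S" "\<And>s. finite (Lv s)" "\<And>s. s \<notin> S \<Longrightarrow> Lv s = {}"
    and sym: "\<And>s y. y \<in> Lv s \<Longrightarrow> - y \<in> Lv s"
    and disj: "\<And>s t. m s t = 3 \<Longrightarrow> Lv s \<inter> Lv t = {}"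
    and gap: "\<And>s y y'. y \<in> Lv s \<Longrightarrow> y' \<in> Lv s \<Longrightarrow> y < y' \<Longrightarrow>
      \<exists>t z t' z'. (t, z) \<noteq> (t', z') \<and> m s t = 3 \<and> m s t' = 3 \<and> z \<in> Lv t \<and> z' \<in> Lv t' \<and>
        y < z \<and> z < y' \<and> y < z' \<and> z' < y'"
  shows "\<exists>u\<in>sd_words. \<forall>s. count_list u s = card (Lv s)"
proof -
  have comm: "m s t = 2" if "y \<in> Lv s" "y \<in> Lv t" "s \<noteq> t" for s t y
    using disj[of s t] that m_cases[of s t] m_eq_1[of s t] by blast
  have "finite (Sigma S Lv)"
    using assms(1,2) by simp
  then have "\<exists>L. set L = Sigma S Lv \<and> linear_ext L"
    by (rule ex_linear_ext) (use comm in auto)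
  then obtain L where L: "set L = Sigma S Lv" "linear_ext L"
    by blast
  then have mem: "(s, y) \<in> set L \<longleftrightarrow> y \<in> Lv s" for s y
    using assms(3)[of s] by auto
  have "fc_word (map fst L)"
  proof (rule linear_ext_fc_word[OF L(2)])
    fix s y y' assume "(s, y) \<in> set L" "(s, y') \<in> set L" "y < y'"
    then obtain t z t' z' where *: "(t, z) \<noteq> (t', z')" "m s t = 3" "m s t' = 3" "z \<in> Lv t" "z' \<in> Lv t'"
        "y < z" "z < y'" "y < z'" "z' < y'"
      unfolding mem using gap[of y s y'] by auto
    show "\<exists>a\<in>set L. \<exists>b\<in>set L. a \<noteq> b \<and> m s (fst a) = 3 \<and> m s (fst b) = 3 \<and>
        y < snd a \<and> snd a < y' \<and> y < snd b \<and> snd b < y'"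
      by (rule bexI[of _ "(t, z)"], rule bexI[of _ "(t', z')"]) (use * mem in auto)
  qed
  moreover have "map fst L \<approx> rev (map fst L)"
    using L(2) sym by (intro linear_ext_selfdual) (auto simp: mem)
  moreover have "map fst L \<in> lists S"
    using L(1) by auto
  ultimately have "map fst L \<in> sd_words"
    by (simp add: sd_words_def)
  moreover have "count_list (map fst L) s = card (Lv s)" for s
    using count_linear_ext[OF L(2)] by (simp add: mem)
  ultimately show ?thesis
    by blast
qed

end

section \<open>Construction of the words\<close>

text \<open>These are the \<open>k\<close> points \<open>-(k-1), -(k-3), ..., k-1\<close>. The sets
  for \<open>k\<close> and \<open>k + 1\<close> interlace, as alternating neighbours
  require.\<close>

definition levels :: "nat \<Rightarrow> int set" where
  "levels k = {y. \<bar>y\<bar> < int k \<and> odd (y + int k)}"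

lemma levels_eq: "levels k = (\<lambda>i. 2 * int i - (int k - 1)) ` {..<k}"
proof (intro equalityI subsetI)
  fix y assume y: "y \<in> levels k"
  then have "even (y + int k - 1)"
    by (simp add: levels_def)
  then obtain z where z: "y + int k - 1 = 2 * z"
    by (elim evenE)
  then have "y = 2 * int (nat z) - (int k - 1)" "nat z < k"
    using y by (auto simp: levels_def)
  then show "y \<in> (\<lambda>i. 2 * int i - (int k - 1)) ` {..<k}"
    by blast
qed (auto simp: levels_def)

lemma finite_levels [simp]: "finite (levels k)"
  unfolding levels_eq by simp

lemma card_levels [simp]: "card (levels k) = k"
  unfolding levels_eq by (subst card_image) (auto simp: inj_on_def)

lemma levels_0 [simp]: "levels 0 = {}"
  by (auto simp: levels_def)

lemma uminus_levels: "y \<in> levels k \<Longrightarrow> - y \<in> levels k"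
  by (auto simp: levels_def)

lemma levels_less:
  assumes "y \<in> levels k" "y' \<in> levels k" "y < y'"
  shows "y + 2 \<le> y'"
proof -
  have "even (y' - y)"
    using assms by (auto simp: levels_def)
  then obtain z where "y' - y = 2 * z"
    by (elim evenE)
  then show ?thesis
    using assms(3) by presburger
qed

lemma levels_between:
  assumes "y \<in> levels k" "y' \<in> levels k" "y < y'" "k' = Suc k \<or> k = Suc k'"
  shows "y + 1 \<in> levels k'" "y + 1 < y'"
  using levels_less[OF assms(1-3)] assms by (auto simp: levels_def)

lemma levels_disjoint: "k' = Suc k \<or> k = Suc k' \<Longrightarrow> levels k \<inter> levels k' = {}"
  by (auto simp: levels_def)

lemma levels_disjoint_walk_step: "walk_step k k' \<Longrightarrow> levels k \<inter> levels k' = {}"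
  using levels_disjoint[of k' k] by (auto simp: walk_step_def)

lemma fork_code_big:
  assumes "fork_code k b c"
  shows "2 \<le> k \<Longrightarrow> even k" "1 \<le> b \<or> 1 \<le> c \<Longrightarrow> even k" "2 \<le> b \<Longrightarrow> 2 * b \<le> k + 2" "2 \<le> c \<Longrightarrow> 2 * c \<le> k + 2"
  using assms by (auto simp: fork_code_def)

text \<open>For even \<open>k\<close> the branching letter sits at odd levels, so the midpoints of
  its gaps are even. Their halves are split by parity between the leaves: one leaf occurs
  \<open>k div 2\<close> times, the other one time more or less.\<close>

lemma fork_levels:
  assumes "fork_code k b c" "y \<in> levels k" "y' \<in> levels k" "y < y'"
  obtains z where "y + 1 = 2 * z" "z \<in> levels b \<or> z \<in> levels c"
proof -
  have k: "even k"
    using assms levels_less[OF assms(2-4)] by (intro fork_code_big(1)[OF assms(1)]) (auto simp: levels_def)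
  then obtain i where i: "k = 2 * i"
    by (elim evenE)
  have "even (y + 1)"
    using assms(2) k by (auto simp: levels_def)
  then obtain z where z: "y + 1 = 2 * z"
    by (elim evenE)
  have "\<bar>2 * z\<bar> \<le> 2 * int i - 2"
    using assms(2,3) levels_less[OF assms(2-4)] z i by (auto simp: levels_def)
  then have zi: "\<bar>z\<bar> \<le> int i - 1" "1 \<le> i"
    by auto
  then have "b = i \<and> (c = Suc i \<or> i = Suc c) \<or> c = i \<and> (b = Suc i \<or> i = Suc b)"
    using assms(1) i by (auto simp: fork_code_def)
  moreover have "z \<in> levels i" if "odd (z + int i)"
    using zi that by (auto simp: levels_def)
  moreover have "z \<in> levels j" if "even (z + int i)" "j = Suc i \<or> i = Suc j" for j
  proof -
    have "\<bar>z\<bar> \<noteq> int i - 1"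
    proof
      assume "\<bar>z\<bar> = int i - 1"
      then have "z = int i - 1 \<or> z = 1 - int i"
        by linarith
      then show False
        using that(1) by auto
    qed
    then show ?thesis
      using zi that by (auto simp: levels_def)
  qed
  ultimately have "z \<in> levels b \<or> z \<in> levels c"
    by (cases "even (z + int i)") auto
  then show ?thesis
    using that z by blast
qed

text \<open>Makes room for the levels \<open>\<plusminus>1, \<dots>, \<plusminus>d\<close> of the nested letters above \<open>h\<close>, where \<open>h\<close> itself is at
  the levels \<open>\<plusminus>(d + 1)\<close>.\<close>

definition stretch :: "int \<Rightarrow> int \<Rightarrow> int" where
  "stretch d t = t + sgn t * d"

lemma stretch_mono: "0 \<le> d \<Longrightarrow> t < t' \<Longrightarrow> stretch d t < stretch d t'"
  by (auto simp: stretch_def sgn_if)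

lemma stretch_less_iff: "0 \<le> d \<Longrightarrow> stretch d t < stretch d t' \<longleftrightarrow> t < t'"
  using stretch_mono[of d t t'] stretch_mono[of d t' t] by (cases t t' rule: linorder_cases) auto

lemma inj_stretch: "0 \<le> d \<Longrightarrow> inj (stretch d)"
  by (rule injI) (metis linorder_neq_iff stretch_less_iff)

lemma stretch_uminus: "stretch d (- t) = - stretch d t"
  by (simp add: stretch_def)

lemma stretch_eq_iff: "0 \<le> d \<Longrightarrow> stretch d t = d + 1 \<longleftrightarrow> t = 1" "0 \<le> d \<Longrightarrow> stretch d t = - d - 1 \<longleftrightarrow> t = -1"
  by (auto simp: stretch_def sgn_if)

context type_D
begin

lemma D_cases [consumes 1, case_names path left right]:
  assumes "D_matrix n s t = 3" "\<And>s t. Q s t \<Longrightarrow> Q t s"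
    and "\<And>j. Suc j < n \<Longrightarrow> Q j (Suc j)" "Q (n - 1) n" "Q (n - 1) (Suc n)"
  shows "Q s t"
  using assms(1) unfolding adj_iff D_edge_def
  using assms(2-5) by (auto simp: less_eq_Suc_le le_diff_conv)

lemma ex_alternating_word:
  assumes "alternating_code n c" "\<And>j. j = 0 \<or> Suc n < j \<Longrightarrow> c j = 0"
  shows "\<exists>u\<in>sd_words. count_list u = c"
proof -
  \<comment> \<open>Leaf levels are doubled because a leaf occupies only every other gap of the
    branching letter.\<close>
  define Lv where "Lv j = (if j < n then levels (c j) else (\<lambda>z. 2 * z) ` levels (c j))" for j
  have path: "walk_step (c j) (c (Suc j))" if "Suc j < n" for j
    using assms(1) that by (auto simp: alternating_code_def path_code_def)
  have fork: "fork_code (c (n - 1)) (c n) (c (Suc n))"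
    using assms(1) by (simp add: alternating_code_def)
  have c0: "c 0 = 0"
    using assms(2) by simp
  have card: "card (Lv j) = c j" for j
    by (auto simp: Lv_def card_image inj_on_def)
  have "\<exists>u\<in>sd_words. \<forall>s. count_list u s = card (Lv s)"
  proof (rule ex_sd_word)
    show "finite (D_gens n)"
      by (simp add: D_gens_def)
    show "finite (Lv s)" for s
      by (simp add: Lv_def)
    show "Lv s = {}" if "s \<notin> D_gens n" for s
      using assms(2)[of s] that by (auto simp: Lv_def D_gens_def)
    show "- y \<in> Lv s" if "y \<in> Lv s" for s y
      using that by (auto simp: Lv_def image_iff uminus_levels split: if_splits)
    have leaf: "Lv (n - 1) \<inter> Lv s = {}" if "s = n \<or> s = Suc n" for s
    proof (cases "c s = 0")
      case True
      then show ?thesis by (simp add: Lv_def)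
    next
      case False
      then have "even (c (n - 1))"
        using that fork_code_big(2)[OF fork] by auto
      then show ?thesis
        using that n_pos by (auto simp: Lv_def levels_def)
    qed
    show "Lv s \<inter> Lv t = {}" if "D_matrix n s t = 3" for s t
      using that
    proof (rule D_cases)
      show "Lv j \<inter> Lv (Suc j) = {}" if "Suc j < n" for j
        using levels_disjoint_walk_step[OF path[OF that]] that by (simp add: Lv_def)
    qed (use leaf in auto)
    fix s y y' assume y: "y \<in> Lv s" "y' \<in> Lv s" "y < y'"
    show "\<exists>t z t' z'. (t, z) \<noteq> (t', z') \<and> D_matrix n s t = 3 \<and> D_matrix n s t' = 3 \<and>
      z \<in> Lv t \<and> z' \<in> Lv t' \<and> y < z \<and> z < y' \<and> y < z' \<and> z' < y'"
    proof (cases "s < n")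
      case True
      then have ys: "y \<in> levels (c s)" "y' \<in> levels (c s)"
        using y by (auto simp: Lv_def)
      then obtain j where j: "s = Suc j"
        using c0 by (cases s) auto
      have between: "y + 1 \<in> levels k" "y + 1 < y'" if "walk_step k (c s) \<or> walk_step (c s) k" for k
        using levels_between[OF ys y(3), of k] that ys by (auto simp: walk_step_def)
      have left: "y + 1 \<in> Lv j" "y + 1 < y'"
        using between[of "c j"] path[of j] True j by (auto simp: Lv_def)
      show ?thesis
      proof (cases "Suc s < n")
        case True
        have "y + 1 \<in> Lv (Suc s)"
          using between[of "c (Suc s)"] path[OF True] True by (auto simp: Lv_def)
        then show ?thesis
          using left j True
          by (intro exI[of _ j] exI[of _ "y + 1"] exI[of _ "Suc s"]) (auto simp: adj_path)
      next
        case False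
        then have s: "s = n - 1"
          using True by simp
        obtain z where z: "y + 1 = 2 * z" "z \<in> levels (c n) \<or> z \<in> levels (c (Suc n))"
          using fork_levels[OF fork] ys y(3) s by metis
        then have "y + 1 \<in> Lv n \<or> y + 1 \<in> Lv (Suc n)"
          by (auto simp: Lv_def)
        then obtain t where t: "t = n \<or> t = Suc n" "y + 1 \<in> Lv t"
          by blast
        have "D_matrix n s j = 3" "D_matrix n s t = 3"
          unfolding s adj_branch using t j s by auto
        then show ?thesis
          using left t j True
          by (intro exI[of _ j] exI[of _ "y + 1"] exI[of _ t]) auto
      qed
    next
      case False
      then obtain z z' where z: "y = 2 * z" "y' = 2 * z'" "z \<in> levels (c s)" "z' \<in> levels (c s)"
        using y by (auto simp: Lv_def)
      then have "z < z'" "c s \<noteq> 0"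
        using y(3) by (auto simp: levels_def)
      then have zz: "z + 2 \<le> z'"
        using levels_less z by blast
      then have "2 \<le> c s"
        using z(3,4) by (auto simp: levels_def)
      have s: "s = n \<or> s = Suc n"
        using assms(2)[of s] False \<open>c s \<noteq> 0\<close> by linarith
      then have "even (c (n - 1))" "2 * c s \<le> c (n - 1) + 2"
        using fork_code_big(2-4)[OF fork] \<open>2 \<le> c s\<close> by auto
      \<comment> \<open>Two levels of a leaf differ by at least 4 after doubling, so these two odd
        levels lie strictly between them.\<close>
      then have "2 * z + 1 \<in> Lv (n - 1)" "2 * z + 3 \<in> Lv (n - 1)"
        using z(3,4) zz n_pos by (auto simp: Lv_def levels_def)
      then show ?thesis
        using zz z(1,2) adj_leaf[OF s]
        by (intro exI[of _ "n - 1"] exI[of _ "2 * z + 1"] exI[of _ "2 * z + 3"]) auto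
    qed
  qed
  then show ?thesis
    unfolding card by (auto simp: fun_eq_iff)
qed

lemma ex_nested_word:
  assumes "nested_code n c h" "\<And>j. j = 0 \<or> Suc n < j \<Longrightarrow> c j = 0"
  shows "\<exists>u\<in>sd_words. count_list u = c"
proof -
  have h: "1 \<le> h" "h < n" "c (h - 1) \<in> {0, 1, 3}" "\<And>j. h \<le> j \<Longrightarrow> j < n \<Longrightarrow> c j = 2" "c n = 1" "c (Suc n) = 1"
    and path: "\<And>j. Suc j < h \<Longrightarrow> walk_step (c j) (c (Suc j))"
    using assms(1) by (auto simp: nested_code_def path_code_def)
  have c0: "c 0 = 0"
    using assms(2) by simp
  define d where "d = int n - int h - 1"
  have d: "0 \<le> d"
    using h(2) by (simp add: d_def)
  \<comment> \<open>The leaves sit at level 0 and a nested letter \<open>j\<close> at distance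
    \<open>n - j\<close> from it, so \<open>h\<close> is at distance \<open>d + 1\<close>, the
    stretched images of 1 and -1. Seen from below, \<open>h\<close> behaves like a letter with the
    level set \<open>levels 2\<close>.\<close>
  define Lv where "Lv j = (if j < h then stretch d ` levels (c j)
      else if j < n then {int j - int n, int n - int j} else if j \<le> Suc n then {0} else {})" for j
  have card: "card (Lv j) = c j" for j
  proof -
    have "card (stretch d ` levels (c j)) = c j"
      by (subst card_image) (auto intro: inj_on_subset[OF inj_stretch[OF d]])
    moreover have "c j = 1" if "n \<le> j" "j \<le> Suc n"
      using h(5,6) that by (auto simp: le_Suc_eq)
    ultimately show ?thesis
      using h(4)[of j] assms(2)[of j] by (auto simp: Lv_def)
  qed
  have "\<exists>u\<in>sd_words. \<forall>s. count_list u s = card (Lv s)"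
  proof (rule ex_sd_word)
    show "finite (D_gens n)"
      by (simp add: D_gens_def)
    show "finite (Lv s)" for s
      by (simp add: Lv_def)
    show "Lv s = {}" if "s \<notin> D_gens n" for s
      using assms(2)[of s] that h by (auto simp: Lv_def D_gens_def)
    show "- y \<in> Lv s" if "y \<in> Lv s" for s y
      using that uminus_levels by (auto simp: Lv_def stretch_uminus[symmetric] split: if_splits)
    show "Lv s \<inter> Lv t = {}" if "D_matrix n s t = 3" for s t
      using that
    proof (rule D_cases)
      show "Lv t \<inter> Lv s = {}" if "Lv s \<inter> Lv t = {}" for s t
        using that by blast
      fix j assume j: "Suc j < n"
      consider "Suc j < h" | "Suc j = h" | "h \<le> j"
        by linarith
      then show "Lv j \<inter> Lv (Suc j) = {}"
      proof cases
        case 1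
        then show ?thesis
          using levels_disjoint_walk_step[OF path[OF 1]] inj_stretch[OF d]
          by (auto simp: Lv_def dest: injD)
      next
        case 2
        have "t \<noteq> 1" "t \<noteq> -1" if "t \<in> levels (c j)" for t
          using that h(3) 2 by (auto simp: levels_def)
        then have "d + 1 \<notin> stretch d ` levels (c j)" "- d - 1 \<notin> stretch d ` levels (c j)"
          using stretch_eq_iff[OF d] by (metis imageE)+
        moreover have "Lv (Suc j) = {- d - 1, d + 1}" "Lv j = stretch d ` levels (c j)"
          using 2 h(2) by (auto simp: Lv_def d_def)
        ultimately show ?thesis
          by simp
      next
        case 3
        then show ?thesis
          using j by (auto simp: Lv_def)
      qed
    qed (use h n_pos in \<open>auto simp: Lv_def\<close>)
    fix s y y' assume y: "y \<in> Lv s" "y' \<in> Lv s" "y < y'"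
    then consider "s < h" | "h \<le> s" "Suc s < n" | "s = n - 1" "h \<le> s"
      by (auto simp: Lv_def split: if_splits) linarith+
    then show "\<exists>t z t' z'. (t, z) \<noteq> (t', z') \<and> D_matrix n s t = 3 \<and> D_matrix n s t' = 3 \<and>
      z \<in> Lv t \<and> z' \<in> Lv t' \<and> y < z \<and> z < y' \<and> y < z' \<and> z' < y'"
    proof cases
      case 1
      then obtain t t' where t: "y = stretch d t" "y' = stretch d t'" "t \<in> levels (c s)" "t' \<in> levels (c s)"
        using y by (auto simp: Lv_def)
      then have tt: "t < t'"
        using y(3) stretch_less_iff[OF d] by simp
      obtain j where j: "s = Suc j"
        using c0 t(3) by (cases s) auto
      have between: "t + 1 \<in> levels k" "t + 1 < t'" if "walk_step k (c s) \<or> walk_step (c s) k" for k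
        using levels_between[OF t(3,4) tt, of k] that t(3) by (auto simp: walk_step_def)
      have less: "y < stretch d (t + 1)" "stretch d (t + 1) < y'"
        using between(2)[of "c j"] path[of j] 1 j t(1,2) stretch_mono[OF d] by auto
      have left: "stretch d (t + 1) \<in> Lv j"
        using between[of "c j"] path[of j] 1 j by (auto simp: Lv_def)
      have right: "stretch d (t + 1) \<in> Lv (Suc s)"
      proof (cases "Suc s < h")
        case True
        then show ?thesis
          using between[of "c (Suc s)"] path[OF True] by (auto simp: Lv_def)
      next
        case False
        then have "Suc s = h"
          using 1 by simp
        then have "c s \<in> {0, 1, 3}"
          using h(3) by auto
        \<comment> \<open>Two different levels exist only for \<open>c (h - 1) = 3\<close>, where
          they are -2, 0, 2; the midpoints are the unstretched levels of \<open>h\<close>.\<close>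
        then have "t + 1 = 1 \<or> t + 1 = -1"
          using t(3,4) tt by (auto simp: levels_def)
        then have "stretch d (t + 1) = d + 1 \<or> stretch d (t + 1) = - d - 1"
          using stretch_eq_iff[OF d] by blast
        then show ?thesis
          using \<open>Suc s = h\<close> h(2) by (auto simp: Lv_def d_def)
      qed
      have "D_matrix n s j = 3" "D_matrix n s (Suc s) = 3"
        using adj_path[of s] 1 h(2) j by auto
      then show ?thesis
        using left right less j
        by (intro exI[of _ j] exI[of _ "stretch d (t + 1)"] exI[of _ "Suc s"]) auto
    next
      case 2
      then have "y = int s - int n" "y' = int n - int s"
        using y by (auto simp: Lv_def)
      then show ?thesis
        using 2 h
        by (intro exI[of _ "Suc s"] exI[of _ "int (Suc s) - int n"] exI[of _ "int n - int (Suc s)"])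
           (auto simp: adj_path Lv_def)
    next
      case 3
      then have "y = -1" "y' = 1"
        using y n_pos by (auto simp: Lv_def of_nat_diff)
      moreover have "D_matrix n s n = 3" "D_matrix n s (Suc n) = 3"
        unfolding 3(1) adj_branch by auto
      ultimately show ?thesis
        using h
        by (intro exI[of _ n] exI[of _ "0::int"] exI[of _ "Suc n"]) (auto simp: Lv_def)
    qed
  qed
  then show ?thesis
    unfolding card by (auto simp: fun_eq_iff)
qed

end

section \<open>Walks counted by the positions of their peaks\<close>

definition walks :: "nat \<Rightarrow> nat \<Rightarrow> (nat \<Rightarrow> nat) set" where
  "walks m j = {c. path_code c m \<and> c m = j \<and> (\<forall>i>m. c i = 0)}"

definition peak_sum :: "nat \<Rightarrow> (nat \<Rightarrow> nat) \<Rightarrow> nat" where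
  "peak_sum m c = \<Sum>{i. 1 \<le> i \<and> i < m \<and> c (i - 1) < c i \<and> c (Suc i) \<le> c i}"

definition end_peak :: "nat \<Rightarrow> (nat \<Rightarrow> nat) \<Rightarrow> nat" where
  "end_peak m c = (if 1 \<le> m \<and> c (m - 1) < c m then m else 0)"

lemma walks_0: "walks 0 j = (if j = 0 then {\<lambda>_. 0} else {})"
  by (auto simp: walks_def path_code_def fun_eq_iff) (metis gr0I)

lemma walks_Suc: "walks (Suc m) j = (\<Union>i\<in>{i. walk_step i j}. (\<lambda>c. c(Suc m := j)) ` walks m i)"
proof (intro equalityI subsetI)
  fix c assume c: "c \<in> walks (Suc m) j"
  then have "c(Suc m := 0) \<in> walks m (c m)" "walk_step (c m) j"
    by (auto simp: walks_def path_code_def not_less_eq)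
  moreover have "c = (c(Suc m := 0))(Suc m := j)"
    using c by (auto simp: walks_def)
  ultimately show "c \<in> (\<Union>i\<in>{i. walk_step i j}. (\<lambda>c. c(Suc m := j)) ` walks m i)"
    by blast
qed (auto simp: walks_def path_code_def less_Suc_eq)

lemma inj_walk_update: "inj_on (\<lambda>c. c(Suc m := j)) (walks m i)"
proof (rule inj_onI)
  fix c c' assume "c \<in> walks m i" "c' \<in> walks m i" "c(Suc m := j) = c'(Suc m := j)"
  then show "c = c'"
    unfolding walks_def fun_eq_iff by (auto simp: fun_upd_def split: if_splits) (metis lessI)
qed

lemma walk_step_pred: "{i. walk_step i 0} = {0, 1}" "{i. walk_step i (Suc j)} = {j, Suc (Suc j)}"
  by (auto simp: walk_step_def)

lemma finite_walks [simp]: "finite (walks m j)"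
proof (induction m arbitrary: j)
  case 0
  then show ?case by (simp add: walks_0)
next
  case (Suc m)
  have "finite {i. walk_step i j}"
    by (cases j) (simp_all add: walk_step_pred)
  then show ?case
    using Suc by (simp add: walks_Suc)
qed

lemma peak_sum_Suc:
  "peak_sum (Suc m) c = peak_sum m c + (if c (Suc m) \<le> c m then end_peak m c else 0)"
proof -
  let ?A = "{i. 1 \<le> i \<and> i < m \<and> c (i - 1) < c i \<and> c (Suc i) \<le> c i}"
  have "{i. 1 \<le> i \<and> i < Suc m \<and> c (i - 1) < c i \<and> c (Suc i) \<le> c i}
    = (if 1 \<le> m \<and> c (m - 1) < c m \<and> c (Suc m) \<le> c m then insert m ?A else ?A)"
    by (auto simp: less_Suc_eq)
  then show ?thesis
    by (auto simp: peak_sum_def end_peak_def)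
qed

lemma peak_sum_cong: "(\<And>i. i \<le> m \<Longrightarrow> c i = c' i) \<Longrightarrow> peak_sum m c = peak_sum m c'"
  unfolding peak_sum_def by (intro arg_cong[of _ _ "\<lambda>A. \<Sum>A"] Collect_cong) auto

lemma end_peak_cong: "(\<And>i. i \<le> m \<Longrightarrow> c i = c' i) \<Longrightarrow> end_peak m c = end_peak m c'"
  by (simp add: end_peak_def)

text \<open>In the second generating function the last position counts as a peak if it is reached by an
  up-step; this is the contribution of a walk that is continued by a step that does not go up.\<close>

definition walk_gf :: "'a::comm_ring_1 \<Rightarrow> nat \<Rightarrow> nat \<Rightarrow> 'a" where
  "walk_gf q m j = (\<Sum>c\<in>walks m j. q ^ peak_sum m c)"

definition closed_walk_gf :: "'a::comm_ring_1 \<Rightarrow> nat \<Rightarrow> nat \<Rightarrow> 'a" where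
  "closed_walk_gf q m j = (\<Sum>c\<in>walks m j. q ^ (peak_sum m c + end_peak m c))"

lemma walk_gf_0: "walk_gf q 0 j = (if j = 0 then 1 else 0)"
  by (simp add: walk_gf_def walks_0 peak_sum_def)

lemma closed_walk_gf_0: "closed_walk_gf q 0 j = (if j = 0 then 1 else 0)"
  by (simp add: closed_walk_gf_def walks_0 peak_sum_def end_peak_def)

lemma sum_walks_Suc:
  "(\<Sum>c\<in>walks (Suc m) j. f c) = (\<Sum>i | walk_step i j. \<Sum>c\<in>walks m i. f (c(Suc m := j)))"
proof -
  have fin: "finite {i. walk_step i j}"
    by (cases j) (simp_all add: walk_step_pred)
  have "(\<lambda>c. c(Suc m := j)) ` walks m i \<inter> (\<lambda>c. c(Suc m := j)) ` walks m i' = {}" if "i \<noteq> i'" for i i'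
  proof -
    have "c m = i" if "c \<in> (\<lambda>c. c(Suc m := j)) ` walks m i" for c i
      using that by (auto simp: walks_def)
    then show ?thesis
      using that by blast
  qed
  then have "(\<Sum>c\<in>walks (Suc m) j. f c) = (\<Sum>i | walk_step i j. \<Sum>c\<in>(\<lambda>c. c(Suc m := j)) ` walks m i. f c)"
    unfolding walks_Suc by (intro sum.UNION_disjoint) (use fin in auto)
  also have "\<dots> = (\<Sum>i | walk_step i j. \<Sum>c\<in>walks m i. f (c(Suc m := j)))"
    by (rule sum.cong[OF HOL.refl]) (simp add: sum.reindex[OF inj_walk_update] o_def)
  finally show ?thesis .
qed

lemma peak_sum_walk_update:
  assumes "c \<in> walks m i"
  shows "peak_sum (Suc m) (c(Suc m := j)) = peak_sum m c + (if j \<le> i then end_peak m c else 0)"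
    "end_peak (Suc m) (c(Suc m := j)) = (if i < j then Suc m else 0)"
proof -
  have "peak_sum m (c(Suc m := j)) = peak_sum m c" "end_peak m (c(Suc m := j)) = end_peak m c"
    by (intro peak_sum_cong end_peak_cong; simp)+
  then show "peak_sum (Suc m) (c(Suc m := j)) = peak_sum m c + (if j \<le> i then end_peak m c else 0)"
    "end_peak (Suc m) (c(Suc m := j)) = (if i < j then Suc m else 0)"
    using assms by (auto simp: peak_sum_Suc end_peak_def walks_def)
qed

lemma walk_gf_Suc:
  "walk_gf q (Suc m) j = (\<Sum>i | walk_step i j. if j \<le> i then closed_walk_gf q m i else walk_gf q m i)"
  unfolding walk_gf_def[of q "Suc m"] sum_walks_Suc
  by (intro sum.cong HOL.refl) (auto simp: peak_sum_walk_update walk_gf_def closed_walk_gf_def)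

lemma closed_walk_gf_Suc:
  "closed_walk_gf q (Suc m) j =
    (\<Sum>i | walk_step i j. if j \<le> i then closed_walk_gf q m i else q ^ Suc m * walk_gf q m i)"
  unfolding closed_walk_gf_def[of q "Suc m"] sum_walks_Suc
  by (intro sum.cong HOL.refl)
     (auto simp: peak_sum_walk_update walk_gf_def closed_walk_gf_def sum_distrib_left power_add algebra_simps)

lemma closed_walk_gf_at_0: "closed_walk_gf q m 0 = walk_gf q m 0"
  unfolding closed_walk_gf_def walk_gf_def
  by (intro sum.cong) (auto simp: end_peak_def walks_def)

lemma walk_gf_Suc_0: "walk_gf q (Suc m) 0 = walk_gf q m 0 + closed_walk_gf q m 1"
  by (simp add: walk_gf_Suc walk_step_pred closed_walk_gf_at_0)

lemma walk_gf_Suc_Suc: "walk_gf q (Suc m) (Suc j) = walk_gf q m j + closed_walk_gf q m (j + 2)"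
  by (simp add: walk_gf_Suc walk_step_pred)

lemma closed_walk_gf_Suc_Suc:
  "closed_walk_gf q (Suc m) (Suc j) = q ^ Suc m * walk_gf q m j + closed_walk_gf q m (j + 2)"
  by (simp add: closed_walk_gf_Suc walk_step_pred)

text \<open>Split at the last up-step, which ends at position \<open>h\<close>: the
  \<open>m - h\<close> steps after it go down, so the walk before it ends at height
  \<open>k + m - h\<close>. The induction removes final down-steps one by one.\<close>

lemma closed_walk_gf_eq: "closed_walk_gf q m (Suc k) = (\<Sum>h=1..m. q ^ h * walk_gf q (h - 1) (k + m - h))"
proof (induction m arbitrary: k)
  case 0
  then show ?case by (simp add: closed_walk_gf_0)
next
  case (Suc m)
  have "closed_walk_gf q (Suc m) (Suc k) = q ^ Suc m * walk_gf q m k + closed_walk_gf q m (Suc (Suc k))"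
    by (simp add: closed_walk_gf_Suc_Suc)
  then show ?case
    by (simp add: Suc.IH)
qed

text \<open>The closed generating functions are eliminated: they differ from the open ones only in
  the factor \<open>q ^ (m + 1)\<close> for walks whose last step goes up.\<close>

lemma walk_gf_rec:
  "walk_gf q (m + 2) 0 = walk_gf q (m + 1) 0 + walk_gf q (m + 1) 1 + (q ^ (m + 1) - 1) * walk_gf q m 0"
  "walk_gf q (m + 2) (j + 1) =
    walk_gf q (m + 1) j + walk_gf q (m + 1) (j + 2) + (q ^ (m + 1) - 1) * walk_gf q m (j + 1)"
proof -
  have "closed_walk_gf q (Suc m) (Suc i) = walk_gf q (Suc m) (Suc i) + (q ^ Suc m - 1) * walk_gf q m i" for i
    by (simp add: walk_gf_Suc_Suc closed_walk_gf_Suc_Suc algebra_simps)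
  from this[of 0] this[of "j + 1"] show
    "walk_gf q (m + 2) 0 = walk_gf q (m + 1) 0 + walk_gf q (m + 1) 1 + (q ^ (m + 1) - 1) * walk_gf q m 0"
    "walk_gf q (m + 2) (j + 1) =
      walk_gf q (m + 1) j + walk_gf q (m + 1) (j + 2) + (q ^ (m + 1) - 1) * walk_gf q m (j + 1)"
    using walk_gf_Suc_0[of q "Suc m"] walk_gf_Suc_Suc[of q "Suc m" j] by simp_all
qed

section \<open>Gaussian binomial coefficients\<close>

lemma qvar_power_neq_1: "i \<ge> 1 \<Longrightarrow> 1 - qvar ^ i \<noteq> 0"
proof
  assume "i \<ge> 1" "1 - qvar ^ i = 0"
  moreover have "to_fract (p ^ i) = to_fract p ^ i" for p :: "rat poly"
    by (induction i) simp_all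
  ultimately have "to_fract ([:0, 1:] ^ i) = (to_fract 1 :: rat poly fract)"
    by (simp add: qvar_def)
  then have "[:0, 1:] ^ i = (1 :: rat poly)"
    by (simp only: to_fract_eq_iff)
  then have "degree ([:0, 1:] ^ i :: rat poly) = 0"
    by simp
  then show False
    using \<open>i \<ge> 1\<close> by (simp add: degree_power_eq)
qed

definition qfact :: "nat \<Rightarrow> rat poly fract" where
  "qfact n = (\<Prod>i=1..n. 1 - qvar ^ i)"

lemma qfact_0: "qfact 0 = 1"
  by (simp add: qfact_def)

lemma qfact_Suc: "qfact (Suc n) = (1 - qvar ^ Suc n) * qfact n"
  by (simp add: qfact_def mult.commute)

lemma qfact_nonzero: "qfact n \<noteq> 0"
  unfolding qfact_def using qvar_power_neq_1 by (simp add: prod_zero_iff)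

lemma qbinomial_qfact: "qbinomial n k = qfact n / (qfact k * qfact (n - k))"
  by (simp add: qbinomial_def qfact_def)

lemma qbinomial_0 [simp]: "qbinomial n 0 = 1"
  using qfact_nonzero by (simp add: qbinomial_qfact qfact_0)

lemma qbinomial_symmetric: "k \<le> n \<Longrightarrow> qbinomial n (n - k) = qbinomial n k"
  by (simp add: qbinomial_qfact mult.commute)

text \<open>With \<open>x = 1 - q^(a+1)\<close> and \<open>y = 1 - q^(b+1)\<close> one has
  \<open>1 - q^(a+b+2) = x + y - x y\<close>; the three summands give the three terms on the
  right.\<close>

lemma qbinomial_rec:
  "qbinomial (a + b + 2) (a + 1) =
    qbinomial (a + b + 1) (a + 1) + qbinomial (a + b + 1) a + (qvar ^ (a + b + 1) - 1) * qbinomial (a + b) a"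
proof -
  define x where "x = 1 - qvar ^ Suc a"
  define y where "y = 1 - qvar ^ Suc b"
  define z where "z = 1 - qvar ^ Suc (a + b)"
  have nz: "x \<noteq> 0" "y \<noteq> 0" "z \<noteq> 0" "qfact a \<noteq> 0" "qfact b \<noteq> 0"
    using qvar_power_neq_1 qfact_nonzero by (simp_all add: x_def y_def z_def del: power_Suc)
  have top: "1 - qvar ^ Suc (Suc (a + b)) = x + y - x * y"
    by (simp add: x_def y_def power_add algebra_simps)
  have 1: "qbinomial (a + b + 2) (a + 1) = (x + y - x * y) * z * qfact (a + b) / (x * qfact a * (y * qfact b))"
    using top by (simp add: qbinomial_qfact qfact_Suc x_def y_def z_def del: power_Suc)
  have 2: "qbinomial (a + b + 1) (a + 1) = z * qfact (a + b) / (x * qfact a * qfact b)"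
    by (simp add: qbinomial_qfact qfact_Suc x_def z_def del: power_Suc)
  have 3: "qbinomial (a + b + 1) a = z * qfact (a + b) / (qfact a * (y * qfact b))"
    by (simp add: qbinomial_qfact qfact_Suc y_def z_def Suc_diff_le del: power_Suc)
  have 4: "(qvar ^ (a + b + 1) - 1) * qbinomial (a + b) a = - z * qfact (a + b) / (qfact a * qfact b)"
    by (simp add: qbinomial_qfact z_def)
  show ?thesis
    unfolding 1 2 3 4 using nz by (simp add: field_simps)
qed

theorem walk_gf_qbinomial:
  "walk_gf qvar m j = (if j \<le> m then qbinomial m ((m - j) div 2) else 0)"
proof (induction m arbitrary: j rule: induct_nat_012)
  case 0
  then show ?case by (simp add: walk_gf_0)
next
  case 1
  then show ?case
    by (cases j) (simp_all add: walk_gf_Suc_0 walk_gf_Suc_Suc walk_gf_0 closed_walk_gf_0)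
next
  case (ge2 m)
  have rec: "qbinomial (m + 2) p = qbinomial (m + 1) p + qbinomial (m + 1) (p - 1) +
      (qvar ^ (m + 1) - 1) * qbinomial m (p - 1)" if "1 \<le> p" "p \<le> m + 1" for p
    using qbinomial_rec[of "p - 1" "m + 1 - p"] that by simp
  show ?case
  proof (cases j)
    case 0
    have "walk_gf qvar (m + 2) 0 = qbinomial (m + 1) ((m + 1) div 2) + qbinomial (m + 1) (m div 2) +
        (qvar ^ (m + 1) - 1) * qbinomial m (m div 2)"
      using walk_gf_rec(1)[of qvar m] ge2 by simp
    \<comment> \<open>At height 0 the flat step replaces the missing up-step. For even
      \<open>m\<close> its coefficient has to be reflected before the recurrence applies.\<close>
    also have "qbinomial (m + 1) ((m + 1) div 2) = qbinomial (m + 1) (m div 2 + 1)"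
    proof (cases "even m")
      case True
      then have "(m + 1) div 2 = m + 1 - (m div 2 + 1)"
        by (elim evenE) simp
      then show ?thesis
        using qbinomial_symmetric[of "m div 2 + 1" "m + 1"] by simp
    next
      case False
      then show ?thesis
        by (elim oddE) simp
    qed
    finally show ?thesis
      using rec[of "m div 2 + 1"] 0 by simp
  next
    case (Suc i)
    have eq: "walk_gf qvar (m + 2) (i + 1) =
        walk_gf qvar (m + 1) i + walk_gf qvar (m + 1) (i + 2) + (qvar ^ (m + 1) - 1) * walk_gf qvar m (i + 1)"
      by (rule walk_gf_rec(2))
    consider "i + 1 \<le> m" | "i = m" | "i = m + 1" | "i > m + 1"
      by linarith
    then show ?thesis
    proof cases
      case 1
      define p where "p = (m + 1 - i) div 2"
      have p: "1 \<le> p" "p \<le> m + 1" "(m - 1 - i) div 2 = p - 1" "(m - Suc i) div 2 = p - 1"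
        using 1 by (auto simp: p_def)
      show ?thesis
        using eq rec[OF p(1,2)] ge2 1 Suc p by (simp add: p_def)
    qed (use eq ge2 Suc in simp_all)
  qed
qed

lemma walk_gf_zero: "m < j \<Longrightarrow> walk_gf qvar m j = 0"
  by (simp add: walk_gf_qbinomial)

text \<open>For odd \<open>m - j\<close> the value of \<open>(m - j) div 2\<close> is the same at
  \<open>j\<close> and \<open>j + 1\<close>. This is what pairs even with odd heights in the sums
  below.\<close>

lemma walk_gf_parity:
  assumes "odd (m + j)"
  shows "walk_gf qvar m (Suc j) = walk_gf qvar m j"
proof (cases "j \<le> m")
  case True
  then have "odd (m - j)"
    using assms by simp
  then have "Suc j \<le> m" "(m - Suc j) div 2 = (m - j) div 2"
    using True by (auto elim!: oddE) presburger+
  then show ?thesis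
    using True by (simp add: walk_gf_qbinomial)
next
  case False
  then show ?thesis by (simp add: walk_gf_qbinomial)
qed

text \<open>The lower indices \<open>e div 2\<close> cover the lower half of the range essentially
  twice; symmetry sends those with odd \<open>e\<close> to the upper half.\<close>

lemma sum_qbinomial: "(\<Sum>i=0..m. qbinomial m i) = (\<Sum>j=0..m. walk_gf qvar m j)"
proof -
  have "(\<Sum>j=0..m. walk_gf qvar m j) = (\<Sum>j=0..m. qbinomial m ((m - j) div 2))"
    by (intro sum.cong) (auto simp: walk_gf_qbinomial)
  also have "\<dots> = (\<Sum>e=0..m. qbinomial m (e div 2))"
    by (rule sum.reindex_bij_witness[of _ "\<lambda>e. m - e" "\<lambda>e. m - e"]) auto
  also have "\<dots> = (\<Sum>i=0..m. qbinomial m i)"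
  proof (rule sum.reindex_bij_witness[of _ "\<lambda>i. if 2 * i \<le> m then 2 * i else 2 * (m - i) + 1"
        "\<lambda>e. if even e then e div 2 else m - e div 2"])
    fix e assume e: "e \<in> {0..m}"
    then show "(if even e then e div 2 else m - e div 2) \<in> {0..m}"
      by auto
    show "qbinomial m (if even e then e div 2 else m - e div 2) = qbinomial m (e div 2)"
      using qbinomial_symmetric[of "e div 2" m] e by auto
    show "(if 2 * (if even e then e div 2 else m - e div 2) \<le> m
        then 2 * (if even e then e div 2 else m - e div 2)
        else 2 * (m - (if even e then e div 2 else m - e div 2)) + 1) = e"
      using e by (auto elim!: oddE)
  next
    fix i assume "i \<in> {0..m}"
    then show "(if 2 * i \<le> m then 2 * i else 2 * (m - i) + 1) \<in> {0..m}"
      "(if even (if 2 * i \<le> m then 2 * i else 2 * (m - i) + 1)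
        then (if 2 * i \<le> m then 2 * i else 2 * (m - i) + 1) div 2
        else m - (if 2 * i \<le> m then 2 * i else 2 * (m - i) + 1) div 2) = i"
      by auto
  qed
  finally show ?thesis ..
qed

section \<open>Summation over the codes\<close>

definition codes :: "nat \<Rightarrow> (nat \<Rightarrow> nat) set" where
  "codes n = {c. (\<forall>j. j = 0 \<or> Suc n < j \<longrightarrow> c j = 0) \<and> (alternating_code n c \<or> (\<exists>h. nested_code n c h))}"

context type_D
begin

lemma sum_fc_involutions:
  "(\<Sum>w\<in>fc_involutions (D_gens n) (D_matrix n). f (maj (D_gens n) (D_matrix n) w))
    = (\<Sum>c\<in>codes n. f (\<Sum>(code_descents n c)))"
proof -
  let ?cl = "cox_class (D_gens n) (D_matrix n)"
  define word where "word c = (SOME u. u \<in> sd_words \<and> count_list u = c)" for c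
  have word: "word c \<in> sd_words" "count_list (word c) = c" if "c \<in> codes n" for c
  proof -
    have "\<exists>u. u \<in> sd_words \<and> count_list u = c"
      using that ex_alternating_word[of c] ex_nested_word[of c] unfolding codes_def by blast
    then show "word c \<in> sd_words" "count_list (word c) = c"
      unfolding word_def by (metis (mono_tags, lifting) someI_ex)+
  qed
  have lists: "u \<in> lists (D_gens n)" "fc_word u" if "u \<in> sd_words" for u
    using that by (auto simp: sd_words_def)
  have "bij_betw (\<lambda>c. ?cl (word c)) (codes n) (fc_involutions (D_gens n) (D_matrix n))"
    unfolding bij_betw_def
  proof (intro conjI inj_onI)
    fix c c' assume c: "c \<in> codes n" "c' \<in> codes n" "?cl (word c) = ?cl (word c')"
    then have "mset (word c) = mset (word c')"
      using word(1) by (intro ceq_mset cox_class_eq_sd_words) auto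
    then have "count_list (word c) = count_list (word c')"
      by (metis count_mset ext)
    then show "c = c'"
      using word(2) c by simp
  next
    show "(\<lambda>c. ?cl (word c)) ` codes n = fc_involutions (D_gens n) (D_matrix n)"
      unfolding fc_involutions_eq
    proof (intro equalityI subsetI)
      fix w assume "w \<in> (\<lambda>c. ?cl (word c)) ` codes n"
      then show "w \<in> ?cl ` sd_words"
        using word by auto
    next
      fix w assume "w \<in> ?cl ` sd_words"
      then obtain u where u: "u \<in> sd_words" "w = ?cl u"
        by blast
      have "count_list u j = 0" if "j = 0 \<or> Suc n < j" for j
        using gens[OF lists(1)[OF u(1)], of j] that by (force simp: count_list_0_iff)
      then have c: "count_list u \<in> codes n"
        using sd_word_code(1)[OF u(1)] by (auto simp: codes_def)
      then have "?cl (word (count_list u)) = ?cl u"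
        using word lists u(1) by (intro cox_class_eqI ceq_imp_cox sd_words_eq_iff) auto
      then show "w \<in> (\<lambda>c. ?cl (word c)) ` codes n"
        using c u(2) by (metis imageI)
    qed
  qed
  then have "(\<Sum>w\<in>fc_involutions (D_gens n) (D_matrix n). f (maj (D_gens n) (D_matrix n) w))
      = (\<Sum>c\<in>codes n. f (maj (D_gens n) (D_matrix n) (?cl (word c))))"
    by (rule sum.reindex_bij_betw[symmetric])
  also have "\<dots> = (\<Sum>c\<in>codes n. f (\<Sum>(code_descents n c)))"
  proof (rule sum.cong[OF HOL.refl])
    fix c assume c: "c \<in> codes n"
    have "right_descents (D_gens n) (D_matrix n) (?cl (word c)) = code_descents n c"
      using right_descents_class[OF lists[OF word(1)[OF c]]] sd_word_code(2)[OF word(1)[OF c]] word(2)[OF c]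
      by simp
    then show "f (maj (D_gens n) (D_matrix n) (?cl (word c))) = f (\<Sum>(code_descents n c))"
      by (simp add: maj_def)
  qed
  finally show ?thesis .
qed

end

section \<open>Weights of the alternating and the nested codes\<close>

lemma sum_code_descents:
  assumes "1 \<le> n"
  shows "\<Sum>(code_descents n c) = peak_sum (n - 1) c +
    (if c n + c (Suc n) \<le> c (n - 1) then end_peak (n - 1) c else 0) +
    (if c (n - 1) < 2 * c n then n else 0) + (if c (n - 1) < 2 * c (Suc n) then Suc n else 0)"
proof -
  obtain m where m: "n = Suc m"
    using assms by (cases n) auto
  let ?s = "c n + c (Suc n)"
  let ?P = "{j. 1 \<le> j \<and> j < n \<and> c (j - 1) < c j \<and> (if Suc j < n then c (Suc j) else ?s) \<le> c j}"
  let ?L = "{j. j \<in> {n, Suc n} \<and> c (n - 1) < 2 * c j}"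
  \<comment> \<open>Placing the total leaf count at position \<open>n\<close> as a fictitious height
    turns the descents below \<open>n\<close> into the peaks of the extended sequence.\<close>
  have "?P = {j. 1 \<le> j \<and> j < Suc m \<and> (c(Suc m := ?s)) (j - 1) < (c(Suc m := ?s)) j \<and>
      (c(Suc m := ?s)) (Suc j) \<le> (c(Suc m := ?s)) j}"
    unfolding m by (intro Collect_cong) auto
  then have "\<Sum>?P = peak_sum (Suc m) (c(Suc m := ?s))"
    by (simp only: peak_sum_def)
  also have "\<dots> = peak_sum m c + (if ?s \<le> c m then end_peak m c else 0)"
    using peak_sum_cong[of m "c(Suc m := ?s)" c] end_peak_cong[of m "c(Suc m := ?s)" c]
    by (simp add: peak_sum_Suc)
  finally have P: "\<Sum>?P = peak_sum m c + (if ?s \<le> c m then end_peak m c else 0)" .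
  have "?L = (if c (n - 1) < 2 * c n then {n} else {}) \<union> (if c (n - 1) < 2 * c (Suc n) then {Suc n} else {})"
    by auto
  then have L: "\<Sum>?L = (if c (n - 1) < 2 * c n then n else 0) + (if c (n - 1) < 2 * c (Suc n) then Suc n else 0)"
    by simp
  have "\<Sum>(code_descents n c) = \<Sum>?P + \<Sum>?L"
    unfolding code_descents_def by (rule sum.union_disjoint) auto
  then show ?thesis
    using P L m by simp
qed

lemma path_code_le: "path_code c m \<Longrightarrow> i \<le> m \<Longrightarrow> c i \<le> i"
proof (induction i)
  case (Suc i)
  then have "walk_step (c i) (c (Suc i))"
    by (auto simp: path_code_def)
  then show ?case
    using Suc by (auto simp: walk_step_def)
qed (simp add: path_code_def)

lemma path_code_cong: "(\<And>i. i \<le> m \<Longrightarrow> c i = c' i) \<Longrightarrow> path_code c m \<longleftrightarrow> path_code c' m"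
  by (auto simp: path_code_def)

lemma fork_code_pairs:
  "{(b, e). fork_code k b e} =
    (if k = 0 then {(0, 0), (1, 1), (1, 0), (0, 1)} else if k = 1 then {(0, 0)}
     else if even k then {(k div 2, k div 2 - 1), (k div 2 - 1, k div 2), (k div 2 + 1, k div 2), (k div 2, k div 2 + 1)}
     else {})"
  by (auto simp: fork_code_def elim!: evenE)

text \<open>Here \<open>k\<close> is the height at the branching vertex. At 0 there is no leaf, one
  of them, or both. At even \<open>k > 0\<close>, two choices have leaf total \<open>k - 1\<close>
  and leave a possible peak at \<open>n - 1\<close>; the other two have total \<open>k + 1\<close>
  and make the leaf in excess a descent.\<close>

definition fork_gf :: "'a::comm_ring_1 \<Rightarrow> nat \<Rightarrow> nat \<Rightarrow> 'a" where
  "fork_gf q n k =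
    (if k = 0 then (1 + q ^ n + q ^ (n + 1) + q ^ (2 * n + 1)) * walk_gf q (n - 1) 0
     else if k = 1 then closed_walk_gf q (n - 1) 1
     else if even k then 2 * closed_walk_gf q (n - 1) k + (q ^ n + q ^ (n + 1)) * walk_gf q (n - 1) k
     else 0)"

lemma sum_alternating_codes:
  fixes q :: "'a::comm_ring_1"
  assumes "1 \<le> n"
  shows "(\<Sum>c | c \<in> codes n \<and> alternating_code n c. q ^ \<Sum>(code_descents n c)) = (\<Sum>k\<le>n - 1. fork_gf q n k)"
proof -
  let ?wt = "\<lambda>k b e c. peak_sum (n - 1) c + (if b + e \<le> k then end_peak (n - 1) c else 0) +
    (if k < 2 * b then n else 0) + (if k < 2 * e then Suc n else 0)"
  let ?A = "{c. c \<in> codes n \<and> alternating_code n c}"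
  let ?to = "\<lambda>(k :: nat, (b, e), c). c(n := b, Suc n := e)"
  let ?from = "\<lambda>c :: nat \<Rightarrow> nat. (c (n - 1), (c n, c (Suc n)), \<lambda>i. if i < n then c i else 0)"
  let ?I = "Sigma {..n - 1} (\<lambda>k. {(b, e). fork_code k b e} \<times> walks (n - 1) k)"
  have "(\<Sum>c\<in>?A. q ^ \<Sum>(code_descents n c)) = (\<Sum>(k, (b, e), c)\<in>?I. q ^ ?wt k b e c)"
  proof (rule sum.reindex_bij_witness[of _ ?to ?from])
    fix c assume c: "c \<in> ?A"
    have path: "path_code c (n - 1)" "fork_code (c (n - 1)) (c n) (c (Suc n))" "\<forall>i>Suc n. c i = 0"
      using c by (auto simp: codes_def alternating_code_def)
    show "?to (?from c) = c"
      using path(3) assms by (auto simp: fun_eq_iff not_less)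
    have trunc: "peak_sum (n - 1) (\<lambda>i. if i < n then c i else 0) = peak_sum (n - 1) c"
      "end_peak (n - 1) (\<lambda>i. if i < n then c i else 0) = end_peak (n - 1) c"
      using assms by (intro peak_sum_cong end_peak_cong; simp)+
    have "path_code (\<lambda>i. if i < n then c i else 0) (n - 1)"
      using path(1) assms by (subst path_code_cong[of _ _ c]) auto
    then show "?from c \<in> ?I"
      using path path_code_le[OF path(1)] assms by (auto simp: walks_def)
    show "(\<lambda>(k, (b, e), c). q ^ ?wt k b e c) (?from c) = q ^ \<Sum>(code_descents n c)"
      using trunc assms by (simp add: sum_code_descents)
  next
    fix x assume "x \<in> ?I"
    then obtain k b e c where x: "x = (k, (b, e), c)" "fork_code k b e" "c \<in> walks (n - 1) k"
      by auto
    then have c: "path_code c (n - 1)" "c (n - 1) = k" "\<forall>i>n - 1. c i = 0"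
      by (auto simp: walks_def)
    show "?from (?to x) = x"
      using x c assms by (auto simp: fun_eq_iff)
    have "path_code (c(n := b, Suc n := e)) (n - 1)"
      using c(1) assms by (subst path_code_cong[of _ _ c]) auto
    moreover have "c 0 = 0"
      using c(1) by (simp add: path_code_def)
    ultimately show "?to x \<in> ?A"
      using x c assms by (auto simp: codes_def alternating_code_def)
  qed
  also have "\<dots> = (\<Sum>k\<le>n - 1. \<Sum>((b, e), c)\<in>{(b, e). fork_code k b e} \<times> walks (n - 1) k. q ^ ?wt k b e c)"
    by (rule sum.Sigma[symmetric]) (auto simp: fork_code_pairs)
  also have "\<dots> = (\<Sum>k\<le>n - 1. fork_gf q n k)"
  proof (rule sum.cong[OF HOL.refl])
    fix k
    have inner: "(\<Sum>c\<in>walks (n - 1) k. q ^ ?wt k b e c) =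
      (if b + e \<le> k then closed_walk_gf q (n - 1) k else walk_gf q (n - 1) k) *
      q ^ ((if k < 2 * b then n else 0) + (if k < 2 * e then Suc n else 0))" for b e
      by (auto simp: walk_gf_def closed_walk_gf_def sum_distrib_right power_add mult.assoc)
    have "(\<Sum>((b, e), c)\<in>{(b, e). fork_code k b e} \<times> walks (n - 1) k. q ^ ?wt k b e c)
      = (\<Sum>(b, e)\<in>{(b, e). fork_code k b e}. \<Sum>c\<in>walks (n - 1) k. q ^ ?wt k b e c)"
      by (subst sum.cartesian_product[symmetric]) (simp add: split_beta)
    also have "\<dots> = (\<Sum>(b, e)\<in>{(b, e). fork_code k b e}.
      (if b + e \<le> k then closed_walk_gf q (n - 1) k else walk_gf q (n - 1) k) *
      q ^ ((if k < 2 * b then n else 0) + (if k < 2 * e then Suc n else 0)))"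
      by (simp only: inner)
    also have "\<dots> = fork_gf q n k"
    proof -
      consider "k = 0" | "k = 1" | i where "k = 2 * Suc i" | "odd k" "k \<noteq> 1"
        by (metis dvdE not0_implies_Suc mult_0_right)
      then show ?thesis
      proof cases
        case 1
        have "q ^ (2 * n + 1) = q ^ n * q ^ (n + 1)"
          by (simp add: mult_2 power_add)
        with 1 show ?thesis
          unfolding fork_code_pairs fork_gf_def
          by (simp add: closed_walk_gf_at_0 power_add algebra_simps)
      next
        case (3 i)
        then show ?thesis
          unfolding fork_code_pairs
          by (simp add: fork_gf_def algebra_simps)
      next
        case 4
        then have "k \<noteq> 0"
          by (metis even_zero)
        with 4 show ?thesis
          unfolding fork_code_pairs fork_gf_def by simp
      qed (simp add: fork_code_pairs fork_gf_def)
    qed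
    finally show "(\<Sum>((b, e), c)\<in>{(b, e). fork_code k b e} \<times> walks (n - 1) k. q ^ ?wt k b e c) = fork_gf q n k" .
  qed
  finally show ?thesis .
qed

lemma nested_code_unique:
  assumes "nested_code n c h" "nested_code n c h'"
  shows "h = h'"
proof -
  have False if "nested_code n c h" "nested_code n c h'" "h < h'" for h h'
  proof -
    have "c (h' - 1) = 2" "c (h' - 1) \<in> {0, 1, 3}"
      using that by (auto simp: nested_code_def)
    then show False by simp
  qed
  then show ?thesis
    using assms by (meson linorder_neqE_nat)
qed

text \<open>On the plateau of height 2 only its first position \<open>h\<close> can be reached from
  below; if it is reached from above, a peak at \<open>h - 1\<close> is possible instead.\<close>

lemma peak_sum_nested:
  assumes "1 \<le> h" "h \<le> m" "\<And>j. h \<le> j \<Longrightarrow> j \<le> m \<Longrightarrow> c j = 2"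
  shows "peak_sum m c + end_peak m c =
    peak_sum (h - 1) c + (if 2 \<le> c (h - 1) then end_peak (h - 1) c else 0) + (if c (h - 1) < 2 then h else 0)"
  using assms(2,3)
proof (induction m rule: dec_induct)
  case base
  then show ?case
    using assms(1) peak_sum_Suc[of "h - 1" c] by (simp add: end_peak_def)
next
  case (step m)
  then show ?case
    using peak_sum_Suc[of m c] by (simp add: end_peak_def)
qed

text \<open>From height 0 or 1 the entry into the plateau makes \<open>h\<close> a descent. From
  height 3 the plateau lies below, so the walk is closed at \<open>h - 1\<close> and
  \<open>h\<close> contributes nothing.\<close>

lemma sum_nested_codes:
  fixes q :: "'a::comm_ring_1"
  assumes "1 \<le> n"
  shows "(\<Sum>c | c \<in> codes n \<and> (\<exists>h. nested_code n c h). q ^ \<Sum>(code_descents n c)) =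
    (\<Sum>h=1..n - 1. q ^ h * (walk_gf q (h - 1) 0 + walk_gf q (h - 1) 1) + closed_walk_gf q (h - 1) 3)"
proof -
  let ?A = "{c. c \<in> codes n \<and> (\<exists>h. nested_code n c h)}"
  let ?I = "Sigma {1..n - 1} (\<lambda>h. Sigma {0, 1, 3} (\<lambda>x. walks (h - 1) x))"
  let ?wt = "\<lambda>h x c. peak_sum (h - 1) c + (if x = 3 then end_peak (h - 1) c else h)"
  let ?to = "\<lambda>(h, x::nat, c) j. if j < h then c j else if j < n then 2 else if j \<le> Suc n then 1 else 0 :: nat"
  let ?from = "\<lambda>c. let h = (THE h. nested_code n c h) in (h, c (h - 1), \<lambda>i. if i < h then c i else 0)"
  have the: "(THE h. nested_code n c h) = h" if "nested_code n c h" for c h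
    using that nested_code_unique by blast
  have "(\<Sum>c\<in>?A. q ^ \<Sum>(code_descents n c)) = (\<Sum>(h, x, c)\<in>?I. q ^ ?wt h x c)"
  proof (rule sum.reindex_bij_witness[of _ ?to ?from])
    fix c assume c: "c \<in> ?A"
    then obtain h where h: "nested_code n c h"
      by blast
    have frm: "?from c = (h, c (h - 1), \<lambda>i. if i < h then c i else 0)"
      using the[OF h] by simp
    have h': "1 \<le> h" "h < n" "path_code c (h - 1)" "c (h - 1) \<in> {0, 1, 3}"
      "\<And>j. h \<le> j \<Longrightarrow> j < n \<Longrightarrow> c j = 2" "c n = 1" "c (Suc n) = 1" "\<And>i. i > Suc n \<Longrightarrow> c i = 0"
      using h c by (auto simp: nested_code_def codes_def)
    show "?to (?from c) = c"
      unfolding frm using h' by (auto simp: fun_eq_iff not_less le_Suc_eq)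
    have "path_code (\<lambda>i. if i < h then c i else 0) (h - 1)"
      using h'(1,3) by (subst path_code_cong[of _ _ c]) auto
    then show "?from c \<in> ?I"
      unfolding frm using h' by (auto simp: walks_def)
    have trunc: "peak_sum (h - 1) (\<lambda>i. if i < h then c i else 0) = peak_sum (h - 1) c"
      "end_peak (h - 1) (\<lambda>i. if i < h then c i else 0) = end_peak (h - 1) c"
      using h'(1) by (intro peak_sum_cong end_peak_cong; simp)+
    have "c (n - 1) = 2"
      using h'(1,2) by (intro h'(5)) auto
    then have "\<Sum>(code_descents n c) = peak_sum (n - 1) c + end_peak (n - 1) c"
      using sum_code_descents[OF assms, of c] h'(6,7) by simp
    also have "\<dots> = peak_sum (h - 1) c + (if 2 \<le> c (h - 1) then end_peak (h - 1) c else 0) +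
        (if c (h - 1) < 2 then h else 0)"
      using h'(1,2) by (intro peak_sum_nested h'(5)) auto
    also have "\<dots> = ?wt h (c (h - 1)) c"
      using h'(4) by auto
    finally show "(case ?from c of (h, x, c) \<Rightarrow> q ^ ?wt h x c) = q ^ \<Sum>(code_descents n c)"
      unfolding frm by (simp add: trunc[unfolded One_nat_def])
  next
    fix x assume "x \<in> ?I"
    then obtain h k c where x: "x = (h, k, c)" "1 \<le> h" "h < n" "k \<in> {0, 1, 3}" "c \<in> walks (h - 1) k"
      using assms by auto
    then have c: "path_code c (h - 1)" "c (h - 1) = k" "\<forall>i>h - 1. c i = 0" "c 0 = 0"
      by (auto simp: walks_def path_code_def)
    have "path_code (?to x) (h - 1)"
      unfolding x(1) using c(1) x(2) by (subst path_code_cong[of _ _ c]) auto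
    then have nested: "nested_code n (?to x) h"
      using x c by (auto simp: nested_code_def)
    show "?from (?to x) = x"
      unfolding the[OF nested] Let_def using x c by (auto simp: fun_eq_iff)
    show "?to x \<in> ?A"
      using nested x c by (auto simp: codes_def)
  qed
  also have "\<dots> = (\<Sum>h=1..n - 1. \<Sum>(x, c)\<in>Sigma {0, 1, 3} (\<lambda>x. walks (h - 1) x). q ^ ?wt h x c)"
    by (rule sum.Sigma[symmetric]) auto
  also have "\<dots> = (\<Sum>h=1..n - 1. q ^ h * (walk_gf q (h - 1) 0 + walk_gf q (h - 1) 1) + closed_walk_gf q (h - 1) 3)"
  proof (rule sum.cong[OF HOL.refl])
    fix h
    have "(\<Sum>(x, c)\<in>Sigma {0, 1, 3} (\<lambda>x. walks (h - 1) x). q ^ ?wt h x c)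
      = (\<Sum>x\<in>{0, 1, 3}. \<Sum>c\<in>walks (h - 1) x. q ^ ?wt h x c)"
      by (rule sum.Sigma[symmetric]) auto
    also have "\<dots> = q ^ h * (walk_gf q (h - 1) 0 + walk_gf q (h - 1) 1) + closed_walk_gf q (h - 1) 3"
      by (simp add: walk_gf_def closed_walk_gf_def power_add sum_distrib_left algebra_simps)
    finally show "(\<Sum>(x, c)\<in>Sigma {0, 1, 3} (\<lambda>x. walks (h - 1) x). q ^ ?wt h x c)
      = q ^ h * (walk_gf q (h - 1) 0 + walk_gf q (h - 1) 1) + closed_walk_gf q (h - 1) 3" .
  qed
  finally show ?thesis .
qed

lemma finite_codes: "1 \<le> n \<Longrightarrow> finite (codes n)"
proof -
  assume n: "1 \<le> n"
  have "codes n \<subseteq> {c. (\<forall>j\<in>{..Suc n}. c j \<in> {..n + 2}) \<and> (\<forall>j. j \<notin> {..Suc n} \<longrightarrow> c j = 0)}"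
  proof
    fix c assume c: "c \<in> codes n"
    have "c j \<le> n + 2" for j
    proof (cases "\<exists>h. nested_code n c h")
      case True
      then obtain h where h: "nested_code n c h"
        by blast
      consider "j < h" | "h \<le> j" "j < n" | "j = n \<or> j = Suc n" | "Suc n < j"
        by linarith
      then show ?thesis
      proof cases
        case 1
        then have "j \<le> h - 1"
          by simp
        then show ?thesis
          using path_code_le[of c "h - 1" j] h by (auto simp: nested_code_def)
      qed (use h c in \<open>auto simp: nested_code_def codes_def\<close>)
    next
      case False
      then have alt: "path_code c (n - 1)" "fork_code (c (n - 1)) (c n) (c (Suc n))"
        using c by (auto simp: codes_def alternating_code_def)
      have le: "c j \<le> n" if "j < n" for j
      proof -
        have "j \<le> n - 1"
          using that by simp
        then show ?thesis
          using path_code_le[OF alt(1), of j] by simp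
      qed
      consider "j < n" | "j = n" | "j = Suc n" | "Suc n < j"
        by linarith
      then show ?thesis
      proof cases
        case 1
        then show ?thesis using le[of j] by simp
      qed (use alt(2) le[of "n - 1"] n c in \<open>auto simp: fork_code_def codes_def\<close>)
    qed
    then show "c \<in> {c. (\<forall>j\<in>{..Suc n}. c j \<in> {..n + 2}) \<and> (\<forall>j. j \<notin> {..Suc n} \<longrightarrow> c j = 0)}"
      using c by (auto simp: codes_def)
  qed
  moreover have "finite {c. (\<forall>j\<in>{..Suc n}. c j \<in> {..n + 2}) \<and> (\<forall>j. j \<notin> {..Suc n} \<longrightarrow> c j = (0::nat))}"
    by (rule finite_set_of_finite_funs[of "{..Suc n}" "{..n + 2}" 0, THEN finite_subset[rotated]]) auto
  ultimately show ?thesis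
    by (rule finite_subset)
qed

lemma sum_codes:
  fixes q :: "'a::comm_ring_1"
  assumes "1 \<le> n"
  shows "(\<Sum>c\<in>codes n. q ^ \<Sum>(code_descents n c)) = (\<Sum>k\<le>n - 1. fork_gf q n k) +
    (\<Sum>h=1..n - 1. q ^ h * (walk_gf q (h - 1) 0 + walk_gf q (h - 1) 1) + closed_walk_gf q (h - 1) 3)"
proof -
  have False if "alternating_code n c" "nested_code n c h" for c h
  proof -
    have "c (n - 1) = 2" "c n = 1" "c (Suc n) = 1"
      using that(2) by (auto simp: nested_code_def)
    then show False
      using that(1) by (simp add: alternating_code_def fork_code_def)
  qed
  then have "{c. c \<in> codes n \<and> alternating_code n c} \<inter> {c. c \<in> codes n \<and> (\<exists>h. nested_code n c h)} = {}"
    by blast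
  moreover have "codes n = {c. c \<in> codes n \<and> alternating_code n c} \<union> {c. c \<in> codes n \<and> (\<exists>h. nested_code n c h)}"
    by (auto simp: codes_def)
  ultimately have "(\<Sum>c\<in>codes n. q ^ \<Sum>(code_descents n c)) =
      (\<Sum>c | c \<in> codes n \<and> alternating_code n c. q ^ \<Sum>(code_descents n c)) +
      (\<Sum>c | c \<in> codes n \<and> (\<exists>h. nested_code n c h). q ^ \<Sum>(code_descents n c))"
    using finite_codes[OF assms] by (metis (no_types, lifting) finite_Un sum.union_disjoint)
  then show ?thesis
    by (simp only: sum_alternating_codes[OF assms] sum_nested_codes[OF assms])
qed

section \<open>The generating function\<close>

lemma sum_lessThan_double: "(\<Sum>k<2 * (N::nat). f k) = (\<Sum>i<N. f (2 * i) + f (2 * i + 1))"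
  for f :: "nat \<Rightarrow> 'a::comm_monoid_add"
  by (induction N) (simp_all add: algebra_simps)

lemma sum_atMost_pairs:
  "(\<Sum>j\<le>M + 2 * N. f j) = (\<Sum>j\<le>M. f j) + (\<Sum>i=1..N. f (M + 2 * i - 1) + f (M + 2 * i))"
  for f :: "nat \<Rightarrow> 'a::comm_monoid_add"
  by (induction N) (simp_all add: algebra_simps)

lemma closed_walk_gf_zero: "m < k \<Longrightarrow> closed_walk_gf qvar m k = 0"
proof (cases k)
  case (Suc i)
  moreover assume "m < k"
  ultimately show ?thesis
    unfolding Suc closed_walk_gf_eq by (intro sum.neutral) (auto simp: walk_gf_zero)
qed simp

abbreviation even_walks :: "nat \<Rightarrow> rat poly fract" where
  "even_walks N \<equiv> (\<Sum>i=0..N. walk_gf qvar N (2 * i))"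

abbreviation even_closed_walks :: "nat \<Rightarrow> rat poly fract" where
  "even_closed_walks N \<equiv> (\<Sum>i=1..N. closed_walk_gf qvar N (2 * i))"

text \<open>The two single-leaf terms at \<open>k = 0\<close> have the same factor
  \<open>q^n + q^(n+1)\<close> as those at even \<open>k > 0\<close> and complete
  \<open>even_walks\<close> at \<open>i = 0\<close>.\<close>

lemma sum_fork_gf:
  assumes "1 \<le> n"
  shows "(\<Sum>k\<le>n - 1. fork_gf qvar n k) =
    (1 + qvar ^ (2 * n + 1)) * walk_gf qvar (n - 1) 0 + closed_walk_gf qvar (n - 1) 1 +
    2 * even_closed_walks (n - 1) + qvar ^ n * (1 + qvar) * even_walks (n - 1)"
proof -
  let ?N = "n - 1"
  have zero: "fork_gf qvar n k = 0" if "?N < k" for k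
    using that by (auto simp: fork_gf_def walk_gf_zero closed_walk_gf_zero)
  have "(\<Sum>k\<le>?N. fork_gf qvar n k) = (\<Sum>k<2 * Suc ?N. fork_gf qvar n k)"
    by (rule sum.mono_neutral_left) (auto simp: zero)
  also have "\<dots> = (\<Sum>i<Suc ?N. fork_gf qvar n (2 * i) + fork_gf qvar n (2 * i + 1))"
    by (rule sum_lessThan_double)
  also have "\<dots> = fork_gf qvar n 0 + fork_gf qvar n 1 +
      (\<Sum>i=1..?N. fork_gf qvar n (2 * i) + fork_gf qvar n (2 * i + 1))"
    by (simp add: lessThan_Suc_atMost atMost_atLeast0 sum.atLeast_Suc_atMost)
  also have "(\<Sum>i=1..?N. fork_gf qvar n (2 * i) + fork_gf qvar n (2 * i + 1)) =
      (\<Sum>i=1..?N. 2 * closed_walk_gf qvar ?N (2 * i) + qvar ^ n * (1 + qvar) * walk_gf qvar ?N (2 * i))"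
    by (rule sum.cong) (auto simp: fork_gf_def algebra_simps)
  also have "\<dots> = 2 * even_closed_walks ?N + qvar ^ n * (1 + qvar) * (\<Sum>i=1..?N. walk_gf qvar ?N (2 * i))"
    by (simp add: sum.distrib sum_distrib_left)
  also have "(\<Sum>i=1..?N. walk_gf qvar ?N (2 * i)) = even_walks ?N - walk_gf qvar ?N 0"
    by (simp add: sum.atLeast_Suc_atMost)
  finally show ?thesis
    by (simp add: fork_gf_def algebra_simps)
qed

text \<open>For odd \<open>N\<close> each even height has the same generating function as the next
  height, for even \<open>N\<close> as the preceding one, and then height 0 has no partner.\<close>

lemma double_even_walks:
  "2 * even_walks N = (\<Sum>j=0..N. walk_gf qvar N j) + (if even N then walk_gf qvar N 0 else 0)"
proof -
  let ?f = "walk_gf qvar N"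
  have "(\<Sum>j=0..N. ?f j) = (\<Sum>j<2 * Suc N. ?f j)"
    by (rule sum.mono_neutral_left) (auto simp: walk_gf_zero)
  also have "\<dots> = (\<Sum>i<Suc N. ?f (2 * i) + ?f (2 * i + 1))"
    by (rule sum_lessThan_double)
  also have "\<dots> = even_walks N + (\<Sum>i=0..N. ?f (2 * i + 1))"
    by (simp add: sum.distrib lessThan_Suc_atMost atMost_atLeast0)
  also have "(\<Sum>i=0..N. ?f (2 * i + 1)) = even_walks N - (if even N then ?f 0 else 0)"
  proof (cases "even N")
    case True
    have "(\<Sum>i=0..N. ?f (2 * i + 1)) = (\<Sum>i=0..N. ?f (2 * Suc i))"
      using walk_gf_parity[of N] True by (intro sum.cong) auto
    also have "\<dots> = (\<Sum>i=0..Suc N. ?f (2 * i)) - ?f 0"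
      by (subst sum.atLeast0_atMost_Suc_shift) simp
    also have "(\<Sum>i=0..Suc N. ?f (2 * i)) = even_walks N"
      by (simp add: walk_gf_zero)
    finally show ?thesis
      using True by simp
  next
    case False
    then show ?thesis
      using walk_gf_parity[of N] by (auto intro!: sum.cong)
  qed
  finally show ?thesis
    by simp
qed

text \<open>The coefficient of \<open>qvar ^ h\<close> in the identity \<open>double_even_closed_walks\<close> below.\<close>

lemma walk_gf_balance:
  assumes "1 \<le> h" "h \<le> N"
  defines "f \<equiv> walk_gf qvar (h - 1)"
  shows "2 * (\<Sum>i=1..N. f (2 * i - 1 + N - h)) + (\<Sum>j\<le>N - h + 1. f j) =
    f (N - h + 1) + (\<Sum>j=0..h - 1. f j) + (if even N then f (N - h + 1) else 0)"
proof -
  let ?M = "N - h"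
  let ?a = "\<lambda>i. f (?M + 2 * i - 1)"
  have "(\<Sum>j=0..h - 1. f j) = (\<Sum>j\<le>?M + 2 * N. f j)"
    using assms by (intro sum.mono_neutral_left) (auto simp: walk_gf_zero)
  also have "\<dots> = (\<Sum>j\<le>?M. f j) + ((\<Sum>i=1..N. ?a i) + (\<Sum>i=1..N. f (?M + 2 * i)))"
    by (simp add: sum_atMost_pairs sum.distrib)
  finally have total: "(\<Sum>j=0..h - 1. f j) = (\<Sum>j\<le>?M. f j) + ((\<Sum>i=1..N. ?a i) + (\<Sum>i=1..N. f (?M + 2 * i)))" .
  have shift: "(\<Sum>i=1..N. f (2 * i - 1 + N - h)) = (\<Sum>i=1..N. ?a i)"
    using assms by (intro sum.cong arg_cong[of _ _ f]) auto
  \<comment> \<open>Since \<open>h - 1 + ?M = N - 1\<close>, the parity of \<open>N\<close> alone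
    decides the pairing: for even \<open>N\<close> height \<open>?M + 2 * i\<close> goes with the
    next one and \<open>?M + 1\<close> stays single, for odd \<open>N\<close> it goes with the
    preceding one.\<close>
  have "(\<Sum>i=1..N. ?a i) = (\<Sum>i=1..N. f (?M + 2 * i)) + (if even N then f (?M + 1) else 0)"
  proof (cases "even N")
    case True
    have "(\<Sum>i=1..N. f (?M + 2 * i)) = (\<Sum>i=1..N. ?a (Suc i))"
    proof (rule sum.cong[OF HOL.refl])
      fix i assume "i \<in> {1..N}"
      have "odd (h - 1 + (?M + 2 * i))"
        using True assms by (simp add: even_diff_nat)
      then show "f (?M + 2 * i) = ?a (Suc i)"
        unfolding f_def using walk_gf_parity by simp
    qed
    also have "\<dots> = (\<Sum>i=1..N. ?a i) + ?a (Suc N) - ?a 1"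
    proof -
      have "(\<Sum>i=1..N. ?a (Suc i)) = (\<Sum>i=Suc 1..Suc N. ?a i)"
        by (rule sum.shift_bounds_cl_Suc_ivl[symmetric])
      also have "\<dots> = (\<Sum>i=1..Suc N. ?a i) - ?a 1"
        by (subst (2) sum.atLeast_Suc_atMost) auto
      finally show ?thesis
        by simp
    qed
    also have "?a (Suc N) = 0"
      unfolding f_def using assms by (intro walk_gf_zero) auto
    finally show ?thesis
      using True by simp
  next
    case False
    have "?a i = f (?M + 2 * i)" if "i \<in> {1..N}" for i
    proof -
      have "odd (h - 1 + (?M + 2 * i - 1))"
        using False assms that by (simp add: even_diff_nat)
      then show ?thesis
        unfolding f_def using walk_gf_parity[of "h - 1" "?M + 2 * i - 1"] that by simp
    qed
    then show ?thesis
      using False by simp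
  qed
  then show ?thesis
    using total unfolding shift by simp
qed

text \<open>Split at the last up-step \<open>h\<close> and interchange the sums: for a plateau
  starting at \<open>H\<close>, the height before that step is \<open>j = H + 1 - h\<close>.\<close>

lemma sum_nested_gf:
  "(\<Sum>h=1..N. closed_walk_gf qvar (h - 1) 3) =
    (\<Sum>h=1..N. qvar ^ h * (\<Sum>j=2..N - h + 1. walk_gf qvar (h - 1) j))"
proof -
  have "closed_walk_gf qvar (H - 1) 3 = (\<Sum>h | h \<in> {1..N} \<and> h < H. qvar ^ h * walk_gf qvar (h - 1) (H + 1 - h))"
    if "H \<in> {1..N}" for H
  proof -
    have "closed_walk_gf qvar (H - 1) 3 = (\<Sum>h=1..H - 1. qvar ^ h * walk_gf qvar (h - 1) (2 + (H - 1) - h))"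
      using closed_walk_gf_eq[of qvar "H - 1" 2] by simp
    also have "\<dots> = (\<Sum>h | h \<in> {1..N} \<and> h < H. qvar ^ h * walk_gf qvar (h - 1) (H + 1 - h))"
      using that by (intro sum.cong) auto
    finally show ?thesis .
  qed
  then have "(\<Sum>H=1..N. closed_walk_gf qvar (H - 1) 3) =
      (\<Sum>H=1..N. \<Sum>h | h \<in> {1..N} \<and> h < H. qvar ^ h * walk_gf qvar (h - 1) (H + 1 - h))"
    by (intro sum.cong) auto
  also have "\<dots> = (\<Sum>h=1..N. \<Sum>H | H \<in> {1..N} \<and> h < H. qvar ^ h * walk_gf qvar (h - 1) (H + 1 - h))"
    by (rule sum.swap_restrict) auto
  also have "\<dots> = (\<Sum>h=1..N. qvar ^ h * (\<Sum>j=2..N - h + 1. walk_gf qvar (h - 1) j))"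
  proof (rule sum.cong[OF HOL.refl])
    fix h assume h: "h \<in> {1..N}"
    have "(\<Sum>H | H \<in> {1..N} \<and> h < H. walk_gf qvar (h - 1) (H + 1 - h)) = (\<Sum>j=2..N - h + 1. walk_gf qvar (h - 1) j)"
      using h by (intro sum.reindex_bij_witness[of _ "\<lambda>j. j + h - 1" "\<lambda>H. H + 1 - h"]) auto
    then show "(\<Sum>H | H \<in> {1..N} \<and> h < H. qvar ^ h * walk_gf qvar (h - 1) (H + 1 - h))
      = qvar ^ h * (\<Sum>j=2..N - h + 1. walk_gf qvar (h - 1) j)"
      by (simp flip: sum_distrib_left)
  qed
  finally show ?thesis .
qed

text \<open>Every sum is split at the last up-step \<open>h\<close>. The doubled even sum accounts
  for heights from \<open>N - h + 1\<close> on, up to pairing, and the nested codes supply exactly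
  the heights up to \<open>N - h + 1\<close>; together they give all heights, with this one
  repeated.\<close>

lemma double_even_closed_walks:
  "2 * even_closed_walks N +
    (\<Sum>h=1..N. qvar ^ h * (walk_gf qvar (h - 1) 0 + walk_gf qvar (h - 1) 1) + closed_walk_gf qvar (h - 1) 3) =
   closed_walk_gf qvar N 2 + (\<Sum>h=1..N. qvar ^ h * (\<Sum>j=0..h - 1. walk_gf qvar (h - 1) j)) +
    (if even N then \<Sum>h=1..N. qvar ^ h * walk_gf qvar (h - 1) (N - h + 1) else 0)"
proof -
  let ?f = "\<lambda>h. walk_gf qvar (h - 1)"
  have "even_closed_walks N = (\<Sum>i=1..N. \<Sum>h=1..N. qvar ^ h * ?f h (2 * i - 1 + N - h))"
  proof (rule sum.cong[OF HOL.refl])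
    fix i assume "i \<in> {1..N}"
    then show "closed_walk_gf qvar N (2 * i) = (\<Sum>h=1..N. qvar ^ h * ?f h (2 * i - 1 + N - h))"
      using closed_walk_gf_eq[of qvar N "2 * i - 1"] by simp
  qed
  also have "\<dots> = (\<Sum>h=1..N. qvar ^ h * (\<Sum>i=1..N. ?f h (2 * i - 1 + N - h)))"
    by (subst sum.swap) (simp add: sum_distrib_left)
  finally have closed: "2 * even_closed_walks N = (\<Sum>h=1..N. qvar ^ h * (2 * (\<Sum>i=1..N. ?f h (2 * i - 1 + N - h))))"
    by (simp add: sum_distrib_left mult.left_commute)
  have "(\<Sum>j\<le>N - h + 1. ?f h j) = ?f h 0 + ?f h 1 + (\<Sum>j=2..N - h + 1. ?f h j)" for h
    by (simp add: atMost_atLeast0 sum.atLeast_Suc_atMost numeral_2_eq_2)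
  then have nested: "(\<Sum>h=1..N. qvar ^ h * (?f h 0 + ?f h 1) + closed_walk_gf qvar (h - 1) 3) =
      (\<Sum>h=1..N. qvar ^ h * (\<Sum>j\<le>N - h + 1. ?f h j))"
    unfolding sum.distrib sum_nested_gf by (simp add: algebra_simps flip: sum.distrib)
  have "closed_walk_gf qvar N 2 = (\<Sum>h=1..N. qvar ^ h * ?f h (N - h + 1))"
    using closed_walk_gf_eq[of qvar N 1] by (auto simp: numeral_2_eq_2 Suc_diff_le intro!: sum.cong)
  then have "closed_walk_gf qvar N 2 + (\<Sum>h=1..N. qvar ^ h * (\<Sum>j=0..h - 1. ?f h j)) +
      (if even N then \<Sum>h=1..N. qvar ^ h * ?f h (N - h + 1) else 0) =
    (\<Sum>h=1..N. qvar ^ h * (?f h (N - h + 1) + (\<Sum>j=0..h - 1. ?f h j) + (if even N then ?f h (N - h + 1) else 0)))"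
    by (simp add: distrib_left sum.distrib)
  also have "\<dots> = (\<Sum>h=1..N. qvar ^ h * (2 * (\<Sum>i=1..N. ?f h (2 * i - 1 + N - h)) + (\<Sum>j\<le>N - h + 1. ?f h j)))"
  proof (rule sum.cong[OF HOL.refl])
    fix h assume "h \<in> {1..N}"
    then have "2 * (\<Sum>i=1..N. ?f h (2 * i - 1 + N - h)) + (\<Sum>j\<le>N - h + 1. ?f h j) =
        ?f h (N - h + 1) + (\<Sum>j=0..h - 1. ?f h j) + (if even N then ?f h (N - h + 1) else 0)"
      by (intro walk_gf_balance) auto
    then show "qvar ^ h * (?f h (N - h + 1) + (\<Sum>j=0..h - 1. ?f h j) + (if even N then ?f h (N - h + 1) else 0)) =
        qvar ^ h * (2 * (\<Sum>i=1..N. ?f h (2 * i - 1 + N - h)) + (\<Sum>j\<le>N - h + 1. ?f h j))"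
      by simp
  qed
  also have "\<dots> = 2 * even_closed_walks N + (\<Sum>h=1..N. qvar ^ h * (\<Sum>j\<le>N - h + 1. ?f h j))"
    unfolding closed by (simp add: distrib_left sum.distrib)
  finally show ?thesis
    unfolding nested by simp
qed

text \<open>A walk of length \<open>h - 1\<close> reaches height \<open>N - h + 1\<close> only if
  \<open>2 * h > N\<close>. Replacing \<open>h\<close> by \<open>N + 1 - h\<close> and reflecting
  the coefficient gives the form in \<open>P\<close>.\<close>

lemma correction_term:
  assumes "even N"
  shows "(\<Sum>h=1..N. qvar ^ h * walk_gf qvar (h - 1) (N - h + 1)) =
    (\<Sum>h=1..N div 2. qvar ^ (N + 1 - h) * qbinomial (N - h) (N div 2))"
proof -
  obtain r where r: "N = 2 * r"
    using assms by (elim evenE)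
  have "(\<Sum>h=1..N. qvar ^ h * walk_gf qvar (h - 1) (N - h + 1)) =
      (\<Sum>h=Suc r..N. qvar ^ h * walk_gf qvar (h - 1) (N - h + 1))"
    using r by (intro sum.mono_neutral_right) (auto simp: walk_gf_zero)
  also have "\<dots> = (\<Sum>h=1..r. qvar ^ (N + 1 - h) * walk_gf qvar (N - h) h)"
    using r by (intro sum.reindex_bij_witness[of _ "\<lambda>h. N + 1 - h" "\<lambda>h. N + 1 - h"]) (auto simp: Suc_diff_le)
  also have "\<dots> = (\<Sum>h=1..r. qvar ^ (N + 1 - h) * qbinomial (N - h) r)"
  proof (rule sum.cong[OF HOL.refl])
    fix h assume h: "h \<in> {1..r}"
    then have "(N - h - h) div 2 = N - h - r" "h \<le> N - h" "r \<le> N - h"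
      using r by auto
    then show "qvar ^ (N + 1 - h) * walk_gf qvar (N - h) h = qvar ^ (N + 1 - h) * qbinomial (N - h) r"
      by (simp only: walk_gf_qbinomial qbinomial_symmetric if_True)
  qed
  finally show ?thesis
    using r by simp
qed

lemma P_eq:
  assumes "1 \<le> n"
  defines "N \<equiv> n - 1"
  shows "P n = (\<Sum>h=1..N. qvar ^ h * (\<Sum>j=0..h - 1. walk_gf qvar (h - 1) j)) +
    qvar ^ n * (1 + qvar) * even_walks N +
    (if even N then \<Sum>h=1..N. qvar ^ h * walk_gf qvar (h - 1) (N - h + 1) else 0)"
proof -
  have n: "n = Suc N"
    using assms by simp
  have half: "even_walks N = 1 / 2 * (2 * even_walks N)"
    by simp
  have mid: "walk_gf qvar N 0 = qbinomial N (N div 2)"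
    by (simp add: walk_gf_qbinomial)
  show ?thesis
  proof (cases "even N")
    case True
    have corr: "(\<Sum>h=1..N. qvar ^ h * walk_gf qvar (h - 1) (N - h + 1)) =
        (\<Sum>h=1..(n - 1) div 2. qvar ^ (n - h) * qbinomial (n - h - 1) ((n - 1) div 2))"
      using correction_term[OF True] n by (auto intro!: sum.cong simp: Suc_diff_le)
    show ?thesis
      unfolding corr P_def using True n
      by (subst half, subst double_even_walks)
         (simp add: sum_qbinomial mid algebra_simps add_divide_distrib)
  next
    case False
    then show ?thesis
      unfolding P_def using n
      by (subst half, subst double_even_walks)
         (simp add: sum_qbinomial mid algebra_simps)
  qed
qed

theorem proposition2p7:
  fixes n :: nat
  assumes "n \<ge> 1"
  shows "(\<Sum>w\<in>fc_involutions (D_gens n) (D_matrix n). qvar ^ maj (D_gens n) (D_matrix n) w)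
    = P n + (qvar ^ (2 * n + 1) - qvar ^ n) * qbinomial (n - 1) ((n - 1) div 2)
      + qbinomial (n + 1) ((n + 1) div 2)"
proof -
  interpret type_D n
    by unfold_locales (rule assms)
  define N where "N = n - 1"
  have n: "n = Suc N"
    using assms by (simp add: N_def)
  have low: "qbinomial (n - 1) ((n - 1) div 2) = walk_gf qvar N 0"
    by (simp add: walk_gf_qbinomial N_def)
  \<comment> \<open>Removing the last two steps of a walk of length \<open>n + 1\<close> to height 0
    produces the closed terms that \<open>P\<close> does not account for. The by-product
    \<open>qvar ^ n * walk_gf qvar N 0\<close> is what the summand with \<open>- qvar ^ n\<close>
    cancels.\<close>
  have "qbinomial (n + 1) ((n + 1) div 2) = walk_gf qvar (Suc n) 0"
    by (simp add: walk_gf_qbinomial)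
  also have "\<dots> = walk_gf qvar n 0 + closed_walk_gf qvar n 1"
    by (rule walk_gf_Suc_0)
  also have "walk_gf qvar n 0 = walk_gf qvar N 0 + closed_walk_gf qvar N 1"
    unfolding n by (rule walk_gf_Suc_0)
  also have "closed_walk_gf qvar n 1 = qvar ^ n * walk_gf qvar N 0 + closed_walk_gf qvar N 2"
    using closed_walk_gf_Suc_Suc[of qvar N 0] n by (simp add: numeral_2_eq_2)
  finally have high: "qbinomial (n + 1) ((n + 1) div 2) =
      walk_gf qvar N 0 + closed_walk_gf qvar N 1 + (qvar ^ n * walk_gf qvar N 0 + closed_walk_gf qvar N 2)" .
  have "(\<Sum>w\<in>fc_involutions (D_gens n) (D_matrix n). qvar ^ maj (D_gens n) (D_matrix n) w) =
      (1 + qvar ^ (2 * n + 1)) * walk_gf qvar N 0 + closed_walk_gf qvar N 1 +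
      qvar ^ n * (1 + qvar) * even_walks N + (2 * even_closed_walks N +
      (\<Sum>h=1..N. qvar ^ h * (walk_gf qvar (h - 1) 0 + walk_gf qvar (h - 1) 1) + closed_walk_gf qvar (h - 1) 3))"
    unfolding sum_fc_involutions sum_codes[OF assms] sum_fork_gf[OF assms] N_def by (simp add: algebra_simps)
  also have "\<dots> = (1 + qvar ^ (2 * n + 1)) * walk_gf qvar N 0 + closed_walk_gf qvar N 1 +
      closed_walk_gf qvar N 2 + P n"
    unfolding double_even_closed_walks P_eq[OF assms] N_def by (simp add: algebra_simps)
  also have "\<dots> = P n + (qvar ^ (2 * n + 1) - qvar ^ n) * qbinomial (n - 1) ((n - 1) div 2)
      + qbinomial (n + 1) ((n + 1) div 2)"
    unfolding low high by (simp add: algebra_simps)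
  finally show ?thesis .
qed

end
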